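(* (1) The 2-parameter generating series $P_\Gamma(q,x)$ is a solution of the Cauchy problem $$\frac{\partial}{\partial q}P_\Gamma(q,x)=2Pe(q,x)P_\Gamma(q,x)+\frac{\partial}{\partial x}Pe(q,x)\Bigl(1+\frac{\partial}{\partial x}Pe(q,x)\Bigr),\qquad P_\Gamma(0,x)=P_\Gamma(x).$$ (2) The 2-parameter generating series $P_{Mas}(q,x)$ is a solution of the Cauchy problem $$\frac{\partial}{\partial q}P_{Mas}(q,x)=(x+Pe(q,x))P_{Mas}(q,x)+x^2\Bigl[2\frac{\partial}{\partial x}St(q,x)+St(q,x)P_\Gamma(q,x)+\frac{\partial}{\partial x}St(q,x)\frac{\partial}{\partial x}Pe(q,x)\Bigr],$$ $$P_{Mas}(0,x)=P_{Mas}(x).$$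
   Context: Polytopes are considered up to combinatorial equivalence. $\mathcal P$ is the ring freely generated as an abelian group by simple convex polytopes (addition is disjoint union, product is Cartesian product, the empty set is zero, the point is the unit). The derivation $d$ sends a polytope to the sum of its facets. Generating series are formal power series with coefficients in $\mathcal P\otimes\mathbb Q$. A building set on $[n+1]$ is a set $B\subseteq2^{[n+1]}$ of nonempty subsets containing all singletons, closed under unions of intersecting members; if $[n+1]\in B$, the nestohedron $P_B$ is the simple $n$-polytope $\sum_{S\in B}\operatorname{conv}(e_i\mid i\in S)$. $Pe^n$ and $St^n$ (permutohedron, stellahedron) are the nestohedra of the building sets of all nonempty vertex sets inducing connected subgraphs in the complete graph and the star graph on $[n+1]$, respectively. $P^0_{Mas}$, $P^0_\Gamma$ are points, $P^1_{Mas}$, $P^1_\Gamma$ are segments. For $n\ge2$, $P^n_{Mas}=P_{B(P,n)}$ with $B(P,n)$ consisting of all singletons of $[n+1]$, all $\{1,2\}\cup I$ with $I\subseteq\{3,\dots,n+1\}$, and all $\{1\}\cup J$ with $\varnothing\neq J\subseteq\{3,\dots,n\}$; and $P^n_\Gamma=P_{B(\Gamma,n)}$ with $B(\Gamma,n)$ consisting of all singletons of $[n+1]$, all subsets of $\{1,\dots,n\}$ with at least two elements, and all $\{1,n+1\}\cup J$ with $J\subseteq\{2,\dots,n\}$. Series: $$Pe(x)=\sum_{s\ge0}Pe^s\frac{x^{s+1}}{(s+1)!},\quad St(x)=\sum_{s\ge0}St^s\frac{x^s}{s!},\quad P_\Gamma(x)=\sum_{s\ge0}P_\Gamma^{s+1}\frac{x^s}{s!},\quad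 P_{Mas}(x)=\sum_{s\ge0}P^{s+2}_{Mas}\frac{x^{s+2}}{s!}.$$ For an $n$-dimensional polytope $P^n$ put $Q(P^n;q)=\sum_{k=0}^n(d^kP^n)\frac{q^k}{k!}$. The 2-parameter extension of a series $P(x)=\sum_n a_nP^nx^{n+n_0}$ is $P(q,x)=\sum_n a_nQ(P^n;q)x^{n+n_0}$; $Pe(q,x)$, $St(q,x)$, $P_\Gamma(q,x)$, $P_{Mas}(q,x)$ are the 2-parameter extensions of the four series above. *)

theory Defs
  imports
    "HOL-Analysis.Analysis"
    "HOL-Analysis.Finite_Function_Topology"
    "HOL-Computational_Algebra.Formal_Power_Series"
begin

section \<open>Simple polytopes and combinatorial equivalence\<close>

text \<open>
  The library's \<open>aff_dim\<close> and \<open>facet_of\<close> are restricted to the class \<open>euclidean_space\<close>.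
  Polytopes of all dimensions are needed in one type below, so both notions are restated for
  an arbitrary real vector space.  The dimension of a nonempty polytope is the dimension of
  the linear space parallel to its affine hull; the value for the empty set is irrelevant.
\<close>

definition pdim :: "'a::real_vector set \<Rightarrow> nat" where
  "pdim S = dim {x - y | x y. x \<in> S \<and> y \<in> S}"

definition facets :: "'a::real_vector set \<Rightarrow> 'a set set" where
  "facets S = {F. F face_of S \<and> F \<noteq> {} \<and> pdim F + 1 = pdim S}"

definition simple_polytope :: "'a::real_vector set \<Rightarrow> bool" where
  "simple_polytope S \<longleftrightarrow> polytope S \<and> S \<noteq> {} \<and>
     (\<forall>v. v extreme_point_of S \<longrightarrow> card {F \<in> facets S. v \<in> F} = pdim S)"

text \<open>
  Combinatorial equivalence is isomorphism of face lattices; \<open>face_of\<close> counts the empty set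
  and the whole polytope as faces.
\<close>

definition comb_equiv :: "'a::real_vector set \<Rightarrow> 'b::real_vector set \<Rightarrow> bool" where
  "comb_equiv S T \<longleftrightarrow> (\<exists>\<phi>. bij_betw \<phi> {F. F face_of S} {G. G face_of T} \<and>
     (\<forall>F F'. F face_of S \<longrightarrow> F' face_of S \<longrightarrow> (F \<subseteq> F' \<longleftrightarrow> \<phi> F \<subseteq> \<phi> F')))"

lemma comb_equiv_refl: "comb_equiv S S"
  unfolding comb_equiv_def by (rule exI[of _ id]) auto

lemma comb_equiv_sym:
  assumes "comb_equiv S T" shows "comb_equiv T S"
proof -
  obtain \<phi> where b: "bij_betw \<phi> {F. F face_of S} {G. G face_of T}"
    and m: "\<And>F F'. F face_of S \<Longrightarrow> F' face_of S \<Longrightarrow> (F \<subseteq> F' \<longleftrightarrow> \<phi> F \<subseteq> \<phi> F')"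
    using assms unfolding comb_equiv_def by blast
  let ?\<psi> = "inv_into {F. F face_of S} \<phi>"
  have b': "bij_betw ?\<psi> {G. G face_of T} {F. F face_of S}"
    using b by (rule bij_betw_inv_into)
  have "G \<subseteq> G' \<longleftrightarrow> ?\<psi> G \<subseteq> ?\<psi> G'" if "G face_of T" "G' face_of T" for G G'
  proof -
    have "?\<psi> G face_of S" "?\<psi> G' face_of S"
      using b' that by (auto simp: bij_betw_def)
    moreover have "\<phi> (?\<psi> G) = G" "\<phi> (?\<psi> G') = G'"
      using b that by (auto simp: bij_betw_inv_into_right)
    ultimately show ?thesis using m by metis
  qed
  with b' show ?thesis unfolding comb_equiv_def by blast
qed

lemma comb_equiv_trans:
  assumes "comb_equiv S T" "comb_equiv T U" shows "comb_equiv S U"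
proof -
  obtain \<phi> where b: "bij_betw \<phi> {F. F face_of S} {G. G face_of T}"
    and m: "\<And>F F'. F face_of S \<Longrightarrow> F' face_of S \<Longrightarrow> (F \<subseteq> F' \<longleftrightarrow> \<phi> F \<subseteq> \<phi> F')"
    using assms(1) unfolding comb_equiv_def by blast
  obtain \<psi> where b': "bij_betw \<psi> {F. F face_of T} {G. G face_of U}"
    and m': "\<And>F F'. F face_of T \<Longrightarrow> F' face_of T \<Longrightarrow> (F \<subseteq> F' \<longleftrightarrow> \<psi> F \<subseteq> \<psi> F')"
    using assms(2) unfolding comb_equiv_def by blast
  have "\<And>F. F face_of S \<Longrightarrow> \<phi> F face_of T" using b by (auto simp: bij_betw_def)
  then have "\<And>F F'. F face_of S \<Longrightarrow> F' face_of S \<Longrightarrow>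
      (F \<subseteq> F' \<longleftrightarrow> (\<psi> \<circ> \<phi>) F \<subseteq> (\<psi> \<circ> \<phi>) F')"
    using m m' by (metis comp_apply)
  with bij_betw_trans[OF b b'] show ?thesis unfolding comb_equiv_def by blast
qed

lemma comb_equiv_linear_image:
  assumes "linear f" "inj f" shows "comb_equiv S (f ` S)"
proof -
  have "bij_betw (image f) {F. F face_of S} {G. G face_of (f ` S)}"
    unfolding bij_betw_def
    using faces_of_linear_image[OF assms, of S] inj_on_image[of f "{F. F face_of S}"] assms(2)
    by (metis inj_image_eq_iff inj_onI)
  moreover have "\<forall>F F'. F \<subseteq> F' \<longleftrightarrow> f ` F \<subseteq> f ` F'"
    using assms(2) by (simp add: inj_image_subset_iff)
  ultimately show ?thesis unfolding comb_equiv_def by blast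
qed

lemma dim_linear_image:
  fixes f :: "'a::real_vector \<Rightarrow> 'b::real_vector"
  assumes f: "linear f" "inj f" shows "dim (f ` A) = dim A"
proof -
  obtain B where B: "B \<subseteq> A" "independent B" "A \<subseteq> span B" "card B = dim A"
    using basis_exists by blast
  have "f ` A \<subseteq> span (f ` B)"
    using B(3) f by (simp add: image_mono linear_span_image)
  moreover have "independent (f ` B)"
    using B(2) f by (metis inj_on_subset linear_independent_injective_image subset_UNIV)
  ultimately have "card (f ` B) = dim (f ` A)"
    using B(1) by (intro real_vector.basis_card_eq_dim) auto
  moreover have "card (f ` B) = card B"
    using f(2) by (metis card_image inj_on_subset subset_UNIV)
  ultimately show ?thesis using B(4) by simp
qed

lemma pdim_linear_image:
  assumes f: "linear f" "inj f" shows "pdim (f ` S) = pdim S"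
proof -
  have "{x - y | x y. x \<in> f ` S \<and> y \<in> f ` S} = f ` {x - y | x y. x \<in> S \<and> y \<in> S}"
    by (auto simp: image_iff linear_diff[OF f(1)]) (metis linear_diff[OF f(1)])+
  then show ?thesis unfolding pdim_def using dim_linear_image[OF f] by simp
qed

lemma facets_linear_image:
  assumes f: "linear f" "inj f" shows "facets (f ` S) = image f ` facets S"
proof -
  have "facets (f ` S) = {F \<in> {F. F face_of f ` S}. F \<noteq> {} \<and> pdim F + 1 = pdim (f ` S)}"
    by (simp add: facets_def)
  also have "\<dots> = image f ` facets S"
    unfolding faces_of_linear_image[OF f] facets_def
    by (auto simp: pdim_linear_image[OF f])
  finally show ?thesis .
qed

lemma simple_polytope_linear_image:
  assumes f: "linear f" "inj f" and S: "simple_polytope S" shows "simple_polytope (f ` S)"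
  unfolding simple_polytope_def
proof (intro conjI allI impI)
  show "polytope (f ` S)" "f ` S \<noteq> {}"
    using S polytope_linear_image[OF f(1)] by (auto simp: simple_polytope_def)
  fix w assume w: "w extreme_point_of f ` S"
  then obtain v where v: "w = f v" "v \<in> S" by (auto simp: extreme_point_of_def)
  have "{f v} face_of f ` S" using w v by (simp add: face_of_singleton)
  then have "v extreme_point_of S"
    using face_of_linear_image[OF f, of "{v}" S] by (simp add: face_of_singleton)
  then have c: "card {F \<in> facets S. v \<in> F} = pdim S"
    using S by (simp add: simple_polytope_def)
  have "{F \<in> facets (f ` S). w \<in> F} = image f ` {F \<in> facets S. v \<in> F}"
    unfolding facets_linear_image[OF f] v(1) using inj_image_mem_iff[OF f(2)] by blast
  moreover have "inj_on (image f) {F \<in> facets S. v \<in> F}"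
    using f(2) by (meson inj_image_eq_iff inj_onI)
  ultimately show "card {F \<in> facets (f ` S). w \<in> F} = pdim (f ` S)"
    using c pdim_linear_image[OF f] by (simp add: card_image)
qed

lemma face_of_Times_general:
  assumes "F face_of S" "G face_of T" shows "(F \<times> G) face_of (S \<times> T)"
  unfolding face_of_def
proof (intro conjI ballI impI)
  show "F \<times> G \<subseteq> S \<times> T" "convex (F \<times> G)"
    using assms by (auto simp: face_of_def convex_Times)
  fix a b x assume ab: "a \<in> S \<times> T" "b \<in> S \<times> T" and x: "x \<in> F \<times> G" "x \<in> open_segment a b"
  obtain u where u: "0 < u" "u < 1" "x = (1 - u) *\<^sub>R a + u *\<^sub>R b"
    using x(2) by (auto simp: in_segment)
  have *: "p \<in> K \<and> q \<in> K" if "K face_of L" "p \<in> L" "q \<in> L" "(1 - u) *\<^sub>R p + u *\<^sub>R q \<in> K"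
    for K L :: "'c::real_vector set" and p q
  proof (cases "p = q")
    case True
    with that(4) show ?thesis by (simp flip: scaleR_left_distrib)
  next
    case False
    then have "(1 - u) *\<^sub>R p + u *\<^sub>R q \<in> open_segment p q"
      using u by (auto simp: in_segment)
    with that show ?thesis unfolding face_of_def by blast
  qed
  have "fst x = (1 - u) *\<^sub>R fst a + u *\<^sub>R fst b" "snd x = (1 - u) *\<^sub>R snd a + u *\<^sub>R snd b"
    using u(3) by simp_all
  moreover have "fst x \<in> F" "snd x \<in> G" using x(1) by auto
  ultimately show "a \<in> F \<times> G" "b \<in> F \<times> G"
    using *[OF assms(1), of "fst a" "fst b"] *[OF assms(2), of "snd a" "snd b"] ab
    by (auto simp: mem_Times_iff)
qed

lemma face_of_Times_split:
  assumes H: "H face_of (S \<times> T)"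
  shows "fst ` H face_of S" "snd ` H face_of T" "H = fst ` H \<times> snd ` H"
proof -
  have cH: "convex H" and sub: "H \<subseteq> S \<times> T" using H by (auto simp: face_of_def)
  have ends: "p \<in> H \<and> q \<in> H"
    if "p \<in> S \<times> T" "q \<in> S \<times> T" "(1 - u) *\<^sub>R p + u *\<^sub>R q \<in> H" "0 < u" "u < 1" for p q u
  proof (cases "p = q")
    case True
    with that(3) show ?thesis by (simp flip: scaleR_left_distrib)
  next
    case False
    then have "(1 - u) *\<^sub>R p + u *\<^sub>R q \<in> open_segment p q"
      using that by (auto simp: in_segment)
    with that H show ?thesis unfolding face_of_def by blast
  qed
  show "fst ` H face_of S"
    unfolding face_of_def
  proof (intro conjI ballI impI)
    show "fst ` H \<subseteq> S" using sub by auto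
    show "convex (fst ` H)" using cH by (rule convex_linear_image[OF linear_fst])
    fix a b x assume h: "a \<in> S" "b \<in> S" "x \<in> fst ` H" "x \<in> open_segment a b"
    obtain y where y: "(x, y) \<in> H" using h(3) by auto
    obtain u where u: "0 < u" "u < 1" "x = (1 - u) *\<^sub>R a + u *\<^sub>R b"
      using h(4) by (auto simp: in_segment)
    have "(x, y) = (1 - u) *\<^sub>R (a, y) + u *\<^sub>R (b, y)"
      using u(3) by (simp flip: scaleR_left_distrib)
    moreover have "y \<in> T" using y sub by auto
    ultimately have "(a, y) \<in> H \<and> (b, y) \<in> H"
      using ends[of "(a, y)" "(b, y)" u] h u y by auto
    then show "a \<in> fst ` H" "b \<in> fst ` H" by force+
  qed
  show "snd ` H face_of T"
    unfolding face_of_def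
  proof (intro conjI ballI impI)
    show "snd ` H \<subseteq> T" using sub by auto
    show "convex (snd ` H)" using cH by (rule convex_linear_image[OF linear_snd])
    fix a b y assume h: "a \<in> T" "b \<in> T" "y \<in> snd ` H" "y \<in> open_segment a b"
    obtain x where x: "(x, y) \<in> H" using h(3) by auto
    obtain u where u: "0 < u" "u < 1" "y = (1 - u) *\<^sub>R a + u *\<^sub>R b"
      using h(4) by (auto simp: in_segment)
    have "(x, y) = (1 - u) *\<^sub>R (x, a) + u *\<^sub>R (x, b)"
      using u(3) by (simp flip: scaleR_left_distrib)
    moreover have "x \<in> S" using x sub by auto
    ultimately have "(x, a) \<in> H \<and> (x, b) \<in> H"
      using ends[of "(x, a)" "(x, b)" u] h u x by auto
    then show "a \<in> snd ` H" "b \<in> snd ` H" by force+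
  qed
  show "H = fst ` H \<times> snd ` H"
  proof
    show "H \<subseteq> fst ` H \<times> snd ` H" by force
    show "fst ` H \<times> snd ` H \<subseteq> H"
    proof
      fix z assume "z \<in> fst ` H \<times> snd ` H"
      then obtain a b c d where ab: "z = (a, d)" "(a, b) \<in> H" "(c, d) \<in> H" by force
      have "(1 - 1/2) *\<^sub>R (a, b) + (1/2::real) *\<^sub>R (c, d) \<in> H"
        by (rule convexD[OF cH ab(2,3)]) simp_all
      moreover have "(1 - 1/2) *\<^sub>R (a, b) + (1/2::real) *\<^sub>R (c, d)
          = (1 - 1/2) *\<^sub>R (a, d) + (1/2::real) *\<^sub>R (c, b)" by (simp add: add.commute)
      ultimately have "(1 - 1/2) *\<^sub>R (a, d) + (1/2::real) *\<^sub>R (c, b) \<in> H" by metis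
      then show "z \<in> H"
        using ends[of "(a, d)" "(c, b)" "1/2"] ab sub by auto
    qed
  qed
qed

lemma comb_equiv_Times:
  assumes "comb_equiv S S'" "comb_equiv T T'"
  shows "comb_equiv (S \<times> T) (S' \<times> T')"
proof -
  obtain \<phi> where b1: "bij_betw \<phi> {F. F face_of S} {G. G face_of S'}"
    and m1: "\<And>F F'. F face_of S \<Longrightarrow> F' face_of S \<Longrightarrow> (F \<subseteq> F' \<longleftrightarrow> \<phi> F \<subseteq> \<phi> F')"
    using assms(1) unfolding comb_equiv_def by blast
  obtain \<psi> where b2: "bij_betw \<psi> {F. F face_of T} {G. G face_of T'}"
    and m2: "\<And>F F'. F face_of T \<Longrightarrow> F' face_of T \<Longrightarrow> (F \<subseteq> F' \<longleftrightarrow> \<psi> F \<subseteq> \<psi> F')"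
    using assms(2) unfolding comb_equiv_def by blast
  have f1: "\<phi> F face_of S'" if "F face_of S" for F using b1 that by (auto simp: bij_betw_def)
  have f2: "\<psi> F face_of T'" if "F face_of T" for F using b2 that by (auto simp: bij_betw_def)
  have s1: "\<exists>F. F face_of S \<and> \<phi> F = G" if "G face_of S'" for G
  proof -
    have "G \<in> \<phi> ` {F. F face_of S}" unfolding bij_betw_imp_surj_on[OF b1] using that by simp
    then show ?thesis by blast
  qed
  have s2: "\<exists>F. F face_of T \<and> \<psi> F = G" if "G face_of T'" for G
  proof -
    have "G \<in> \<psi> ` {F. F face_of T}" unfolding bij_betw_imp_surj_on[OF b2] using that by simp
    then show ?thesis by blast
  qed
  have e1: "\<phi> F = {} \<longleftrightarrow> F = {}" if "F face_of S" for F
  proof -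
    obtain E where E: "E face_of S" "\<phi> E = {}" using s1[OF empty_face_of] by blast
    then have "E = {}" using m1[OF E(1) empty_face_of] by simp
    with E show ?thesis using m1[OF that empty_face_of] by auto
  qed
  have e2: "\<psi> F = {} \<longleftrightarrow> F = {}" if "F face_of T" for F
  proof -
    obtain E where E: "E face_of T" "\<psi> E = {}" using s2[OF empty_face_of] by blast
    then have "E = {}" using m2[OF E(1) empty_face_of] by simp
    with E show ?thesis using m2[OF that empty_face_of] by auto
  qed
  define \<theta> where "\<theta> H = \<phi> (fst ` H) \<times> \<psi> (snd ` H)" for H
  have mono: "H \<subseteq> H' \<longleftrightarrow> \<theta> H \<subseteq> \<theta> H'" if H: "H face_of (S \<times> T)" "H' face_of (S \<times> T)" for H H'
  proof (cases "H = {}")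
    case True
    then show ?thesis using e1[OF empty_face_of] by (simp add: \<theta>_def)
  next
    case False
    note h = face_of_Times_split[OF H(1)] and h' = face_of_Times_split[OF H(2)]
    have ne: "fst ` H \<noteq> {}" "snd ` H \<noteq> {}" "\<phi> (fst ` H) \<noteq> {}" "\<psi> (snd ` H) \<noteq> {}"
      using False e1[OF h(1)] e2[OF h(2)] by auto
    have "H \<subseteq> H' \<longleftrightarrow> fst ` H \<subseteq> fst ` H' \<and> snd ` H \<subseteq> snd ` H'"
    proof
      assume "fst ` H \<subseteq> fst ` H' \<and> snd ` H \<subseteq> snd ` H'"
      then have "fst ` H \<times> snd ` H \<subseteq> fst ` H' \<times> snd ` H'" by (intro Sigma_mono) auto
      then show "H \<subseteq> H'" using h(3) h'(3) by metis
    qed (simp add: image_mono)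
    also have "\<dots> \<longleftrightarrow> \<phi> (fst ` H) \<subseteq> \<phi> (fst ` H') \<and> \<psi> (snd ` H) \<subseteq> \<psi> (snd ` H')"
      using m1[OF h(1) h'(1)] m2[OF h(2) h'(2)] by simp
    also have "\<dots> \<longleftrightarrow> \<theta> H \<subseteq> \<theta> H'"
      unfolding \<theta>_def times_subset_iff using ne by auto
    finally show ?thesis .
  qed
  have "\<theta> H face_of (S' \<times> T')" if "H face_of (S \<times> T)" for H
    unfolding \<theta>_def using face_of_Times_split[OF that] f1 f2 by (simp add: face_of_Times_general)
  moreover have "\<exists>H. H face_of (S \<times> T) \<and> \<theta> H = K" if K: "K face_of (S' \<times> T')" for K
  proof (cases "K = {}")
    case True
    then show ?thesis by (intro exI[of _ "{}"]) (use e1[OF empty_face_of] True in \<open>simp add: \<theta>_def\<close>)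
  next
    case False
    note k = face_of_Times_split[OF K]
    obtain F where F: "F face_of S" "\<phi> F = fst ` K" using s1[OF k(1)] by blast
    obtain G where G: "G face_of T" "\<psi> G = snd ` K" using s2[OF k(2)] by blast
    have "F \<noteq> {}" "G \<noteq> {}" using False F G e1[of F] e2[of G] by auto
    then have "\<theta> (F \<times> G) = fst ` K \<times> snd ` K" using F(2) G(2) by (simp add: \<theta>_def)
    then have "\<theta> (F \<times> G) = K" using k(3) by metis
    then show ?thesis using F G face_of_Times_general by blast
  qed
  moreover have "inj_on \<theta> {H. H face_of (S \<times> T)}"
    using mono by (intro inj_onI) (metis mem_Collect_eq subset_antisym subset_refl)
  ultimately have "bij_betw \<theta> {H. H face_of (S \<times> T)} {K. K face_of (S' \<times> T')}"
    unfolding bij_betw_def by blast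
  with mono show ?thesis unfolding comb_equiv_def by blast
qed

lemma dim_Times_general:
  fixes A :: "'a::real_vector set" and B :: "'b::real_vector set"
  assumes "finite K" "A \<subseteq> span K" "finite L" "B \<subseteq> span L" "0 \<in> A" "0 \<in> B"
  shows "dim (A \<times> B) = dim A + dim B"
proof -
  obtain X where X: "X \<subseteq> A" "independent X" "A \<subseteq> span X" "card X = dim A"
    using basis_exists by blast
  obtain Y where Y: "Y \<subseteq> B" "independent Y" "B \<subseteq> span Y" "card Y = dim B"
    using basis_exists by blast
  have fX: "finite X" using X assms by (meson independent_span_bound subset_trans)
  have fY: "finite Y" using Y assms by (meson independent_span_bound subset_trans)
  let ?i = "\<lambda>x::'a. (x, 0::'b)" and ?j = "\<lambda>y::'b. (0::'a, y)"
  have li: "linear ?i" "inj ?i" and lj: "linear ?j" "inj ?j"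
    by (auto simp: linear_iff inj_def)
  have spi: "span (?i ` V) = ?i ` span V" for V
    by (rule linear_span_image[OF li(1)])
  have spj: "span (?j ` V) = ?j ` span V" for V
    by (rule linear_span_image[OF lj(1)])
  have disj: "?i ` X \<inter> ?j ` Y = {}"
    using X(2) dependent_zero by auto
  have "independent (?i ` X \<union> ?j ` Y)"
    unfolding dependent_def
  proof safe
    fix x assume x: "x \<in> X"
      and "(x, 0) \<in> span (?i ` X \<union> ?j ` Y - {(x, 0)})"
    moreover have "?i ` X \<union> ?j ` Y - {(x, 0)} \<subseteq> ?i ` (X - {x}) \<union> ?j ` Y" by auto
    ultimately have "(x, 0) \<in> span (?i ` (X - {x}) \<union> ?j ` Y)" by (meson span_mono subsetD)
    then have "x \<in> span (X - {x})" by (auto simp: span_Un spi spj)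
    then show False using x X(2) by (auto simp: dependent_def)
  next
    fix y assume y: "y \<in> Y"
      and "(0, y) \<in> span (?i ` X \<union> ?j ` Y - {(0, y)})"
    moreover have "?i ` X \<union> ?j ` Y - {(0, y)} \<subseteq> ?i ` X \<union> ?j ` (Y - {y})" by auto
    ultimately have "(0, y) \<in> span (?i ` X \<union> ?j ` (Y - {y}))" by (meson span_mono subsetD)
    then have "y \<in> span (Y - {y})" by (auto simp: span_Un spi spj)
    then show False using y Y(2) by (auto simp: dependent_def)
  qed
  moreover have "?i ` X \<union> ?j ` Y \<subseteq> A \<times> B" using X Y assms by auto
  moreover have "A \<times> B \<subseteq> span (?i ` X \<union> ?j ` Y)"
  proof
    fix z assume "z \<in> A \<times> B"
    then obtain a b where z: "z = (a, b)" "a \<in> span X" "b \<in> span Y"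
      using X(3) Y(3) by blast
    have "?i a \<in> span (?i ` X)" "?j b \<in> span (?j ` Y)" unfolding spi spj using z by auto
    then have "?i a + ?j b \<in> span (?i ` X \<union> ?j ` Y)"
      by (intro span_add) (meson Un_upper1 Un_upper2 span_mono subsetD)+
    then show "z \<in> span (?i ` X \<union> ?j ` Y)" using z by simp
  qed
  ultimately have "dim (A \<times> B) = card (?i ` X \<union> ?j ` Y)"
    by (metis real_vector.basis_card_eq_dim)
  also have "\<dots> = card X + card Y"
    using fX fY disj li lj by (simp add: card_Un_disjoint card_image inj_on_def)
  finally show ?thesis using X Y by simp
qed

lemma pdim_Times:
  assumes "finite K" "S \<subseteq> span K" "finite L" "T \<subseteq> span L" "S \<noteq> {}" "T \<noteq> {}"
  shows "pdim (S \<times> T) = pdim S + pdim T"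
proof -
  let ?D = "\<lambda>S. {x - y | x y. x \<in> S \<and> y \<in> S}"
  have "{x - y | x y. x \<in> S \<times> T \<and> y \<in> S \<times> T} = ?D S \<times> ?D T"
    by force
  moreover have "?D S \<subseteq> span K" "?D T \<subseteq> span L"
    using assms by (auto intro: span_diff)
  moreover have "0 \<in> ?D S" "0 \<in> ?D T" using assms by force+
  ultimately show ?thesis
    unfolding pdim_def using assms by (simp add: dim_Times_general)
qed

lemma span_differences_convex:
  fixes F :: "'a::real_vector set"
  assumes F: "convex F" "F \<noteq> {}" and z: "z \<in> span {x - y | x y. x \<in> F \<and> y \<in> F}"
  shows "\<exists>M p q. 0 \<le> M \<and> p \<in> F \<and> q \<in> F \<and> z = M *\<^sub>R (p - q)"
proof -
  let ?W = "{z. \<exists>M p q. 0 \<le> M \<and> p \<in> F \<and> q \<in> F \<and> z = M *\<^sub>R (p - q)}"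
  have "subspace ?W"
    unfolding subspace_def
  proof safe
    show "\<exists>M p q. 0 \<le> M \<and> p \<in> F \<and> q \<in> F \<and> 0 = M *\<^sub>R (p - q)"
      using F(2) by fastforce
  next
    fix M N :: real and p q p' q'
    assume h: "0 \<le> M" "0 \<le> N" "p \<in> F" "q \<in> F" "p' \<in> F" "q' \<in> F"
    show "\<exists>L r s. 0 \<le> L \<and> r \<in> F \<and> s \<in> F \<and>
        M *\<^sub>R (p - q) + N *\<^sub>R (p' - q') = L *\<^sub>R (r - s)"
    proof (cases "M + N = 0")
      case True
      then have "M = 0" "N = 0" using h by auto
      then show ?thesis using h by (intro exI[of _ 0] exI[of _ p]) auto
    next
      case False
      let ?r = "(M / (M + N)) *\<^sub>R p + (N / (M + N)) *\<^sub>R p'"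
      let ?s = "(M / (M + N)) *\<^sub>R q + (N / (M + N)) *\<^sub>R q'"
      have "?r \<in> F" "?s \<in> F"
        using h False by (auto intro!: convexD[OF F(1)] simp: add_divide_distrib[symmetric])
      moreover have "M *\<^sub>R (p - q) + N *\<^sub>R (p' - q') = (M + N) *\<^sub>R (?r - ?s)"
        using False by (simp add: scaleR_diff_right scaleR_add_right)
      ultimately show ?thesis using h by (intro exI[of _ "M + N"] exI[of _ ?r] exI[of _ ?s]) auto
    qed
  next
    fix c M :: real and p q assume h: "0 \<le> M" "p \<in> F" "q \<in> F"
    show "\<exists>L r s. 0 \<le> L \<and> r \<in> F \<and> s \<in> F \<and> c *\<^sub>R M *\<^sub>R (p - q) = L *\<^sub>R (r - s)"
    proof (cases "0 \<le> c")
      case True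
      then show ?thesis using h by (intro exI[of _ "c * M"] exI[of _ p] exI[of _ q]) auto
    next
      case False
      have "c *\<^sub>R M *\<^sub>R (p - q) = ((- c) * M) *\<^sub>R (q - p)"
        by (simp add: scaleR_diff_right)
      then show ?thesis using h False
        by (intro exI[of _ "(- c) * M"] exI[of _ q] exI[of _ p]) (auto simp: mult_nonpos_nonneg)
    qed
  qed
  moreover have "{x - y | x y. x \<in> F \<and> y \<in> F} \<subseteq> ?W"
    by (force intro: exI[of _ 1])
  ultimately have "span {x - y | x y. x \<in> F \<and> y \<in> F} \<subseteq> ?W" by (rule span_minimal[rotated])
  with z show ?thesis by blast
qed

lemma pdim_proper_face_less:
  assumes K: "finite K" "S \<subseteq> span K" and F: "F face_of S" "F \<noteq> {}" "F \<noteq> S"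
  shows "pdim F < pdim S"
proof -
  let ?D = "\<lambda>S. {x - y | x y. x \<in> S \<and> y \<in> S}"
  have cF: "convex F" and sub: "F \<subseteq> S" using F by (auto simp: face_of_def)
  obtain x where x: "x \<in> S" "x \<notin> F" using F sub by blast
  obtain f where f: "f \<in> F" using F by blast
  have nin: "x - f \<notin> span (?D F)"
  proof
    assume "x - f \<in> span (?D F)"
    then obtain M p q where M: "0 \<le> M" "p \<in> F" "q \<in> F" "x - f = M *\<^sub>R (p - q)"
      using span_differences_convex[OF cF F(2)] by blast
    have M0: "M \<noteq> 0" using M x f by auto
    let ?m = "(1 / (1 + M)) *\<^sub>R x + (M / (1 + M)) *\<^sub>R q"
    have "x + M *\<^sub>R q = f + M *\<^sub>R p" using M(4) by (simp add: algebra_simps)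
    then have "(1 / (1 + M)) *\<^sub>R (x + M *\<^sub>R q) = (1 / (1 + M)) *\<^sub>R (f + M *\<^sub>R p)" by simp
    then have "?m = (1 / (1 + M)) *\<^sub>R f + (M / (1 + M)) *\<^sub>R p"
      by (simp add: scaleR_add_right)
    moreover have "(1 / (1 + M)) *\<^sub>R f + (M / (1 + M)) *\<^sub>R p \<in> F"
      using M f by (intro convexD[OF cF]) (auto simp: add_divide_distrib[symmetric])
    moreover have "?m \<in> open_segment x q"
      unfolding in_segment
    proof (intro conjI exI[of _ "M / (1 + M)"])
      show "x \<noteq> q" using x M by auto
      show "0 < M / (1 + M)" "M / (1 + M) < 1" using M M0 by auto
      have "1 - M / (1 + M) = 1 / (1 + M)" using M by (simp add: field_simps)
      then show "?m = (1 - M / (1 + M)) *\<^sub>R x + (M / (1 + M)) *\<^sub>R q" by simp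
    qed
    ultimately have "x \<in> F"
      using F(1) x M sub unfolding face_of_def by (metis subsetD)
    with x show False by blast
  qed
  obtain X where X: "X \<subseteq> ?D F" "independent X" "?D F \<subseteq> span X" "card X = dim (?D F)"
    using basis_exists by blast
  obtain Y where Y: "Y \<subseteq> ?D S" "independent Y" "?D S \<subseteq> span Y" "card Y = dim (?D S)"
    using basis_exists by blast
  have "?D S \<subseteq> span K" using K by (auto intro: span_diff)
  then have fY: "finite Y" using Y K by (meson independent_span_bound subset_trans)
  have nX: "x - f \<notin> span X" using nin X(1) span_mono by blast
  then have ind: "independent (insert (x - f) X)" using X(2) by (simp add: independent_insertI)
  have sub': "insert (x - f) X \<subseteq> span Y" using X(1) Y(3) x f sub by blast
  have "finite (insert (x - f) X) \<and> card (insert (x - f) X) \<le> card Y"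
    by (rule independent_span_bound[OF fY ind sub'])
  moreover have "x - f \<notin> X" using nX span_base by blast
  ultimately have "card X < card Y" by auto
  then show ?thesis unfolding pdim_def X(4) Y(4) .
qed

lemma polytope_subset_span: "polytope S \<Longrightarrow> \<exists>K. finite K \<and> S \<subseteq> span K"
  unfolding polytope_def using convex_hull_subset_span by blast

lemma facets_Times:
  assumes S: "polytope S" "S \<noteq> {}" and T: "polytope T" "T \<noteq> {}"
  shows "facets (S \<times> T) = (\<lambda>F. F \<times> T) ` facets S \<union> (\<lambda>G. S \<times> G) ` facets T"
proof -
  obtain K where K: "finite K" "S \<subseteq> span K" using polytope_subset_span S by blast
  obtain L where L: "finite L" "T \<subseteq> span L" using polytope_subset_span T by blast
  have cS: "S face_of S" and cT: "T face_of T"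
    using S T polytope_imp_convex by (auto simp: face_of_refl_eq)
  have dim: "pdim (F \<times> G) = pdim F + pdim G"
    if "F face_of S" "G face_of T" "F \<noteq> {}" "G \<noteq> {}" for F G
  proof (rule pdim_Times[OF K(1) _ L(1) _ that(3,4)])
    show "F \<subseteq> span K" using K(2) face_of_imp_subset[OF that(1)] by (rule subset_trans[rotated])
    show "G \<subseteq> span L" using L(2) face_of_imp_subset[OF that(2)] by (rule subset_trans[rotated])
  qed
  have le1: "pdim F < pdim S \<or> F = S" if "F face_of S" "F \<noteq> {}" for F
    using pdim_proper_face_less[OF K that] by blast
  have le2: "pdim G < pdim T \<or> G = T" if "G face_of T" "G \<noteq> {}" for G
    using pdim_proper_face_less[OF L that] by blast
  show ?thesis
  proof (intro equalityI subsetI)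
    fix H assume "H \<in> facets (S \<times> T)"
    then have H: "H face_of (S \<times> T)" "H \<noteq> {}" "pdim H + 1 = pdim (S \<times> T)"
      by (auto simp: facets_def)
    define F G where "F = fst ` H" and "G = snd ` H"
    have FG: "F face_of S" "G face_of T" "H = F \<times> G" "F \<noteq> {}" "G \<noteq> {}"
      unfolding F_def G_def using face_of_Times_split[OF H(1)] H(2) by blast+
    have "pdim F + pdim G + 1 = pdim S + pdim T"
      using H(3) dim[OF FG(1,2,4,5)] dim[OF cS cT S(2) T(2)] by (metis FG(3))
    then have "G = T \<and> pdim F + 1 = pdim S \<or> F = S \<and> pdim G + 1 = pdim T"
      using le1[OF FG(1,4)] le2[OF FG(2,5)] by auto
    then show "H \<in> (\<lambda>F. F \<times> T) ` facets S \<union> (\<lambda>G. S \<times> G) ` facets T"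
      using FG by (fastforce simp: facets_def)
  next
    fix H assume "H \<in> (\<lambda>F. F \<times> T) ` facets S \<union> (\<lambda>G. S \<times> G) ` facets T"
    then consider F where "H = F \<times> T" "F face_of S" "F \<noteq> {}" "pdim F + 1 = pdim S"
      | G where "H = S \<times> G" "G face_of T" "G \<noteq> {}" "pdim G + 1 = pdim T"
      unfolding facets_def by blast
    then show "H \<in> facets (S \<times> T)"
    proof cases
      case 1
      then show ?thesis
        using S T cS cT dim[of F T] dim[of S T] face_of_Times_general[of F S T T]
        by (simp add: facets_def times_eq_iff)
    next
      case 2
      then show ?thesis
        using S T cS cT dim[of S G] dim[of S T] face_of_Times_general[of S S G T]
        by (simp add: facets_def times_eq_iff)
    qed
  qed
qed

lemma simple_polytope_Times:
  assumes "simple_polytope S" "simple_polytope T" shows "simple_polytope (S \<times> T)"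
proof -
  have S: "polytope S" "S \<noteq> {}" and T: "polytope T" "T \<noteq> {}"
    using assms by (auto simp: simple_polytope_def)
  obtain K where K: "finite K" "S \<subseteq> span K" using polytope_subset_span S by blast
  obtain L where L: "finite L" "T \<subseteq> span L" using polytope_subset_span T by blast
  have "card {H \<in> facets (S \<times> T). z \<in> H} = pdim (S \<times> T)" if z: "z extreme_point_of (S \<times> T)" for z
  proof -
    obtain v w where vw: "z = (v, w)" by force
    have "{(v, w)} face_of (S \<times> T)" using z vw by (simp add: face_of_singleton)
    then have "{v} face_of S" "{w} face_of T" using face_of_Times_split by fastforce+
    then have v: "v extreme_point_of S" "v \<in> S" and w: "w extreme_point_of T" "w \<in> T"
      by (auto simp: face_of_singleton extreme_point_of_def)
    let ?A = "{F \<in> facets S. v \<in> F}" and ?B = "{G \<in> facets T. w \<in> G}"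
    have cA: "card ?A = pdim S" and cB: "card ?B = pdim T"
      using assms v w by (auto simp: simple_polytope_def)
    have fin: "finite ?A" "finite ?B"
      using cA cB by (cases "pdim S"; cases "pdim T"; force simp: facets_def intro: card_ge_0_finite)+
    have "{H \<in> facets (S \<times> T). z \<in> H} = (\<lambda>F. F \<times> T) ` ?A \<union> (\<lambda>G. S \<times> G) ` ?B"
      unfolding facets_Times[OF S T] vw using v w by auto
    moreover have "(\<lambda>F. F \<times> T) ` ?A \<inter> (\<lambda>G. S \<times> G) ` ?B = {}"
    proof -
      have "S \<notin> facets S" by (simp add: facets_def)
      then show ?thesis using T S by (auto simp: times_eq_iff facets_def)
    qed
    moreover have "inj_on (\<lambda>F. F \<times> T) ?A" "inj_on (\<lambda>G. S \<times> G) ?B"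
      using S T by (auto simp: inj_on_def times_eq_iff)
    ultimately have "card {H \<in> facets (S \<times> T). z \<in> H} = card ?A + card ?B"
      using fin by (simp add: card_Un_disjoint card_image)
    then show ?thesis using cA cB pdim_Times[OF K L S(2) T(2)] by simp
  qed
  then show ?thesis
    using S T by (auto simp: simple_polytope_def polytope_Times)
qed

section \<open>The ring of simple polytopes\<close>

text \<open>
  Polytopes of all dimensions live in the space of finitely supported real sequences, the
  union of all \<open>\<real>\<^sup>n\<close>; the basis vector \<open>e\<^sub>i\<close> is \<open>Poly_Mapping.single i 1\<close>.  Since that
  space is isomorphic to its own square, the Cartesian product of two polytopes can be moved
  back into it by a linear isomorphism.
\<close>

type_synonym point = "nat \<Rightarrow>\<^sub>0 real"

lift_definition interleave :: "point \<Rightarrow> point \<Rightarrow> point" is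
  "\<lambda>f g i. if even i then f (i div 2) else g (i div 2)"
proof -
  fix f g :: "nat \<Rightarrow> real" assume fin: "finite {i. f i \<noteq> 0}" "finite {i. g i \<noteq> 0}"
  have "{i. (if even i then f (i div 2) else g (i div 2)) \<noteq> 0}
      \<subseteq> (\<lambda>i. 2 * i) ` {i. f i \<noteq> 0} \<union> (\<lambda>i. 2 * i + 1) ` {i. g i \<noteq> 0}"
  proof
    fix i assume i: "i \<in> {i. (if even i then f (i div 2) else g (i div 2)) \<noteq> 0}"
    show "i \<in> (\<lambda>i. 2 * i) ` {i. f i \<noteq> 0} \<union> (\<lambda>i. 2 * i + 1) ` {i. g i \<noteq> 0}"
    proof (cases "even i")
      case True
      then show ?thesis using i by (intro UnI1 image_eqI[of _ _ "i div 2"]) auto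
    next
      case False
      then show ?thesis using i by (intro UnI2 image_eqI[of _ _ "i div 2"]) auto
    qed
  qed
  then show "finite {i. (if even i then f (i div 2) else g (i div 2)) \<noteq> 0}"
    using fin by (meson finite_Un finite_imageI finite_subset)
qed

definition pprod :: "point set \<Rightarrow> point set \<Rightarrow> point set" where
  "pprod S T = case_prod interleave ` (S \<times> T)"

lemma lookup_scaleR_point: "Poly_Mapping.lookup (c *\<^sub>R (x::point)) i = c * Poly_Mapping.lookup x i"
proof -
  have "{i. c * Poly_Mapping.lookup x i \<noteq> 0} \<subseteq> {i. Poly_Mapping.lookup x i \<noteq> 0}" by auto
  then have "finite {i. c * Poly_Mapping.lookup x i \<noteq> 0}"
    using finite_lookup finite_subset by blast
  then show ?thesis by (simp add: scaleR_poly_mapping_def)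
qed

lemma linear_interleave: "linear (case_prod interleave)"
proof (rule linearI)
  fix x y :: "point \<times> point" and c :: real
  show "case_prod interleave (x + y) = case_prod interleave x + case_prod interleave y"
    by (rule poly_mapping_eqI) (simp add: interleave.rep_eq lookup_add split_beta)
  show "case_prod interleave (c *\<^sub>R x) = c *\<^sub>R case_prod interleave x"
    by (rule poly_mapping_eqI) (simp add: interleave.rep_eq lookup_scaleR_point split_beta)
qed

lemma inj_interleave: "inj (case_prod interleave)"
proof (rule injI, clarify)
  fix x y x' y' assume eq: "interleave x y = interleave x' y'"
  have "Poly_Mapping.lookup x i = Poly_Mapping.lookup x' i" for i
    using arg_cong[OF eq, of "\<lambda>z. Poly_Mapping.lookup z (2 * i)"] by (simp add: interleave.rep_eq)
  moreover have "Poly_Mapping.lookup y i = Poly_Mapping.lookup y' i" for i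
    using arg_cong[OF eq, of "\<lambda>z. Poly_Mapping.lookup z (2 * i + 1)"] by (simp add: interleave.rep_eq)
  ultimately show "x = x' \<and> y = y'" by (auto intro: poly_mapping_eqI)
qed

lemma comb_equiv_pprod: "comb_equiv (pprod S T) (S \<times> T)"
  unfolding pprod_def
  by (rule comb_equiv_sym, rule comb_equiv_linear_image[OF linear_interleave inj_interleave])

lemma simple_polytope_pprod:
  "simple_polytope S \<Longrightarrow> simple_polytope T \<Longrightarrow> simple_polytope (pprod S T)"
  unfolding pprod_def
  by (intro simple_polytope_linear_image linear_interleave inj_interleave simple_polytope_Times)

lemma comb_equiv_pprodI:
  "comb_equiv (S \<times> T) (S' \<times> T') \<Longrightarrow> comb_equiv (pprod S T) (pprod S' T')"
  by (rule comb_equiv_trans[OF comb_equiv_trans[OF comb_equiv_pprod] comb_equiv_sym[OF comb_equiv_pprod]])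

lemma simple_polytope_sing: "simple_polytope {a}"
proof -
  have "{x - y |x y. x \<in> {a} \<and> y \<in> {a}} = {0}" by auto
  then have "pdim {a} = 0" using real_vector.dim_le_card[of "{0}" "{}"] by (simp add: pdim_def)
  moreover have "polytope {a}" unfolding polytope_def by (metis convex_hull_singleton finite.intros)
  ultimately show ?thesis by (simp add: simple_polytope_def facets_def)
qed

definition same_type :: "point set \<Rightarrow> point set \<Rightarrow> bool" where
  "same_type S T \<longleftrightarrow> simple_polytope S \<and> simple_polytope T \<and> comb_equiv S T"

text \<open>
  The empty polytope has no type: in the ring of polytopes it is the zero, not a generator.
\<close>

quotient_type comb_type = "point set" / partial: same_type
  morphisms rep_type type_of
proof (rule part_equivpI)
  show "\<exists>S. same_type S S"
    using simple_polytope_sing comb_equiv_refl by (auto simp: same_type_def)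
  show "symp same_type" by (auto simp: symp_def same_type_def comb_equiv_sym)
  show "transp same_type" by (auto simp: transp_def same_type_def intro: comb_equiv_trans)
qed

text \<open>
  The monoid of combinatorial types is written additively, because \<^typ>\<open>'a \<Rightarrow>\<^sub>0 'b\<close> is the
  monoid algebra of an additive monoid: \<open>+\<close> on \<open>comb_type\<close> is the Cartesian product and
  \<open>0\<close> is the point.
\<close>

instantiation comb_type :: comm_monoid_add
begin

lift_definition zero_comb_type :: comb_type is "{0}"
  by (simp add: same_type_def simple_polytope_sing comb_equiv_refl)

lift_definition plus_comb_type :: "comb_type \<Rightarrow> comb_type \<Rightarrow> comb_type" is pprod
  by (auto simp: same_type_def simple_polytope_pprod intro!: comb_equiv_pprodI comb_equiv_Times)

instance
proof
  fix a b c :: comb_type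
  show "a + b + c = a + (b + c)"
  proof (transfer, unfold same_type_def, intro conjI)
    fix a b c :: "point set"
    let ?f = "\<lambda>((x, y), z). (x::point, (y::point, z::point))"
    have "?f ` ((a \<times> b) \<times> c) = a \<times> (b \<times> c)" by (auto simp: image_iff)
    moreover have "linear ?f" "inj ?f" by (auto simp: linear_iff inj_def)
    ultimately have "comb_equiv ((a \<times> b) \<times> c) (a \<times> (b \<times> c))"
      using comb_equiv_linear_image[of ?f "(a \<times> b) \<times> c"] by simp
    moreover have "comb_equiv (pprod a b \<times> c) ((a \<times> b) \<times> c)"
      "comb_equiv (a \<times> (b \<times> c)) (a \<times> pprod b c)"
      by (intro comb_equiv_Times comb_equiv_refl comb_equiv_pprod comb_equiv_sym[OF comb_equiv_pprod])+
    ultimately have "comb_equiv (pprod a b \<times> c) (a \<times> pprod b c)"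
      by (blast intro: comb_equiv_trans)
    then show "comb_equiv (pprod (pprod a b) c) (pprod a (pprod b c))"
      by (rule comb_equiv_pprodI)
  qed (auto simp: simple_polytope_pprod)
  show "a + b = b + a"
  proof (transfer, unfold same_type_def, intro conjI)
    fix a b :: "point set"
    have "prod.swap ` (a \<times> b) = b \<times> a" by (simp add: product_swap)
    moreover have "linear (prod.swap :: point \<times> point \<Rightarrow> _)" "inj (prod.swap :: point \<times> point \<Rightarrow> _)"
      by (auto simp: linear_iff)
    ultimately show "comb_equiv (pprod a b) (pprod b a)"
      using comb_equiv_linear_image[of prod.swap "a \<times> b"] comb_equiv_pprodI by simp
  qed (auto simp: simple_polytope_pprod)
  show "0 + a = a"
  proof (transfer, unfold same_type_def, intro conjI)
    fix a :: "point set"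
    let ?f = "\<lambda>x::point. (0::point, x)"
    have "?f ` a = {0::point} \<times> a" by auto
    moreover have "linear ?f" "inj ?f" by (auto simp: linear_iff inj_def)
    ultimately have "comb_equiv a ({0::point} \<times> a)"
      using comb_equiv_linear_image[of ?f a] by simp
    then have "comb_equiv ({0::point} \<times> a) a" by (rule comb_equiv_sym)
    then show "comb_equiv (pprod {0} a) a"
      by (rule comb_equiv_trans[OF comb_equiv_pprod])
  qed (auto simp: simple_polytope_pprod simple_polytope_sing)
qed

end

text \<open>
  \<open>\<P> \<otimes> \<rat>\<close>: the rational vector space with basis the combinatorial types of simple polytopes,
  multiplied by the bilinear extension of the Cartesian product.
\<close>

type_synonym polytope_ring = "comb_type \<Rightarrow>\<^sub>0 rat"

definition scalar :: "rat \<Rightarrow> polytope_ring" where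
  "scalar r = Poly_Mapping.single 0 r"

definition class_of :: "comb_type \<Rightarrow> polytope_ring" where
  "class_of c = Poly_Mapping.single c 1"

text \<open>
  The dimension and the facets up to combinatorial equivalence do not depend on the
  representative: dimension is the length of the face lattice, facets are its coatoms.  Facets
  of a simple polytope are simple, so \<open>type_of\<close> is meaningful on them.
\<close>

definition type_dim :: "comb_type \<Rightarrow> nat" where
  "type_dim c = pdim (rep_type c)"

definition facet_sum :: "comb_type \<Rightarrow> polytope_ring" where
  "facet_sum c = (\<Sum>F\<in>facets (rep_type c). class_of (type_of F))"

definition bd :: "polytope_ring \<Rightarrow> polytope_ring" where
  "bd a = (\<Sum>c\<in>Poly_Mapping.keys a. scalar (Poly_Mapping.lookup a c) * facet_sum c)"

section \<open>Two-parameter generating series\<close>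

text \<open>
  A series in \<open>q\<close> is of type \<open>polytope_ring fps\<close>; a series in \<open>q\<close> and \<open>x\<close> is of type
  \<open>polytope_ring fps fps\<close>, a power series in \<open>x\<close> whose coefficients are power series in \<open>q\<close>.
  Hence \<open>fps_X\<close> is \<open>x\<close> and \<open>fps_deriv\<close> is the partial derivative in \<open>x\<close>.
\<close>

definition Q_type :: "comb_type \<Rightarrow> polytope_ring fps" where
  "Q_type c = (\<Sum>k\<le>type_dim c.
     fps_const (scalar (1 / fact k) * (bd ^^ k) (class_of c)) * fps_X ^ k)"

text \<open>
  The linear extension of \<open>Q\<close> makes \<open>two_param\<close> send \<open>\<Sum>\<^sub>n a\<^sub>n P\<^sup>n x\<^bsup>n+n\<^sub>0\<^esup>\<close> to
  \<open>\<Sum>\<^sub>n a\<^sub>n Q(P\<^sup>n;q) x\<^bsup>n+n\<^sub>0\<^esup>\<close> for every shift \<open>n\<^sub>0\<close>.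
\<close>

definition Q :: "polytope_ring \<Rightarrow> polytope_ring fps" where
  "Q a = (\<Sum>c\<in>Poly_Mapping.keys a. fps_const (scalar (Poly_Mapping.lookup a c)) * Q_type c)"

definition two_param :: "polytope_ring fps \<Rightarrow> polytope_ring fps fps" where
  "two_param f = Abs_fps (\<lambda>m. Q (fps_nth f m))"

definition deriv_q :: "polytope_ring fps fps \<Rightarrow> polytope_ring fps fps" where
  "deriv_q f = Abs_fps (\<lambda>m. fps_deriv (fps_nth f m))"

definition at_q0 :: "polytope_ring fps fps \<Rightarrow> polytope_ring fps" where
  "at_q0 f = Abs_fps (\<lambda>m. fps_nth (fps_nth f m) 0)"

section \<open>Nestohedra\<close>

definition building_set :: "nat set \<Rightarrow> nat set set \<Rightarrow> bool" where
  "building_set V B \<longleftrightarrow> B \<subseteq> Pow V \<and> {} \<notin> B \<and> (\<forall>i\<in>V. {i} \<in> B) \<and>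
     (\<forall>S\<in>B. \<forall>T\<in>B. S \<inter> T \<noteq> {} \<longrightarrow> S \<union> T \<in> B)"

text \<open>The sum is the Minkowski sum of sets.\<close>

definition nestohedron :: "nat set set \<Rightarrow> point set" where
  "nestohedron B = (\<Sum>S\<in>B. convex hull ((\<lambda>i. Poly_Mapping.single i 1) ` S))"

definition graphical :: "nat set \<Rightarrow> (nat \<times> nat) set \<Rightarrow> nat set set" where
  "graphical V E = {S. S \<noteq> {} \<and> S \<subseteq> V \<and> (\<forall>u\<in>S. \<forall>v\<in>S. (u, v) \<in> (E \<inter> S \<times> S)\<^sup>*)}"

definition complete_graph :: "nat set \<Rightarrow> (nat \<times> nat) set" where
  "complete_graph V = {(i, j). i \<in> V \<and> j \<in> V \<and> i \<noteq> j}"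

definition star_graph :: "nat \<Rightarrow> nat set \<Rightarrow> (nat \<times> nat) set" where
  "star_graph c V = {c} \<times> (V - {c}) \<union> (V - {c}) \<times> {c}"

definition singletons :: "nat set \<Rightarrow> nat set set" where
  "singletons V = {{i} | i. i \<in> V}"

definition B_Mas :: "nat \<Rightarrow> nat set set" where
  "B_Mas n = singletons {1..n+1} \<union> {{1, 2} \<union> I | I. I \<subseteq> {3..n+1}}
     \<union> {{1} \<union> J | J. J \<noteq> {} \<and> J \<subseteq> {3..n}}"

definition B_Gamma :: "nat \<Rightarrow> nat set set" where
  "B_Gamma n = singletons {1..n+1} \<union> {S. S \<subseteq> {1..n} \<and> 2 \<le> card S}
     \<union> {{1, n + 1} \<union> J | J. J \<subseteq> {2..n}}"

lemma building_set_graphical: "building_set V (graphical V E)"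
  unfolding building_set_def
proof (intro conjI ballI impI)
  fix S T assume S: "S \<in> graphical V E" and T: "T \<in> graphical V E" and ne: "S \<inter> T \<noteq> {}"
  obtain w where w: "w \<in> S" "w \<in> T" using ne by blast
  have mono: "(E \<inter> S \<times> S)\<^sup>* \<subseteq> (E \<inter> (S \<union> T) \<times> (S \<union> T))\<^sup>*"
    "(E \<inter> T \<times> T)\<^sup>* \<subseteq> (E \<inter> (S \<union> T) \<times> (S \<union> T))\<^sup>*"
    by (intro rtrancl_mono; blast)+
  have "(u, w) \<in> (E \<inter> (S \<union> T) \<times> (S \<union> T))\<^sup>* \<and> (w, u) \<in> (E \<inter> (S \<union> T) \<times> (S \<union> T))\<^sup>*"
    if "u \<in> S \<union> T" for u
    using that S T w mono unfolding graphical_def by blast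
  then have "(u, v) \<in> (E \<inter> (S \<union> T) \<times> (S \<union> T))\<^sup>*" if "u \<in> S \<union> T" "v \<in> S \<union> T" for u v
    using that by (meson rtrancl_trans)
  then show "S \<union> T \<in> graphical V E" using S T by (auto simp: graphical_def)
qed (auto simp: graphical_def)

lemma building_set_B_Mas:
  assumes "2 \<le> n" shows "building_set {1..n+1} (B_Mas n)"
proof -
  have eq: "B_Mas n = singletons {1..n+1} \<union> {S. {1, 2} \<subseteq> S \<and> S \<subseteq> {1..n+1}}
      \<union> {S. 1 \<in> S \<and> S \<noteq> {1} \<and> S \<subseteq> {1..n} \<and> 2 \<notin> S}" (is "_ = _ \<union> ?A \<union> ?C")
  proof -
    have "{{1, 2} \<union> I | I. I \<subseteq> {3..n+1}} = ?A"
    proof (intro equalityI subsetI)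
      fix S assume "S \<in> ?A"
      then have "S = {1, 2} \<union> (S - {1, 2})" "S - {1, 2} \<subseteq> {3..n+1}" by fastforce+
      then show "S \<in> {{1, 2} \<union> I | I. I \<subseteq> {3..n+1}}" by blast
    qed (use assms in auto)
    moreover have "{{1} \<union> J | J. J \<noteq> {} \<and> J \<subseteq> {3..n}} = ?C"
    proof (intro equalityI subsetI)
      fix S assume S: "S \<in> ?C"
      have "S - {1} \<subseteq> {3..n}"
      proof
        fix x assume "x \<in> S - {1}"
        then have "x \<in> {1..n}" "x \<noteq> 1" "x \<noteq> 2" using S by auto
        then show "x \<in> {3..n}" by auto
      qed
      moreover have "S = {1} \<union> (S - {1})" "S - {1} \<noteq> {}" using S by auto
      ultimately show "S \<in> {{1} \<union> J | J. J \<noteq> {} \<and> J \<subseteq> {3..n}}" by blast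
    qed (use assms in fastforce)
    ultimately show ?thesis unfolding B_Mas_def by simp
  qed
  have sub: "S \<subseteq> {1..n+1}" if "S \<in> B_Mas n" for S
    using that unfolding eq singletons_def by auto
  have "S \<union> T \<in> B_Mas n" if h: "S \<in> B_Mas n" "T \<in> B_Mas n" "S \<inter> T \<noteq> {}" for S T
  proof -
    have one: "S \<in> ?A \<union> ?C \<or> (\<exists>i. S = {i})" "T \<in> ?A \<union> ?C \<or> (\<exists>i. T = {i})"
      using h unfolding eq singletons_def by blast+
    consider "\<exists>i. S = {i}" | "\<exists>i. T = {i}" | "S \<in> ?A \<union> ?C" "T \<in> ?A \<union> ?C" using one by blast
    then show ?thesis
    proof cases
      case 1
      then have "S \<union> T = T" using h by auto
      then show ?thesis using h by simp
    next
      case 2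
      then have "S \<union> T = S" using h by auto
      then show ?thesis using h by simp
    next
      case 3
      show ?thesis
      proof (cases "2 \<in> S \<union> T")
        case True
        then have "S \<union> T \<in> ?A" using 3 sub[OF h(1)] sub[OF h(2)] by blast
        then show ?thesis unfolding eq by blast
      next
        case False
        then have "S \<union> T \<in> ?C" using 3 by blast
        then show ?thesis unfolding eq by blast
      qed
    qed
  qed
  moreover have "{} \<notin> B_Mas n" by (auto simp: B_Mas_def singletons_def)
  moreover have "{i} \<in> B_Mas n" if "i \<in> {1..n+1}" for i
    using that by (auto simp: B_Mas_def singletons_def)
  ultimately show ?thesis
    using sub unfolding building_set_def by blast
qed

lemma building_set_B_Gamma:
  assumes "2 \<le> n" shows "building_set {1..n+1} (B_Gamma n)"
proof -
  have eq: "B_Gamma n = singletons {1..n+1} \<union> {S. S \<subseteq> {1..n} \<and> 2 \<le> card S}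
      \<union> {S. {1, n + 1} \<subseteq> S \<and> S \<subseteq> {1..n+1}}" (is "_ = _ \<union> ?C \<union> ?A")
  proof -
    have "{{1, n + 1} \<union> J | J. J \<subseteq> {2..n}} = ?A"
    proof (intro equalityI subsetI)
      fix S assume "S \<in> ?A"
      then have "S = {1, n + 1} \<union> (S - {1, n + 1})" "S - {1, n + 1} \<subseteq> {2..n}"
        by fastforce+
      then show "S \<in> {{1, n + 1} \<union> J | J. J \<subseteq> {2..n}}" by blast
    qed (use assms in auto)
    then show ?thesis unfolding B_Gamma_def by simp
  qed
  have sub: "S \<subseteq> {1..n+1}" if "S \<in> B_Gamma n" for S
    using that unfolding eq singletons_def by fastforce
  have "S \<union> T \<in> B_Gamma n" if h: "S \<in> B_Gamma n" "T \<in> B_Gamma n" "S \<inter> T \<noteq> {}" for S T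
  proof -
    have one: "S \<in> ?A \<union> ?C \<or> (\<exists>i. S = {i})" "T \<in> ?A \<union> ?C \<or> (\<exists>i. T = {i})"
      using h unfolding eq singletons_def by blast+
    consider "\<exists>i. S = {i}" | "\<exists>i. T = {i}" | "S \<in> ?A \<union> ?C" "T \<in> ?A \<union> ?C" using one by blast
    then show ?thesis
    proof cases
      case 1
      then have "S \<union> T = T" using h by auto
      then show ?thesis using h by simp
    next
      case 2
      then have "S \<union> T = S" using h by auto
      then show ?thesis using h by simp
    next
      case 3
      have inter: "1 \<in> S \<union> T" if "n + 1 \<in> S \<union> T" using that 3 by fastforce
      show ?thesis
      proof (cases "n + 1 \<in> S \<union> T")
        case True
        then have "S \<union> T \<in> ?A" using inter sub[OF h(1)] sub[OF h(2)] by blast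
        then show ?thesis unfolding eq by blast
      next
        case False
        then have C: "S \<in> ?C" "T \<in> ?C" using 3 by auto
        then have "finite (S \<union> T)" using finite_subset by auto
        then have "card S \<le> card (S \<union> T)" by (simp add: card_mono)
        then have "S \<union> T \<in> ?C" using C by auto
        then show ?thesis unfolding eq by blast
      qed
    qed
  qed
  moreover have "{} \<notin> B_Gamma n" by (auto simp: B_Gamma_def singletons_def)
  moreover have "{i} \<in> B_Gamma n" if "i \<in> {1..n+1}" for i
    using that by (auto simp: B_Gamma_def singletons_def)
  ultimately show ?thesis
    using sub unfolding building_set_def by blast
qed

text \<open>
  The vertex \<open>1\<close> is taken as the centre of the star; relabelling vertices permutes coordinates,
  so the choice does not affect the combinatorial type.
\<close>

definition Pe :: "nat \<Rightarrow> comb_type" where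
  "Pe n = type_of (nestohedron (graphical {1..n+1} (complete_graph {1..n+1})))"

definition St :: "nat \<Rightarrow> comb_type" where
  "St n = type_of (nestohedron (graphical {1..n+1} (star_graph 1 {1..n+1})))"

definition point_type :: comb_type where
  "point_type = type_of {0}"

definition segment_type :: comb_type where
  "segment_type = type_of (closed_segment 0 (Poly_Mapping.single 1 1))"

definition P_Mas :: "nat \<Rightarrow> comb_type" where
  "P_Mas n = (if n = 0 then point_type else if n = 1 then segment_type
     else type_of (nestohedron (B_Mas n)))"

definition P_Gamma :: "nat \<Rightarrow> comb_type" where
  "P_Gamma n = (if n = 0 then point_type else if n = 1 then segment_type
     else type_of (nestohedron (B_Gamma n)))"

text \<open>Each summand is indexed by the exponent \<open>m\<close> of \<open>x\<close> rather than by \<open>s\<close>.\<close>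

definition Pe_series :: "polytope_ring fps" where
  "Pe_series = Abs_fps (\<lambda>m. if m = 0 then 0 else scalar (1 / fact m) * class_of (Pe (m - 1)))"

definition St_series :: "polytope_ring fps" where
  "St_series = Abs_fps (\<lambda>m. scalar (1 / fact m) * class_of (St m))"

definition P_Gamma_series :: "polytope_ring fps" where
  "P_Gamma_series = Abs_fps (\<lambda>m. scalar (1 / fact m) * class_of (P_Gamma (m + 1)))"

definition P_Mas_series :: "polytope_ring fps" where
  "P_Mas_series =
     Abs_fps (\<lambda>m. if m < 2 then 0 else scalar (1 / fact (m - 2)) * class_of (P_Mas m))"

end

theory Submission
  imports Defs
begin

text \<open>
  A facet of the nestohedron of a connected building set \<open>B\<close> on \<open>V\<close> is the face minimising the sum
  of the coordinates in some \<open>S \<in> B - {V}\<close>; it is the product of the nestohedra of the restriction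
  of \<open>B\<close> to \<open>S\<close> and of the contraction of \<open>B\<close> by \<open>S\<close>.  For \<open>P\<^sub>\<Gamma>\<close> and \<open>P\<^sub>M\<^sub>a\<^sub>s\<close> the factors are
  again permutohedra, stellahedra or members of the two families, so counting the sets \<open>S\<close> of each
  shape expresses \<open>d\<close> of the one-parameter series through products of exponential generating
  functions.  Since \<open>d\<close> is a derivation, \<open>Q = exp(q d)\<close> is a ring homomorphism with
  \<open>\<partial>Q/\<partial>q = Q \<circ> d\<close>; applying it coefficientwise gives the two equations.

  The facets are computed in the infinite-dimensional space of finitely supported sequences, where
  the theory of polytopes in Euclidean spaces does not apply; the facts needed about faces come from
  the cone spanned by a polytope modulo the directions of a face.
\<close>

section \<open>Faces of polytopes in a real vector space\<close>

text \<open>The exponents of x count unmarked vertices. A permutohedron has no mark, a stellahedron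
  has its centre, \<open>P_Gamma\<close> has two marked vertices and \<open>P_Mas\<close> three
  (there up to the factor x^2). A facet splits the unmarked labels into a subset and its complement,
  which is what a product of exponential generating functions encodes; a derivative appears whenever
  a marked vertex becomes an ordinary one in a factor. For restrictions and contractions to fall
  back into the families, the building sets are redescribed by conditions on marked vertices over
  arbitrary ground sets.

  Two obstacles shape the geometry. \<open>type_of\<close> is meaningful on simple polytopes only,
  so facets and factors have to be proved simple before their types can be computed. And contraction
  produces a Minkowski sum in which summands may repeat, while the nestohedron of a contracted
  building set has each summand once; so the product structure of a facet holds only up to
  combinatorial equivalence, and a repeated summand has to be shown not to change the face
  lattice.\<close>

lemma face_of_endpoint:
  assumes "F face_of S" "a \<in> S" "b \<in> S" "0 < t" "t \<le> 1" "(1 - t) *\<^sub>R a + t *\<^sub>R b \<in> F"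
  shows "b \<in> F"
proof (cases "a = b \<or> t = 1")
  case True
  then show ?thesis
    using assms(6) by (auto simp flip: scaleR_left_distrib)
next
  case False
  then have "(1 - t) *\<^sub>R a + t *\<^sub>R b \<in> open_segment a b"
    using assms by (auto simp: in_segment)
  then show ?thesis
    using assms unfolding face_of_def by blast
qed

text \<open>All points other than \<open>y i\<close> are merged into one point \<open>r\<close> of
  \<open>S\<close>, which reduces the claim to the segment from \<open>r\<close> to
  \<open>y i\<close>; if their total weight is zero, the sum is \<open>y i\<close> itself.\<close>

lemma face_of_convex_combination:
  assumes F: "F face_of S" "convex S" and I: "finite I" "i \<in> I"
    and y: "\<And>j. j \<in> I \<Longrightarrow> y j \<in> S" and u: "\<And>j. j \<in> I \<Longrightarrow> 0 \<le> u j" "sum u I = 1" "0 < u i"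
    and s: "(\<Sum>j\<in>I. u j *\<^sub>R y j) \<in> F"
  shows "y i \<in> F"
proof -
  let ?J = "I - {i}"
  have sum: "u i + sum u ?J = 1" using u(2) I by (simp add: sum.remove)
  have s': "u i *\<^sub>R y i + (\<Sum>j\<in>?J. u j *\<^sub>R y j) \<in> F"
    using s I by (simp add: sum.remove)
  have nn: "0 \<le> sum u ?J" using u(1) by (intro sum_nonneg) auto
  show ?thesis
  proof (cases "sum u ?J = 0")
    case True
    then have "\<forall>j\<in>?J. u j = 0" using u(1) I by (subst (asm) sum_nonneg_eq_0_iff) auto
    then show ?thesis using s' True sum by simp
  next
    case False
    define r where "r = (\<Sum>j\<in>?J. (u j / sum u ?J) *\<^sub>R y j)"
    have "r \<in> S"
      unfolding r_def using F I y u nn False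
      by (intro convex_sum) (auto simp flip: sum_divide_distrib)
    moreover have "sum u ?J *\<^sub>R r = (\<Sum>j\<in>?J. u j *\<^sub>R y j)"
      unfolding r_def using False by (simp add: scaleR_sum_right)
    ultimately show ?thesis
      using face_of_endpoint[OF F(1), of r "y i" "u i"] y u I s' sum nn
      by (simp add: add.commute eq_diff_eq[symmetric])
  qed
qed

text \<open>A direction of a convex set \<open>F\<close> is a multiple
  \<open>M *\<^sub>R (p - q)\<close> of a difference of two of its points. From x + M q = f + M p,
  division by 1 + M gives a point of \<open>F\<close> on the segment from \<open>q\<close> to
  \<open>x\<close>, different from \<open>q\<close>, so \<open>x\<close> is drawn into
  \<open>F\<close>.\<close>

lemma face_of_mem_span:
  assumes F: "F face_of S" "f \<in> F" "x \<in> S" "x - f \<in> span {a - b |a b. a \<in> F \<and> b \<in> F}"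
  shows "x \<in> F"
proof -
  have cF: "convex F" using F by (auto simp: face_of_def)
  obtain M p q where M: "0 \<le> M" "p \<in> F" "q \<in> F" "x - f = M *\<^sub>R (p - q)"
    using span_differences_convex[OF cF _ F(4)] F(2) by blast
  have eq: "x + M *\<^sub>R q = f + M *\<^sub>R p" using M(4) by (simp add: algebra_simps)
  have 1: "1 - 1 / (1 + M) = M / (1 + M)" using M by (simp add: field_simps)
  have "(1 - 1 / (1 + M)) *\<^sub>R q + (1 / (1 + M)) *\<^sub>R x = (1 / (1 + M)) *\<^sub>R (x + M *\<^sub>R q)"
    unfolding 1 by (simp add: scaleR_add_right)
  also have "\<dots> = (1 / (1 + M)) *\<^sub>R f + (M / (1 + M)) *\<^sub>R p"
    unfolding eq by (simp add: scaleR_add_right)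
  also have "\<dots> \<in> F"
    using M F by (intro convexD[OF cF]) (auto simp: add_divide_distrib[symmetric])
  finally show ?thesis
    using face_of_endpoint[OF F(1), of q x "1 / (1 + M)"] M F face_of_imp_subset[OF F(1)] by auto
qed

text \<open>A point of \<open>F\<close> written with weights on \<open>X\<close> cannot give
  positive weight to a generator outside \<open>F\<close>. That faces are polytopes and finite in
  number follows.\<close>

lemma face_of_convex_hull_finite:
  assumes X: "finite X" and F: "F face_of (convex hull X)"
  shows "F = convex hull (X \<inter> F)"
proof
  show "convex hull (X \<inter> F) \<subseteq> F"
    using F by (intro hull_minimal) (auto simp: face_of_def)
  show "F \<subseteq> convex hull (X \<inter> F)"
  proof
    fix x assume x: "x \<in> F"
    then have "x \<in> convex hull X" using F face_of_imp_subset by blast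
    then obtain u where u: "\<forall>y\<in>X. 0 \<le> u y" "sum u X = 1" "(\<Sum>y\<in>X. u y *\<^sub>R y) = x"
      using X by (auto simp: convex_hull_finite)
    have z: "u y = 0" if "y \<in> X - F" for y
      using face_of_convex_combination[OF F convex_convex_hull X, of y "\<lambda>y. y" u] that u x
      by (force simp: hull_inc)
    have "sum u (X \<inter> F) = 1"
      using u(2) X z by (subst sum.mono_neutral_left[of X]) auto
    moreover have "(\<Sum>y\<in>X \<inter> F. u y *\<^sub>R y) = x"
      using u(3) X z by (subst sum.mono_neutral_left[of X]) auto
    ultimately show "x \<in> convex hull (X \<inter> F)"
      using X u(1) by (auto simp: convex_hull_finite)
  qed
qed

lemma polytope_face:
  assumes "polytope S" "F face_of S" shows "polytope F"
  using assms face_of_convex_hull_finite unfolding polytope_def by (metis finite_Int)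

lemma finite_faces_polytope:
  assumes "polytope S" shows "finite {F. F face_of S}"
proof -
  obtain X where X: "finite X" "S = convex hull X" using assms by (auto simp: polytope_def)
  have "{F. F face_of S} \<subseteq> (\<lambda>Y. convex hull Y) ` Pow X"
    using face_of_convex_hull_finite[OF X(1)] X(2) by blast
  then show ?thesis using X(1) finite_subset by blast
qed

lemma finite_facets:
  assumes "polytope S" shows "finite (facets S)"
  using finite_faces_polytope[OF assms] by (rule rev_finite_subset) (auto simp: facets_def)

text \<open>A generating set of least cardinality is irredundant, and a generator that is not in the
  hull of the others is an extreme point.\<close>

lemma polytope_extreme_point_exists:
  assumes "polytope S" "S \<noteq> {}"
  obtains v where "v extreme_point_of S"
proof -
  let ?P = "\<lambda>X. finite X \<and> S = convex hull X"
  obtain X where X: "?P X" and min: "\<And>Y. ?P Y \<Longrightarrow> card X \<le> card Y"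
    using ex_has_least_nat[of ?P _ card] assms(1) unfolding polytope_def by metis
  obtain v where v: "v \<in> X" using X assms(2) by fastforce
  have "v \<notin> convex hull (X - {v})"
  proof
    assume "v \<in> convex hull (X - {v})"
    then have "convex hull (X - {v}) = S"
      using X v hull_redundant[of v convex "X - {v}"] by (simp add: insert_absorb)
    then show False using min[of "X - {v}"] X v card_Diff1_less[of X v] by auto
  qed
  then have "v extreme_point_of convex hull (insert v (X - {v}))"
    using X by (intro extreme_point_of_convex_hull_insert) auto
  then show ?thesis using that X v by (simp add: insert_absorb)
qed

lemma pdim_sing: "pdim {a} = 0"
proof -
  have "{x - y |x y. x \<in> {a} \<and> y \<in> {a}} = {0}" by auto
  then show ?thesis using real_vector.dim_le_card[of "{0}" "{}"] by (simp add: pdim_def)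
qed

lemma pdim_face_less:
  assumes "polytope S" "F face_of S" "F \<noteq> {}" "F \<noteq> S"
  shows "pdim F < pdim S"
  using polytope_subset_span[OF assms(1)] pdim_proper_face_less assms by blast

text \<open>
  The faces of \<open>S\<close> one dimension above a face \<open>F\<close> are the extreme rays of the cone spanned by
  \<open>S\<close> modulo the directions of \<open>F\<close>.  This cone is pointed, so every element of a minimal
  generating set spans an extreme ray, and two distinct rays meet only in the apex.
\<close>

lemma face_extension:
  fixes S :: "'a::real_vector set"
  assumes S: "polytope S" and F: "F face_of S" "F \<noteq> {}" and x: "x \<in> S" "x \<notin> F"
    and d: "pdim F + 1 < pdim S"
  obtains G where "G face_of S" "F \<subset> G" "pdim G = pdim F + 1" "x \<notin> G"
proof -
  obtain X where X: "finite X" "S = convex hull X" using S by (auto simp: polytope_def)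
  have cS: "convex S" using X by simp
  have FS: "F \<subseteq> S" using F face_of_imp_subset by blast
  obtain f where f: "f \<in> F" using F by blast
  define D where "D = {a - b |a b. a \<in> F \<and> b \<in> F}"
  define W where "W = span D"
  \<comment> \<open>\<open>cone Z\<close> contains the subspace \<open>W\<close> of directions of
    \<open>F\<close>, so the quotient by \<open>W\<close> never has to be formed.\<close>
  define cone where "cone Z = {w + (\<Sum>z\<in>Z. c z *\<^sub>R z) | w c. w \<in> W \<and> (\<forall>z\<in>Z. 0 \<le> c z)}" for Z
  have coneI: "w + (\<Sum>z\<in>Z. c z *\<^sub>R z) \<in> cone Z" if "w \<in> W" "\<forall>z\<in>Z. 0 \<le> c z" for w c Z
    using that unfolding cone_def by blast
  have coneE: thesis
    if "y \<in> cone Z" "\<And>w c. w \<in> W \<Longrightarrow> \<forall>z\<in>Z. 0 \<le> c z \<Longrightarrow> y = w + (\<Sum>z\<in>Z. c z *\<^sub>R z) \<Longrightarrow> thesis"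
    for y Z thesis
    using that unfolding cone_def by auto
  have memF: "s \<in> F" if "s \<in> S" "s - f \<in> W" for s
    using face_of_mem_span[OF F(1) f] that unfolding W_def D_def by blast
  have FW: "s - f \<in> W" if "s \<in> F" for s
    using that f unfolding W_def D_def by (blast intro: span_base)
  define Y where "Y = (\<lambda>y. y - f) ` (X - F)"
  have fY: "finite Y" using X by (simp add: Y_def)
  have YS: "z + f \<in> S" "z + f \<notin> F" if "z \<in> Y" for z
    using that X by (auto simp: Y_def hull_inc)
  have gen: "s - f \<in> cone Y" if s: "s \<in> S" for s
  proof -
    obtain u where u: "\<forall>y\<in>X. 0 \<le> u y" "sum u X = 1" "(\<Sum>y\<in>X. u y *\<^sub>R y) = s"
      using X s by (auto simp: convex_hull_finite)
    have "s - f = (\<Sum>y\<in>X. u y *\<^sub>R (y - f))"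
      using u by (simp add: scaleR_diff_right sum_subtractf flip: scaleR_sum_left)
    also have "\<dots> = (\<Sum>y\<in>X \<inter> F. u y *\<^sub>R (y - f)) + (\<Sum>y\<in>X - F. u y *\<^sub>R (y - f))"
      using X(1) by (metis sum.Int_Diff)
    also have "(\<Sum>y\<in>X - F. u y *\<^sub>R (y - f)) = (\<Sum>z\<in>Y. u (z + f) *\<^sub>R z)"
      unfolding Y_def by (subst sum.reindex) (auto simp: inj_on_def)
    finally have "s - f = (\<Sum>y\<in>X \<inter> F. u y *\<^sub>R (y - f)) + (\<Sum>z\<in>Y. u (z + f) *\<^sub>R z)" .
    moreover have "(\<Sum>y\<in>X \<inter> F. u y *\<^sub>R (y - f)) \<in> W"
      using FW unfolding W_def by (intro span_sum span_scale) auto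
    ultimately show ?thesis
      using coneI[of "\<Sum>y\<in>X \<inter> F. u y *\<^sub>R (y - f)" Y "\<lambda>z. u (z + f)"] u(1)
      by (auto simp: Y_def)
  qed
  \<comment> \<open>If some coefficient were positive, the normalised combination \<open>A\<close>
    of points of \<open>S\<close> outside \<open>F\<close> would agree with \<open>f\<close> modulo
    \<open>W\<close>; then \<open>A\<close> lies in \<open>F\<close>, and the face property pulls
    the points with positive weight into \<open>F\<close>.\<close>
  have pointed: "c z = 0"
    if Z: "Z \<subseteq> Y" "z \<in> Z" and w: "w \<in> W" and c: "\<forall>z\<in>Z. 0 \<le> c z"
      and eq: "w + (\<Sum>z\<in>Z. c z *\<^sub>R z) = 0" for Z z w c
  proof (rule ccontr)
    assume nz: "c z \<noteq> 0"
    have fZ: "finite Z" using Z fY finite_subset by blast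
    have "0 < c z" using nz c Z by force
    then have C: "0 < sum c Z" using c Z fZ by (intro sum_pos2) auto
    obtain M p q where M: "0 \<le> M" "p \<in> F" "q \<in> F" "w = M *\<^sub>R (p - q)"
      using span_differences_convex[of F w] w F face_of_imp_convex
      unfolding W_def D_def by blast
    define A where "A = (\<Sum>z\<in>Z. (c z / sum c Z) *\<^sub>R (z + f))"
    have c1: "(\<Sum>z\<in>Z. c z / sum c Z) = 1" using C by (simp flip: sum_divide_distrib)
    have AS: "A \<in> S"
      unfolding A_def using c C Z YS by (intro convex_sum[OF fZ cS c1]) auto
    have "sum c Z *\<^sub>R A = (\<Sum>z\<in>Z. c z *\<^sub>R z) + sum c Z *\<^sub>R f"
      unfolding A_def using C
      by (simp add: scaleR_sum_right scaleR_add_right sum.distrib scaleR_left.sum)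
    also have "(\<Sum>z\<in>Z. c z *\<^sub>R z) = - M *\<^sub>R (p - q)"
      using eq M(4) by (simp add: add_eq_0_iff)
    finally have e: "M *\<^sub>R p + sum c Z *\<^sub>R A = M *\<^sub>R q + sum c Z *\<^sub>R f"
      by (simp add: algebra_simps)
    let ?t = "sum c Z / (M + sum c Z)"
    have t: "1 - ?t = M / (M + sum c Z)" using C M by (simp add: field_simps)
    have "(1 - ?t) *\<^sub>R p + ?t *\<^sub>R A = (1 / (M + sum c Z)) *\<^sub>R (M *\<^sub>R p + sum c Z *\<^sub>R A)"
      unfolding t by (simp add: scaleR_add_right)
    also have "\<dots> = (M / (M + sum c Z)) *\<^sub>R q + ?t *\<^sub>R f"
      unfolding e by (simp add: scaleR_add_right)
    also have "\<dots> \<in> F"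
      using M f C face_of_imp_convex[OF F(1)]
      by (intro convexD) (auto simp: add_divide_distrib[symmetric])
    finally have "A \<in> F"
      using face_of_endpoint[OF F(1), of p A ?t] M C FS AS by auto
    then have "z + f \<in> F"
      using face_of_convex_combination[OF F(1) cS fZ Z(2), of "\<lambda>z. z + f" "\<lambda>z. c z / sum c Z"]
        YS Z c C c1 \<open>0 < c z\<close> unfolding A_def by auto
    then show False using YS Z by blast
  qed
  let ?P = "\<lambda>Z. Z \<subseteq> Y \<and> (\<forall>s\<in>S. s - f \<in> cone Z)"
  obtain Z where Z: "?P Z" and min: "\<And>Z'. ?P Z' \<Longrightarrow> card Z \<le> card Z'"
    using ex_has_least_nat[of ?P Y card] gen by blast
  have fZ: "finite Z" using Z fY finite_subset by blast
  have irred: "z \<notin> cone (Z - {z})" if z: "z \<in> Z" for z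
  proof
    assume "z \<in> cone (Z - {z})"
    then obtain w c where wc: "w \<in> W" "\<forall>y\<in>Z - {z}. 0 \<le> c y"
      and ze: "z = w + (\<Sum>y\<in>Z - {z}. c y *\<^sub>R y)"
      by (rule coneE)
    have "s - f \<in> cone (Z - {z})" if s: "s \<in> S" for s
    proof -
      obtain v b where vb: "v \<in> W" "\<forall>y\<in>Z. 0 \<le> b y" "s - f = v + (\<Sum>y\<in>Z. b y *\<^sub>R y)"
        using coneE[of "s - f" Z] Z s by blast
      have "s - f = v + (b z *\<^sub>R z + (\<Sum>y\<in>Z - {z}. b y *\<^sub>R y))"
        using vb(3) z fZ by (simp add: sum.remove)
      also have "b z *\<^sub>R z = b z *\<^sub>R w + (\<Sum>y\<in>Z - {z}. (b z * c y) *\<^sub>R y)"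
        by (subst ze) (simp add: scaleR_add_right scaleR_sum_right)
      finally have "s - f = (v + b z *\<^sub>R w) + (\<Sum>y\<in>Z - {z}. (b z * c y + b y) *\<^sub>R y)"
        by (simp add: scaleR_left_distrib sum.distrib)
      moreover have "v + b z *\<^sub>R w \<in> W"
        using vb wc unfolding W_def by (intro span_add span_scale)
      ultimately show ?thesis
        using coneI[of "v + b z *\<^sub>R w" "Z - {z}" "\<lambda>y. b z * c y + b y"] vb wc z
        by (simp add: add.assoc)
    qed
    then show False using min[of "Z - {z}"] Z z fZ card_Diff1_less[of Z z] by auto
  qed
  \<comment> \<open>\<open>G z\<close> collects the points of \<open>S\<close> on the ray of
    \<open>z\<close> modulo \<open>W\<close>; minimality of \<open>Z\<close> makes this ray extreme,
    hence \<open>G z\<close> a face.\<close>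
  define G where "G z = {s \<in> S. \<exists>w\<in>W. \<exists>c\<ge>0. s - f = w + c *\<^sub>R z}" for z
  have ray: "a \<in> G z"
    if z: "z \<in> Z" and ab: "a \<in> S" "b \<in> S" and t: "0 < t" "t < 1"
      and m: "(1 - t) *\<^sub>R a + t *\<^sub>R b \<in> G z" for z a b t
  proof -
    obtain wa ca where a: "wa \<in> W" "\<forall>y\<in>Z. 0 \<le> ca y" "a - f = wa + (\<Sum>y\<in>Z. ca y *\<^sub>R y)"
      using coneE[of "a - f" Z] Z ab(1) by blast
    obtain wb cb where b: "wb \<in> W" "\<forall>y\<in>Z. 0 \<le> cb y" "b - f = wb + (\<Sum>y\<in>Z. cb y *\<^sub>R y)"
      using coneE[of "b - f" Z] Z ab(2) by blast
    obtain w g where w: "w \<in> W" "0 \<le> g" "(1 - t) *\<^sub>R a + t *\<^sub>R b - f = w + g *\<^sub>R z"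
      using m unfolding G_def by blast
    define e where "e y = (1 - t) * ca y + t * cb y" for y
    define v where "v = (1 - t) *\<^sub>R wa + t *\<^sub>R wb - w"
    have vW: "v \<in> W" unfolding v_def W_def using a b w
      by (intro span_diff span_add span_scale) (auto simp: W_def)
    have e0: "\<forall>y\<in>Z. 0 \<le> e y" using a b t by (auto simp: e_def)
    have "w + g *\<^sub>R z = (1 - t) *\<^sub>R (a - f) + t *\<^sub>R (b - f)"
      unfolding w(3)[symmetric] by (simp add: algebra_simps)
    also have "\<dots> = (v + w) + (\<Sum>y\<in>Z. e y *\<^sub>R y)"
      unfolding a(3) b(3) e_def v_def
      by (simp add: scaleR_add_right scaleR_sum_right scaleR_left_distrib sum.distrib)
    finally have eq: "v + (\<Sum>y\<in>Z. e y *\<^sub>R y) = g *\<^sub>R z" by (simp add: algebra_simps)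
    then have eq': "v + ((e z - g) *\<^sub>R z + (\<Sum>y\<in>Z - {z}. e y *\<^sub>R y)) = 0"
      using z fZ by (simp add: sum.remove algebra_simps)
    \<comment> \<open>Otherwise the relation could be solved for \<open>z\<close> in terms of the
      other generators, against the minimality of \<open>Z\<close>. Once \<open>g \<le> e z\<close>
      is known, the relation has nonnegative coefficients and \<open>pointed\<close>
      applies.\<close>
    have ge: "g \<le> e z"
    proof (rule ccontr)
      assume "\<not> g \<le> e z"
      then have lt: "0 < g - e z" by simp
      have "(g - e z) *\<^sub>R z = v + (\<Sum>y\<in>Z - {z}. e y *\<^sub>R y)"
        using eq' by (simp add: algebra_simps)
      then have "(1 / (g - e z)) *\<^sub>R (g - e z) *\<^sub>R z
          = (1 / (g - e z)) *\<^sub>R (v + (\<Sum>y\<in>Z - {z}. e y *\<^sub>R y))"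
        by (rule arg_cong)
      then have ze: "z = (1 / (g - e z)) *\<^sub>R v + (\<Sum>y\<in>Z - {z}. (e y / (g - e z)) *\<^sub>R y)"
        using lt by (simp add: scaleR_add_right scaleR_sum_right)
      have "(1 / (g - e z)) *\<^sub>R v \<in> W" using vW unfolding W_def by (rule span_scale)
      moreover have "\<forall>y\<in>Z - {z}. 0 \<le> e y / (g - e z)" using e0 lt by auto
      ultimately have "z \<in> cone (Z - {z})"
        by (subst ze) (rule coneI)
      then show False using irred z by blast
    qed
    define e' where "e' = e(z := e z - g)"
    have "(\<Sum>y\<in>Z. e' y *\<^sub>R y) = e' z *\<^sub>R z + (\<Sum>y\<in>Z - {z}. e' y *\<^sub>R y)"
      using z fZ by (simp add: sum.remove)
    also have "\<dots> = (e z - g) *\<^sub>R z + (\<Sum>y\<in>Z - {z}. e y *\<^sub>R y)"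
      unfolding e'_def by (intro arg_cong2[of _ _ _ _ "(+)"] sum.cong) auto
    finally have "v + (\<Sum>y\<in>Z. e' y *\<^sub>R y) = 0" using eq' by simp
    then have e'0: "e' y = 0" if "y \<in> Z" for y
      using pointed[of Z y v e'] Z that vW e0 ge by (auto simp: e'_def)
    have "ca y = 0" if y: "y \<in> Z - {z}" for y
    proof -
      have "(1 - t) * ca y + t * cb y = 0" using e'0[of y] y by (auto simp: e'_def e_def)
      moreover have "0 \<le> (1 - t) * ca y" "0 \<le> t * cb y" using a(2) b(2) t y by auto
      ultimately have "(1 - t) * ca y = 0" by linarith
      then show ?thesis using t by simp
    qed
    then have "(\<Sum>y\<in>Z. ca y *\<^sub>R y) = ca z *\<^sub>R z"
      using z fZ by (simp add: sum.remove)
    then show ?thesis using a z ab unfolding G_def by auto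
  qed
  have face: "G z face_of S" if z: "z \<in> Z" for z
    unfolding face_of_def
  proof (intro conjI ballI impI)
    show "G z \<subseteq> S" by (auto simp: G_def)
    show "convex (G z)"
    proof (rule convexI)
      fix a b and u v :: real
      assume h: "a \<in> G z" "b \<in> G z" "0 \<le> u" "0 \<le> v" "u + v = 1"
      obtain wa ca where a: "wa \<in> W" "0 \<le> ca" "a - f = wa + ca *\<^sub>R z" "a \<in> S"
        using h unfolding G_def by blast
      obtain wb cb where b: "wb \<in> W" "0 \<le> cb" "b - f = wb + cb *\<^sub>R z" "b \<in> S"
        using h unfolding G_def by blast
      have "u *\<^sub>R a + v *\<^sub>R b - f = u *\<^sub>R (a - f) + v *\<^sub>R (b - f)"
        using h(5) by (simp add: algebra_simps flip: scaleR_left_distrib)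
      also have "\<dots> = (u *\<^sub>R wa + v *\<^sub>R wb) + (u * ca + v * cb) *\<^sub>R z"
        unfolding a b by (simp add: algebra_simps)
      finally have "u *\<^sub>R a + v *\<^sub>R b - f = (u *\<^sub>R wa + v *\<^sub>R wb) + (u * ca + v * cb) *\<^sub>R z" .
      moreover have "u *\<^sub>R wa + v *\<^sub>R wb \<in> W"
        using a b unfolding W_def by (intro span_add span_scale)
      moreover have "u *\<^sub>R a + v *\<^sub>R b \<in> S" using convexD[OF cS] a b h by blast
      moreover have "0 \<le> u * ca + v * cb" using a b h by simp
      ultimately show "u *\<^sub>R a + v *\<^sub>R b \<in> G z" unfolding G_def by blast
    qed
    fix a b m assume h: "a \<in> S" "b \<in> S" "m \<in> G z" "m \<in> open_segment a b"
    then obtain t where t: "0 < t" "t < 1" "m = (1 - t) *\<^sub>R a + t *\<^sub>R b" by (auto simp: in_segment)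
    show "a \<in> G z" using ray[OF z h(1,2) t(1,2)] h t by simp
    show "b \<in> G z" using ray[OF z h(2,1), of "1 - t"] h t by (simp add: add.commute)
  qed
  have zG: "z + f \<in> G z" if "z \<in> Z" for z
    using YS[of z] Z that unfolding G_def W_def
    by (intro CollectI conjI bexI[of _ 0] exI[of _ 1]) (auto simp: span_zero)
  have sub: "F \<subset> G z" if z: "z \<in> Z" for z
  proof
    show "F \<subseteq> G z" using FS FW by (force simp: G_def)
    show "F \<noteq> G z" using YS[of z] zG[OF z] Z z by auto
  qed
  have dimG: "pdim (G z) = pdim F + 1" if z: "z \<in> Z" for z
  proof -
    let ?D = "{a - b |a b. a \<in> G z \<and> b \<in> G z}"
    obtain B where B: "B \<subseteq> D" "independent B" "D \<subseteq> span B" "card B = dim D"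
      using real_vector.basis_exists by blast
    have WB: "W = span B" unfolding W_def using B by (metis span_mono span_span subset_antisym)
    obtain K where K: "finite K" "S \<subseteq> span K" using polytope_subset_span S by blast
    have "D \<subseteq> span K" using K FS by (auto simp: D_def intro!: span_diff)
    then have fB: "finite B" using B K by (meson independent_span_bound subset_trans)
    have "z \<notin> span B" using memF[of "z + f"] YS[of z] Z z by (auto simp: WB)
    then have ind: "independent (insert z B)" "z \<notin> B"
      using B(2) by (auto simp: independent_insertI span_base)
    have "z = (z + f) - f" by simp
    then have "z \<in> ?D" using zG[OF z] sub[OF z] f by blast
    moreover have "D \<subseteq> ?D" using sub[OF z] unfolding D_def by blast
    ultimately have "insert z B \<subseteq> ?D" using B by blast
    moreover have "?D \<subseteq> span (insert z B)"
    proof safe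
      fix a b assume ab: "a \<in> G z" "b \<in> G z"
      have *: "s - f \<in> span (insert z B)" if sG: "s \<in> G z" for s
      proof -
        obtain w c where wc: "w \<in> W" "s - f = w + c *\<^sub>R z" using sG unfolding G_def by blast
        have "w \<in> span (insert z B)" using wc(1) WB span_mono[of B "insert z B"] by blast
        then show ?thesis unfolding wc(2) by (intro span_add span_scale span_base[of z]) auto
      qed
      have "a - b = (a - f) - (b - f)" by simp
      then show "a - b \<in> span (insert z B)" using *[OF ab(1)] *[OF ab(2)] span_diff by metis
    qed
    ultimately have "card (insert z B) = dim ?D" using ind by (intro real_vector.basis_card_eq_dim)
    then show ?thesis using ind fB B(4) unfolding pdim_def D_def[symmetric] by simp
  qed
  have inter: "z = z'" if z: "z \<in> Z" "z' \<in> Z" and xz: "x \<in> G z" "x \<in> G z'" for z z'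
  proof (rule ccontr)
    assume ne: "z \<noteq> z'"
    obtain w c where wc: "w \<in> W" "0 \<le> c" "x - f = w + c *\<^sub>R z" using xz unfolding G_def by blast
    obtain v b where vb: "v \<in> W" "0 \<le> b" "x - f = v + b *\<^sub>R z'" using xz unfolding G_def by blast
    have "c \<noteq> 0" using wc memF x by auto
    have "c *\<^sub>R z = (v - w) + b *\<^sub>R z'" using wc(3) vb(3) by (simp add: algebra_simps)
    then have "(1 / c) *\<^sub>R c *\<^sub>R z = (1 / c) *\<^sub>R ((v - w) + b *\<^sub>R z')" by (rule arg_cong)
    then have "z = (1 / c) *\<^sub>R (v - w) + (b / c) *\<^sub>R z'"
      using \<open>c \<noteq> 0\<close> by (simp add: scaleR_add_right)
    also have "(b / c) *\<^sub>R z' = (\<Sum>y\<in>Z - {z}. (if y = z' then b / c else 0) *\<^sub>R y)"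
      using z ne fZ by (simp add: if_distrib[of "\<lambda>c. c *\<^sub>R _"] sum.delta cong: if_cong)
    finally have ze: "z = (1 / c) *\<^sub>R (v - w) + (\<Sum>y\<in>Z - {z}. (if y = z' then b / c else 0) *\<^sub>R y)" .
    have "(1 / c) *\<^sub>R (v - w) \<in> W"
      using vb wc unfolding W_def by (intro span_scale span_diff)
    then have "z \<in> cone (Z - {z})"
      by (subst ze, intro coneI) (use vb wc in auto)
    then show False using irred z by blast
  qed
  have "Z \<noteq> {}" using Z memF x unfolding cone_def by fastforce
  then obtain z where z: "z \<in> Z" by blast
  \<comment> \<open>With a single generator all of \<open>S\<close> would lie on one ray, so
    \<open>S\<close> would have dimension \<open>pdim F + 1\<close>. Of two distinct rays at least
    one misses \<open>x\<close>.\<close>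
  obtain z' where z': "z' \<in> Z" "z' \<noteq> z"
  proof (rule ccontr)
    assume "\<not> thesis"
    then have Zz: "Z = {z}" using that z by blast
    have "s \<in> G z" if s: "s \<in> S" for s
    proof -
      obtain w c where "w \<in> W" "0 \<le> c z" "s - f = w + c z *\<^sub>R z"
        using coneE[of "s - f" Z] Z s unfolding Zz by auto
      then show ?thesis using s unfolding G_def by blast
    qed
    then have "G z = S" by (auto simp: G_def)
    then show False using dimG[OF z] d by simp
  qed
  show thesis
    using that[OF face[OF z] sub[OF z] dimG[OF z]] that[OF face[OF z'(1)] sub[OF z'(1)] dimG[OF z'(1)]]
      inter[OF z z'(1)] z'(2) by blast
qed

section \<open>Facets above a face, and the facets of a simple polytope\<close>

lemma face_extension_one:
  assumes S: "polytope S" and F: "F face_of S" "F \<noteq> {}" "F \<noteq> S"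
  obtains G where "G face_of S" "F \<subset> G" "pdim G = pdim F + 1"
proof (cases "pdim F + 1 < pdim S")
  case True
  obtain x where "x \<in> S" "x \<notin> F" using F face_of_imp_subset by blast
  then show ?thesis using face_extension[OF S F(1,2)] True that by metis
next
  case False
  then have "pdim S = pdim F + 1" using pdim_face_less[OF S F] by simp
  then show ?thesis
    using that[of S] S F face_of_imp_subset[OF F(1)] polytope_imp_convex[OF S]
    by (simp add: face_of_refl_eq psubset_eq)
qed

text \<open>Climb from \<open>F\<close> one dimension at a time through faces that avoid
  \<open>x\<close>; \<open>face_extension\<close> permits this as long as the codimension is at
  least two.\<close>

lemma facet_avoiding_point:
  assumes S: "polytope S" and F: "F face_of S" "F \<noteq> {}" and x: "x \<in> S" "x \<notin> F"
  obtains H where "H \<in> facets S" "F \<subseteq> H" "x \<notin> H"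
proof -
  have "\<exists>H\<in>facets S. F \<subseteq> H \<and> x \<notin> H" using F x
  proof (induction "pdim S - pdim F" arbitrary: F rule: less_induct)
    case less
    have lt: "pdim F < pdim S" using pdim_face_less[OF S less.prems(1,2)] less.prems by blast
    show ?case
    proof (cases "pdim F + 1 = pdim S")
      case True
      then show ?thesis using less.prems by (auto simp: facets_def)
    next
      case False
      then obtain G where G: "G face_of S" "F \<subset> G" "pdim G = pdim F + 1" "x \<notin> G"
        using face_extension[OF S less.prems] lt by (metis Suc_eq_plus1 Suc_lessI)
      then show ?thesis using less.hyps[of G] less.prems lt by (metis diff_less_mono2 less_add_one
          psubset_imp_subset subset_empty subset_trans x(1))
    qed
  qed
  then show ?thesis using that by blast
qed

text \<open>Some facet separates a face from any point outside it, so the facets above a nonempty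
  face determine it.\<close>

lemma face_eqI_facets:
  assumes S: "polytope S" and F: "F face_of S" "F \<noteq> {}" and G: "G face_of S" "G \<noteq> {}"
    and eq: "\<And>H. H \<in> facets S \<Longrightarrow> F \<subseteq> H \<longleftrightarrow> G \<subseteq> H"
  shows "F = G"
proof -
  have sub: "A \<subseteq> B" if AB: "A face_of S" "B face_of S" "B \<noteq> {}"
    and h: "\<And>H. H \<in> facets S \<Longrightarrow> A \<subseteq> H \<longleftrightarrow> B \<subseteq> H" for A B
  proof
    fix x assume x: "x \<in> A"
    show "x \<in> B"
    proof (rule ccontr)
      assume "x \<notin> B"
      then obtain H where "H \<in> facets S" "B \<subseteq> H" "x \<notin> H"
        using facet_avoiding_point[OF S AB(2,3), of x] x face_of_imp_subset[OF AB(1)] by blast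
      then show False using h x by blast
    qed
  qed
  show ?thesis using sub[OF F(1) G] sub[OF G(1) F] eq by blast
qed

text \<open>Each step up by one dimension gains a point that some facet above the lower face avoids,
  so it loses at least one facet. This bounds the facets at a vertex from below and, in a simple
  polytope, the facets above a ridge from above.\<close>

lemma card_facets_above_mono:
  assumes S: "polytope S" and G: "G face_of S" and H: "H face_of G" "H \<noteq> {}"
  shows "card {F \<in> facets S. G \<subseteq> F} + pdim G \<le> card {F \<in> facets S. H \<subseteq> F} + pdim H"
  using H
proof (induction "pdim G - pdim H" arbitrary: H rule: less_induct)
  case less
  have PG: "polytope G" using polytope_face[OF S G] .
  show ?case
  proof (cases "H = G")
    case False
    obtain H' where H': "H' face_of G" "H \<subset> H'" "pdim H' = pdim H + 1"
      using face_extension_one[OF PG less.prems False] by blast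
    have lt: "pdim H < pdim G" using pdim_face_less[OF PG less.prems False] .
    have IH: "card {F \<in> facets S. G \<subseteq> F} + pdim G \<le> card {F \<in> facets S. H' \<subseteq> F} + pdim H'"
      using less.hyps[of H'] H' lt by fastforce
    obtain x where x: "x \<in> H'" "x \<notin> H" using H' by blast
    have HS: "H face_of S" using less.prems(1) G by (rule face_of_trans)
    have "x \<in> S" using x H' G face_of_imp_subset by blast
    then obtain K where K: "K \<in> facets S" "H \<subseteq> K" "x \<notin> K"
      using facet_avoiding_point[OF S HS less.prems(2) _ x(2)] by blast
    have "{F \<in> facets S. H' \<subseteq> F} \<subset> {F \<in> facets S. H \<subseteq> F}" using K x H' by blast
    then have "card {F \<in> facets S. H' \<subseteq> F} < card {F \<in> facets S. H \<subseteq> F}"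
      using finite_facets[OF S] by (intro psubset_card_mono) auto
    then show ?thesis using IH H' by simp
  qed simp
qed

lemma extreme_point_imp_face: "v extreme_point_of S \<Longrightarrow> {v} face_of S"
  by (simp add: face_of_singleton)

text \<open>With \<open>G = S\<close> no facet lies above \<open>G\<close>. One inequality in the
  definition of simplicity thus holds for every polytope, and proofs of simplicity need to bound the
  facets at a vertex from above only.\<close>

lemma card_facets_extreme_point_ge:
  assumes S: "polytope S" and v: "v extreme_point_of S"
  shows "pdim S \<le> card {F \<in> facets S. v \<in> F}"
  using card_facets_above_mono[OF S face_of_refl extreme_point_imp_face[OF v]]
    polytope_imp_convex[OF S] by (simp add: pdim_sing)

lemma facet_neq: "F \<in> facets S \<Longrightarrow> F \<noteq> S" by (auto simp: facets_def)

lemma facet_maximal: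
  assumes "polytope S" "F \<in> facets S" "G face_of S" "F \<subseteq> G"
  shows "G = F \<or> G = S"
proof (rule ccontr)
  assume ne: "\<not> ?thesis"
  have F: "F face_of S" "F \<noteq> {}" "pdim F + 1 = pdim S" using assms by (auto simp: facets_def)
  have "F face_of G" using face_of_subset[OF F(1) assms(4) face_of_imp_subset[OF assms(3)]] .
  then have "pdim F < pdim G"
    using pdim_face_less[OF polytope_face[OF assms(1,3)], of F] F ne by blast
  moreover have "pdim G < pdim S" using pdim_face_less[OF assms(1,3)] F assms(4) ne by blast
  ultimately show False using F by simp
qed

text \<open>Being a coatom refers to inclusion of faces alone, which lets isomorphisms of face
  lattices carry facets to facets.\<close>

lemma facets_iff_coatom:
  assumes S: "polytope S"
  shows "F \<in> facets S \<longleftrightarrow> F face_of S \<and> F \<noteq> {} \<and> F \<noteq> S \<and>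
    (\<forall>G. G face_of S \<longrightarrow> F \<subseteq> G \<longrightarrow> G = F \<or> G = S)" (is "?L \<longleftrightarrow> ?R")
proof
  assume ?L then show ?R using facet_maximal[OF S] facet_neq by (auto simp: facets_def)
next
  assume R: ?R
  then obtain G where G: "G face_of S" "F \<subset> G" "pdim G = pdim F + 1"
    using face_extension_one[OF S] by metis
  then have "G = S" using R by blast
  then show ?L using G R by (simp add: facets_def)
qed

text \<open>A facet \<open>G\<close> of \<open>F\<close> through \<open>v\<close> is a ridge of
  \<open>S\<close> and lies in exactly one facet \<open>h G\<close> of \<open>S\<close> besides
  \<open>F\<close>. Since \<open>F\<close> and \<open>h G\<close> determine \<open>G\<close>, the
  facets of \<open>F\<close> at \<open>v\<close> inject into the \<open>pdim S - 1\<close> other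
  facets of \<open>S\<close> at \<open>v\<close>.\<close>

lemma simple_polytope_facet:
  assumes S: "simple_polytope S" and F: "F \<in> facets S"
  shows "simple_polytope F"
proof -
  have PS: "polytope S" using S by (simp add: simple_polytope_def)
  have FS: "F face_of S" "F \<noteq> {}" "pdim F + 1 = pdim S" using F by (auto simp: facets_def)
  have PF: "polytope F" using polytope_face[OF PS FS(1)] .
  have "card {G \<in> facets F. v \<in> G} = pdim F" if v: "v extreme_point_of F" for v
  proof (rule antisym)
    show "pdim F \<le> card {G \<in> facets F. v \<in> G}" by (rule card_facets_extreme_point_ge[OF PF v])
    have vS: "v extreme_point_of S" "v \<in> F" using v extreme_point_of_face[OF FS(1)] by auto
    define A where "A G = {H \<in> facets S. G \<subseteq> H}" for G
    have Av: "card (A {v}) = pdim S" using S vS(1) by (simp add: simple_polytope_def A_def)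
    have finA: "finite (A G)" for G using finite_facets[OF PS] by (simp add: A_def)
    have AF: "A F = {F}"
      using facet_maximal[OF PS F] F facet_neq unfolding A_def facets_def by fastforce
    have ridge: "\<exists>H. H \<in> A {v} - {F} \<and> A G = {F, H}" if G: "G \<in> facets F" "v \<in> G" for G
    proof -
      have GF: "G face_of F" "G \<noteq> {}" "pdim G + 1 = pdim F" using G by (auto simp: facets_def)
      have GS: "G face_of S" using GF(1) FS(1) by (rule face_of_trans)
      have "{v} face_of G"
        using face_of_subset[OF extreme_point_imp_face[OF v]] G face_of_imp_subset[OF GF(1)] by simp
      \<comment> \<open>\<open>card (A G) + pdim G\<close> is at most
        \<open>card (A {v}) = pdim S\<close>, and \<open>pdim G\<close> is
        \<open>pdim S - 2\<close>.\<close>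
      then have "card (A G) \<le> 2"
        using card_facets_above_mono[OF PS GS, of "{v}"] Av GF FS unfolding A_def
        by (simp add: pdim_sing)
      moreover have FA: "F \<in> A G" using F face_of_imp_subset[OF GF(1)] by (simp add: A_def)
      moreover have "A G \<noteq> {F}"
      proof
        assume "A G = {F}"
        then have "G = F"
          using face_eqI_facets[OF PS GS GF(2) FS(1,2)] AF unfolding A_def by blast
        then show False using facet_neq G by blast
      qed
      ultimately obtain H where H: "H \<in> A G" "H \<noteq> F" by blast
      then have "{F, H} \<subseteq> A G" "card {F, H} = 2" using FA by auto
      then have "A G = {F, H}" using \<open>card (A G) \<le> 2\<close> finA card_seteq by metis
      moreover have "H \<in> A {v}" using H G unfolding A_def by blast
      ultimately show ?thesis using H by blast
    qed
    define h where "h G = (SOME H. H \<in> A {v} - {F} \<and> A G = {F, H})" for G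
    have h: "h G \<in> A {v} - {F}" "A G = {F, h G}" if "G \<in> {G \<in> facets F. v \<in> G}" for G
      using someI_ex[OF ridge, of G] that unfolding h_def by blast+
    have "inj_on h {G \<in> facets F. v \<in> G}"
    proof (rule inj_onI)
      fix G G' assume G: "G \<in> {G \<in> facets F. v \<in> G}" "G' \<in> {G \<in> facets F. v \<in> G}" "h G = h G'"
      then have "A G = A G'" using h(2) by metis
      moreover have "G face_of S" "G' face_of S" "G \<noteq> {}" "G' \<noteq> {}"
        using G FS(1) face_of_trans by (auto simp: facets_def)
      ultimately show "G = G'" using face_eqI_facets[OF PS, of G G'] unfolding A_def by blast
    qed
    then have "card {G \<in> facets F. v \<in> G} \<le> card (A {v} - {F})"
      using h(1) finA by (intro card_inj_on_le) auto
    also have "\<dots> = pdim F"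
      using Av F vS FS(3) finA by (subst card_Diff_singleton) (auto simp: A_def)
    finally show "card {G \<in> facets F. v \<in> G} \<le> pdim F" .
  qed
  then show ?thesis using PF FS(2) by (simp add: simple_polytope_def)
qed

text \<open>The functional is the coordinate along a vector \<open>z\<close> leading out of
  \<open>F\<close>, with the directions of \<open>F\<close> in its kernel; as \<open>F\<close> has
  codimension one, these exhaust the directions of \<open>S\<close>.\<close>

lemma facet_exposed:
  fixes S :: "'a::real_vector set"
  assumes S: "polytope S" and F: "F \<in> facets S"
  obtains u :: "'a \<Rightarrow> real" and m where "linear u" "F = {x \<in> S. u x = m}"
    "\<And>x. x \<in> S \<Longrightarrow> m \<le> u x" "\<exists>x\<in>S. u x \<noteq> m"
proof -
  have FS: "F face_of S" "F \<noteq> {}" "pdim F + 1 = pdim S" using F by (auto simp: facets_def)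
  have sub: "F \<subseteq> S" using FS face_of_imp_subset by blast
  obtain f where f: "f \<in> F" using FS by blast
  obtain x0 where x0: "x0 \<in> S" "x0 \<notin> F" using sub facet_neq[OF F] by blast
  let ?D = "\<lambda>S::'a set. {a - b |a b. a \<in> S \<and> b \<in> S}"
  define z where "z = x0 - f"
  obtain B where B: "B \<subseteq> ?D F" "independent B" "?D F \<subseteq> span B" "card B = dim (?D F)"
    using real_vector.basis_exists by blast
  obtain C where C: "C \<subseteq> ?D S" "independent C" "?D S \<subseteq> span C" "card C = dim (?D S)"
    using real_vector.basis_exists by blast
  obtain K where K: "finite K" "S \<subseteq> span K" using polytope_subset_span S by blast
  have fin: "finite Z" if "Z \<subseteq> ?D S" "independent Z" for Z
  proof -
    have "?D S \<subseteq> span K" using K by (auto intro: span_diff)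
    then show ?thesis using that K by (meson independent_span_bound subset_trans)
  qed
  have DFS: "?D F \<subseteq> ?D S" using sub by blast
  have fB: "finite B" using fin[OF order_trans[OF B(1) DFS] B(2)] .
  have fC: "finite C" using fin[OF C(1,2)] .
  have spB: "span (?D F) = span B" 
    by (rule subset_antisym[OF span_minimal[OF B(3) subspace_span] span_mono[OF B(1)]])
  have memF: "x \<in> F" if "x \<in> S" "x - f \<in> span B" for x
    using face_of_mem_span[OF FS(1) f that(1)] that(2) spB by simp
  have zB: "z \<notin> span B" using memF[OF x0(1)] x0(2) by (auto simp: z_def)
  have ind: "independent (insert z B)" "z \<notin> B"
    using B(2) zB by (auto simp: independent_insertI span_base)
  have zD: "z \<in> ?D S" unfolding z_def using x0(1) f sub by blast
  \<comment> \<open>A direction of \<open>S\<close> outside the span of \<open>z\<close> and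
    \<open>B\<close> would give \<open>pdim F + 2\<close> independent directions of
    \<open>S\<close>.\<close>
  have spS: "y \<in> span (insert z B)" if y: "y \<in> ?D S" for y
  proof (rule ccontr)
    assume ny: "y \<notin> span (insert z B)"
    then have "independent (insert y (insert z B))" using ind by (simp add: independent_insertI)
    moreover have "insert y (insert z B) \<subseteq> span C"
      using y zD B(1) C(3) DFS by blast
    ultimately have "card (insert y (insert z B)) \<le> card C"
      using independent_span_bound[OF fC] by blast
    moreover have "y \<notin> insert z B" using ny span_base by blast
    ultimately show False using B(4) C(4) FS(3) fB ind by (simp add: pdim_def)
  qed
  obtain u :: "'a \<Rightarrow> real" where u: "linear u" "\<forall>x\<in>insert z B. u x = (if x = z then 1 else 0)"
    using linear_independent_extend[OF ind(1), of "\<lambda>x. if x = z then 1 else 0"] by blast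
  have uB: "u w = 0" if "w \<in> span B" for w
  proof (rule linear_eq_0_on_span[OF u(1) _ that])
    show "u x = 0" if "x \<in> B" for x using u(2) ind(2) that by auto
  qed
  have uz: "u z = 1" using u(2) by simp
  have dec: "s - f - u (s - f) *\<^sub>R z \<in> span B" if s: "s \<in> S" for s
  proof -
    have "s - f \<in> ?D S" using s f sub by blast
    then have "s - f \<in> span (insert z B)" by (rule spS)
    then obtain k where k: "s - f - k *\<^sub>R z \<in> span B" using span_breakdown_eq by blast
    have "u (s - f - k *\<^sub>R z) = u (s - f) - k"
      using uz by (simp add: linear_diff[OF u(1)] linear_scale[OF u(1)])
    then show ?thesis using uB[OF k] k by simp
  qed
  have pos: "0 \<le> u (s - f)" if s: "s \<in> S" for s
  proof (rule ccontr)
    define k where "k = u (s - f)"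
    assume "\<not> 0 \<le> u (s - f)"
    then have k: "k < 0" by (simp add: k_def)
    \<comment> \<open>Chosen so that (1 - t) k + t = 0: the point \<open>?m\<close> between
      \<open>s\<close> and \<open>x0\<close> then differs from \<open>f\<close> by a direction of
      \<open>F\<close>, hence lies in \<open>F\<close> and pulls \<open>x0\<close> into
      \<open>F\<close>.\<close>
    let ?t = "- k / (1 - k)"
    let ?m = "(1 - ?t) *\<^sub>R s + ?t *\<^sub>R x0"
    have 1: "1 - ?t = 1 / (1 - k)" using k by (simp add: field_simps)
    have "?m - f = (1 - ?t) *\<^sub>R (s - f - k *\<^sub>R z) + ((1 - ?t) * k + ?t) *\<^sub>R z"
      by (simp add: z_def algebra_simps)
    also have "(1 - ?t) * k + ?t = 0" unfolding 1 using k by (simp add: field_simps)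
    finally have "?m - f \<in> span B" using dec[OF s] by (simp add: k_def span_scale)
    moreover have "?m \<in> S"
      using polytope_imp_convex[OF S] s x0 k by (intro convexD) (auto simp: field_simps)
    ultimately have "?m \<in> F" using memF by blast
    then have "x0 \<in> F"
      using face_of_endpoint[OF FS(1) s x0(1), of ?t] k by (simp add: field_simps)
    then show False using x0 by simp
  qed
  have diff: "u (s - f) = u s - u f" for s by (simp add: linear_diff[OF u(1)])
  show thesis
  proof (rule that[OF u(1), of "u f"])
    show "F = {x \<in> S. u x = u f}"
    proof (intro equalityI subsetI)
      fix x assume x: "x \<in> F"
      then have "x - f \<in> span B" using f B(3) by blast
      then show "x \<in> {x \<in> S. u x = u f}" using uB[of "x - f"] x sub by (auto simp: diff)
    next
      fix x assume "x \<in> {x \<in> S. u x = u f}"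
      then show "x \<in> F" using dec[of x] memF[of x] by (simp add: diff)
    qed
    show "u f \<le> u x" if "x \<in> S" for x using pos[OF that] by (simp add: diff)
    show "\<exists>x\<in>S. u x \<noteq> u f" using x0 uz by (intro bexI[of _ x0]) (auto simp: z_def diff)
  qed
qed

section \<open>Combinatorial invariance\<close>

text \<open>The witness of \<open>comb_equiv\<close> is named because it has to be restricted to
  faces and followed on facets.\<close>

definition face_iso :: "('a::real_vector set \<Rightarrow> 'b::real_vector set) \<Rightarrow> 'a set \<Rightarrow> 'b set \<Rightarrow> bool" where
  "face_iso \<phi> S T \<longleftrightarrow> bij_betw \<phi> {F. F face_of S} {G. G face_of T} \<and>
     (\<forall>F F'. F face_of S \<longrightarrow> F' face_of S \<longrightarrow> (F \<subseteq> F' \<longleftrightarrow> \<phi> F \<subseteq> \<phi> F'))"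

lemma comb_equiv_iff_face_iso: "comb_equiv S T \<longleftrightarrow> (\<exists>\<phi>. face_iso \<phi> S T)"
  by (simp add: comb_equiv_def face_iso_def)

lemma face_isoD:
  assumes "face_iso \<phi> S T"
  shows face_iso_face: "F face_of S \<Longrightarrow> \<phi> F face_of T"
    and face_iso_mono: "F face_of S \<Longrightarrow> F' face_of S \<Longrightarrow> \<phi> F \<subseteq> \<phi> F' \<longleftrightarrow> F \<subseteq> F'"
    and face_iso_surj: "G face_of T \<Longrightarrow> \<exists>F. F face_of S \<and> \<phi> F = G"
proof -
  have b: "\<phi> ` {F. F face_of S} = {G. G face_of T}"
    using assms by (simp add: face_iso_def bij_betw_def)
  show "F face_of S \<Longrightarrow> \<phi> F face_of T" using b by blast
  show "F face_of S \<Longrightarrow> F' face_of S \<Longrightarrow> \<phi> F \<subseteq> \<phi> F' \<longleftrightarrow> F \<subseteq> F'"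
    using assms by (simp add: face_iso_def)
  show "\<exists>F. F face_of S \<and> \<phi> F = G" if "G face_of T"
  proof -
    have "G \<in> \<phi> ` {F. F face_of S}" using b that by simp
    then show ?thesis by blast
  qed
qed

lemma face_iso_eq:
  assumes "face_iso \<phi> S T" "F face_of S" "F' face_of S" shows "\<phi> F = \<phi> F' \<longleftrightarrow> F = F'"
  using face_iso_mono[OF assms(1)] assms(2,3) by blast

lemma face_iso_empty:
  assumes "face_iso \<phi> S T" shows "\<phi> {} = {}"
proof -
  obtain F where F: "F face_of S" "\<phi> F = {}" using face_iso_surj[OF assms empty_face_of] by blast
  then show ?thesis using face_iso_mono[OF assms empty_face_of F(1)] by simp
qed

lemma face_iso_top:
  assumes "face_iso \<phi> S T" "convex S" "convex T" shows "\<phi> S = T"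
proof -
  have S: "S face_of S" "T face_of T" using assms by (auto simp: face_of_refl)
  then obtain F where F: "F face_of S" "\<phi> F = T" using face_iso_surj[OF assms(1)] by blast
  then have "T \<subseteq> \<phi> S" using face_iso_mono[OF assms(1) F(1) S(1)] face_of_imp_subset by blast
  then show ?thesis using face_iso_face[OF assms(1) S(1)] face_of_imp_subset by blast
qed

text \<open>The faces of a face \<open>F\<close> are the faces of \<open>S\<close> contained in
  \<open>F\<close>, so the same map serves. Dimensions and types of facets are compared through this
  restriction.\<close>

lemma face_iso_restrict:
  assumes iso: "face_iso \<phi> S T" and F: "F face_of S"
  shows "face_iso \<phi> F (\<phi> F)"
proof -
  have G: "\<phi> F face_of T" using face_iso_face[OF iso F] .
  have "\<phi> ` {E. E face_of F} = {E. E face_of \<phi> F}"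
  proof (intro equalityI subsetI)
    fix K assume "K \<in> \<phi> ` {E. E face_of F}"
    then obtain E where E: "K = \<phi> E" "E face_of S" "E \<subseteq> F" using face_of_face[OF F] by auto
    then show "K \<in> {E. E face_of \<phi> F}"
      using face_of_face[OF G] face_iso_face[OF iso] face_iso_mono[OF iso _ F] by simp
  next
    fix K assume "K \<in> {E. E face_of \<phi> F}"
    then have K: "K face_of T" "K \<subseteq> \<phi> F" using face_of_face[OF G] by auto
    then obtain E where E: "E face_of S" "\<phi> E = K" using face_iso_surj[OF iso] by blast
    then have "E \<subseteq> F" using K E face_iso_mono[OF iso E(1) F] by simp
    then show "K \<in> \<phi> ` {E. E face_of F}" using E face_of_face[OF F] by blast
  qed
  moreover have "inj_on \<phi> {E. E face_of F}"
    using face_of_face[OF F] face_iso_eq[OF iso] by (auto simp: inj_on_def)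
  ultimately show ?thesis
    using face_of_face[OF F] face_iso_mono[OF iso] by (simp add: face_iso_def bij_betw_def)
qed

lemma face_iso_facet:
  assumes iso: "face_iso \<phi> S T" and P: "polytope S" "polytope T" and F: "F face_of S"
  shows "\<phi> F \<in> facets T \<longleftrightarrow> F \<in> facets S"
proof -
  have top: "\<phi> S = T" using face_iso_top[OF iso polytope_imp_convex[OF P(1)] polytope_imp_convex[OF P(2)]] .
  have S: "S face_of S" using face_of_refl[OF polytope_imp_convex[OF P(1)]] .
  have e: "\<phi> F = {} \<longleftrightarrow> F = {}" "\<phi> F = T \<longleftrightarrow> F = S"
    using face_iso_eq[OF iso F empty_face_of] face_iso_empty[OF iso] face_iso_eq[OF iso F S] top
    by simp_all
  have "(\<forall>G. G face_of T \<longrightarrow> \<phi> F \<subseteq> G \<longrightarrow> G = \<phi> F \<or> G = T) \<longleftrightarrow>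
      (\<forall>G. G face_of S \<longrightarrow> \<phi> F \<subseteq> \<phi> G \<longrightarrow> \<phi> G = \<phi> F \<or> \<phi> G = \<phi> S)"
    using face_iso_face[OF iso] face_iso_surj[OF iso] top by metis
  also have "\<dots> \<longleftrightarrow> (\<forall>G. G face_of S \<longrightarrow> F \<subseteq> G \<longrightarrow> G = F \<or> G = S)"
    using face_iso_mono[OF iso F] face_iso_eq[OF iso] F S by metis
  finally show ?thesis
    unfolding facets_iff_coatom[OF P(1)] facets_iff_coatom[OF P(2)] e
    using face_iso_face[OF iso F] F by simp
qed

lemma face_iso_facets:
  assumes iso: "face_iso \<phi> S T" and P: "polytope S" "polytope T"
  shows "bij_betw \<phi> (facets S) (facets T)"
proof -
  have "\<phi> ` facets S = facets T"
  proof (intro equalityI subsetI)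
    fix G assume G: "G \<in> facets T"
    then obtain F where "F face_of S" "\<phi> F = G" using face_iso_surj[OF iso] by (auto simp: facets_def)
    then show "G \<in> \<phi> ` facets S" using face_iso_facet[OF iso P] G by blast
  next
    fix G assume "G \<in> \<phi> ` facets S"
    then show "G \<in> facets T" using face_iso_facet[OF iso P] by (auto simp: facets_def)
  qed
  moreover have "inj_on \<phi> (facets S)"
    using face_iso_eq[OF iso] by (auto simp: inj_on_def facets_def)
  ultimately show ?thesis by (simp add: bij_betw_def)
qed

lemma polytope_pdim_0:
  assumes "polytope S" "S \<noteq> {}" "pdim S = 0" shows "\<exists>a. S = {a}"
proof -
  obtain v where v: "v extreme_point_of S" using polytope_extreme_point_exists[OF assms(1,2)] .
  show ?thesis
    using pdim_face_less[OF assms(1) extreme_point_imp_face[OF v]] assms(3) by auto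
qed

lemma polytope_facet_exists:
  assumes "polytope S" "pdim S \<noteq> 0" shows "facets S \<noteq> {}"
proof (cases "S = {}")
  case True
  have "pdim ({} :: 'a set) = 0" using real_vector.dim_le_card[of "{}" "{}"] by (simp add: pdim_def)
  then show ?thesis using assms True by simp
next
  case False
  then obtain v where v: "v extreme_point_of S" using polytope_extreme_point_exists[OF assms(1)] by blast
  have "S \<noteq> {v}" using assms by (auto simp: pdim_sing)
  then obtain x where "x \<in> S" "x \<noteq> v" using False by blast
  then show ?thesis
    using facet_avoiding_point[OF assms(1) extreme_point_imp_face[OF v], of x] by blast
qed

text \<open>Induction on the dimension: a facet and its image have equal dimension by restriction of
  the isomorphism. In the base case \<open>S\<close> is a point, whose only nonempty face is
  itself.\<close>

lemma face_iso_pdim: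
  assumes "face_iso \<phi> S T" "polytope S" "polytope T" "S \<noteq> {}" "T \<noteq> {}"
  shows "pdim S = pdim T"
  using assms
proof (induction "pdim S" arbitrary: S T)
  case 0
  then obtain a where a: "S = {a}" using polytope_pdim_0 by metis
  obtain v where v: "v extreme_point_of T" using polytope_extreme_point_exists 0 by metis
  obtain F where F: "F face_of S" "\<phi> F = {v}"
    using face_iso_surj[OF 0(2) extreme_point_imp_face[OF v]] by blast
  have "F = S"
    using F(2) a face_iso_empty[OF 0(2)] face_of_imp_subset[OF F(1)] by (cases "F = {}") auto
  then have "T = {v}"
    using face_iso_top[OF 0(2) polytope_imp_convex[OF 0(3)] polytope_imp_convex[OF 0(4)]] F by simp
  then show ?case using 0(1) by (simp add: pdim_sing)
next
  case (Suc n)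
  then obtain F where F: "F \<in> facets S" using polytope_facet_exists[of S] by force
  then have G: "\<phi> F \<in> facets T" using face_iso_facets[OF Suc.prems(1,2,3)] by (auto simp: bij_betw_def)
  have FS: "F face_of S" "F \<noteq> {}" "pdim F + 1 = pdim S" using F by (auto simp: facets_def)
  have GT: "\<phi> F face_of T" "\<phi> F \<noteq> {}" "pdim (\<phi> F) + 1 = pdim T" using G by (auto simp: facets_def)
  have "pdim F = pdim (\<phi> F)"
    using Suc.hyps FS GT face_iso_restrict[OF Suc.prems(1) FS(1)] polytope_face Suc.prems(2,3)
    by (metis Suc_eq_plus1 Suc_inject)
  then show ?case using FS GT by simp
qed

section \<open>The ring of simple polytopes and its derivation\<close>

lemma same_type_refl: "simple_polytope S \<Longrightarrow> same_type S S"
  by (simp add: same_type_def comb_equiv_refl)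

lemma type_of_eqI:
  "simple_polytope S \<Longrightarrow> simple_polytope T \<Longrightarrow> comb_equiv S T \<Longrightarrow> type_of S = type_of T"
  using Quotient3_rel[OF Quotient3_comb_type, of S T] by (simp add: same_type_def comb_equiv_refl)

lemma simple_polytope_rep_type: "simple_polytope (rep_type c)"
  using Quotient3_rep_reflp[OF Quotient3_comb_type, of c] by (simp add: same_type_def)

lemma type_of_rep_type: "type_of (rep_type c) = c"
  by (rule Quotient3_abs_rep[OF Quotient3_comb_type])

lemma comb_equiv_rep_type_of:
  assumes "simple_polytope S" shows "comb_equiv S (rep_type (type_of S))"
  using Quotient3_rep_abs[OF Quotient3_comb_type same_type_refl[OF assms]]
  by (simp add: same_type_def comb_equiv_sym)

lemma type_of_pprod:
  "simple_polytope S \<Longrightarrow> simple_polytope T \<Longrightarrow> type_of (pprod S T) = type_of S + type_of T"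
  by (simp add: plus_comb_type.abs_eq same_type_refl)

lemma type_of_Times:
  assumes "simple_polytope U" "simple_polytope S" "simple_polytope T" "comb_equiv U (S \<times> T)"
  shows "type_of U = type_of S + type_of T"
  using assms type_of_eqI[of U "pprod S T"]
  by (simp add: type_of_pprod simple_polytope_pprod comb_equiv_trans[OF _ comb_equiv_sym[OF comb_equiv_pprod]])

lemma simple_polytopeD: "simple_polytope S \<Longrightarrow> polytope S" "simple_polytope S \<Longrightarrow> S \<noteq> {}"
  by (auto simp: simple_polytope_def)

lemma type_dim_type_of:
  assumes "simple_polytope S" shows "type_dim (type_of S) = pdim S"
proof -
  obtain \<phi> where "face_iso \<phi> S (rep_type (type_of S))"
    using comb_equiv_rep_type_of[OF assms] by (auto simp: comb_equiv_iff_face_iso)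
  then show ?thesis
    unfolding type_dim_def
    using face_iso_pdim simple_polytopeD[OF assms] simple_polytopeD[OF simple_polytope_rep_type] by metis
qed

text \<open>Independence of the representative: the isomorphism with \<open>rep_type\<close> matches
  the facets, and each facet is equivalent to its image. Simplicity of both allows their types to be
  compared.\<close>

lemma facet_sum_type_of:
  assumes S: "simple_polytope S"
  shows "facet_sum (type_of S) = (\<Sum>F\<in>facets S. class_of (type_of F))"
proof -
  let ?T = "rep_type (type_of S)"
  obtain \<phi> where iso: "face_iso \<phi> S ?T"
    using comb_equiv_rep_type_of[OF S] by (auto simp: comb_equiv_iff_face_iso)
  note T = simple_polytope_rep_type[of "type_of S"]
  note bij = face_iso_facets[OF iso simple_polytopeD(1)[OF S] simple_polytopeD(1)[OF T]]
  have "facet_sum (type_of S) = (\<Sum>F\<in>facets S. class_of (type_of (\<phi> F)))"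
    unfolding facet_sum_def by (rule sum.reindex_bij_betw[OF bij, symmetric])
  also have "\<dots> = (\<Sum>F\<in>facets S. class_of (type_of F))"
  proof (rule sum.cong[OF refl])
    fix F assume F: "F \<in> facets S"
    then have "\<phi> F \<in> facets ?T" using bij by (auto simp: bij_betw_def)
    moreover have "comb_equiv F (\<phi> F)"
      using face_iso_restrict[OF iso, of F] F by (auto simp: comb_equiv_iff_face_iso facets_def)
    ultimately show "class_of (type_of (\<phi> F)) = class_of (type_of F)"
      using type_of_eqI simple_polytope_facet S T F by metis
  qed
  finally show ?thesis .
qed

lemma class_of_add: "class_of (a + b) = class_of a * class_of b"
  by (simp add: class_of_def mult_single)

lemma scalar_add: "scalar (r + s) = scalar r + scalar s"
  by (simp add: scalar_def single_add)

lemma scalar_mult: "scalar (r * s) = scalar r * scalar s"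
  by (simp add: scalar_def mult_single)

lemma scalar_0 [simp]: "scalar 0 = 0" and scalar_1 [simp]: "scalar 1 = 1"
  by (simp_all add: scalar_def)

lemma scalar_of_nat: "scalar (of_nat n) = of_nat n"
  by (induction n) (simp_all add: scalar_add)

lemma scalar_fact_Suc: "scalar (1 / fact (Suc k)) * of_nat (Suc k) = scalar (1 / fact k)"
proof -
  have "1 / fact (Suc k) * of_nat (Suc k) = (1 / fact k :: rat)"
    by (simp del: of_nat_Suc)
  then show ?thesis unfolding scalar_of_nat[symmetric] scalar_mult[symmetric] by (rule arg_cong)
qed

text \<open>The Leibniz rule on generators: a facet of a product is a facet of one factor times the
  other factor. The injective linear map \<open>interleave\<close> carries this from
  \<open>A \<times> B\<close> to \<open>pprod A B\<close>.\<close>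

lemma facet_sum_add: "facet_sum (a + b) = facet_sum a * class_of b + class_of a * facet_sum b"
proof -
  define A B where "A = rep_type a" and "B = rep_type b"
  have sA: "simple_polytope A" and sB: "simple_polytope B"
    by (simp_all add: A_def B_def simple_polytope_rep_type)
  have a: "a = type_of A" and b: "b = type_of B" by (simp_all add: A_def B_def type_of_rep_type)
  note pA = simple_polytopeD[OF sA] and pB = simple_polytopeD[OF sB]
  let ?h = "image (case_prod interleave)"
  have inj: "inj ?h" by (rule injI) (simp add: inj_image_eq_iff[OF inj_interleave])
  have disj: "(\<lambda>F. F \<times> B) ` facets A \<inter> (\<lambda>G. A \<times> G) ` facets B = {}"
    using pA pB by (auto simp: times_eq_iff facets_def)
  have iA: "inj_on (\<lambda>F. F \<times> B) (facets A)" and iB: "inj_on (\<lambda>G. A \<times> G) (facets B)"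
    using pA pB by (auto simp: inj_on_def times_eq_iff)
  have "facet_sum (a + b) = (\<Sum>F\<in>facets (pprod A B). class_of (type_of F))"
    unfolding a b type_of_pprod[OF sA sB, symmetric]
    by (rule facet_sum_type_of[OF simple_polytope_pprod[OF sA sB]])
  also have "facets (pprod A B) = ?h ` facets (A \<times> B)"
    unfolding pprod_def by (rule facets_linear_image[OF linear_interleave inj_interleave])
  also have "(\<Sum>F\<in>?h ` facets (A \<times> B). class_of (type_of F)) =
      (\<Sum>F\<in>facets (A \<times> B). class_of (type_of (?h F)))"
    using inj by (subst sum.reindex) (auto intro: inj_on_subset)
  also have "facets (A \<times> B) = (\<lambda>F. F \<times> B) ` facets A \<union> (\<lambda>G. A \<times> G) ` facets B"
    by (rule facets_Times[OF pA pB])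
  also have "(\<Sum>F\<in>(\<lambda>F. F \<times> B) ` facets A \<union> (\<lambda>G. A \<times> G) ` facets B. class_of (type_of (?h F))) =
      (\<Sum>F\<in>facets A. class_of (type_of (pprod F B))) + (\<Sum>G\<in>facets B. class_of (type_of (pprod A G)))"
    using disj iA iB finite_facets pA pB
    by (subst sum.union_disjoint) (auto simp: sum.reindex pprod_def)
  also have "(\<Sum>F\<in>facets A. class_of (type_of (pprod F B))) = facet_sum a * class_of b"
    unfolding a facet_sum_type_of[OF sA] sum_distrib_right b
    using simple_polytope_facet[OF sA] sB by (intro sum.cong) (auto simp: type_of_pprod class_of_add)
  also have "(\<Sum>G\<in>facets B. class_of (type_of (pprod A G))) = class_of a * facet_sum b"
    unfolding b facet_sum_type_of[OF sB] sum_distrib_left a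
    using simple_polytope_facet[OF sB] sA by (intro sum.cong) (auto simp: type_of_pprod class_of_add)
  finally show ?thesis .
qed

section \<open>Linear extension, the derivation and its exponential\<close>

lemma polytope_ring_induct [case_names zero basis scale add]:
  fixes a :: polytope_ring
  assumes "P 0" "\<And>c. P (class_of c)" "\<And>r a. P a \<Longrightarrow> P (scalar r * a)"
    "\<And>a b. P a \<Longrightarrow> P b \<Longrightarrow> P (a + b)"
  shows "P a"
proof (induction a rule: update_induct)
  case const
  show ?case by (rule assms(1))
next
  case (update f c r)
  have "Poly_Mapping.update c r f = f + scalar r * class_of c"
    using update(1)
    by (intro poly_mapping_eqI)
      (auto simp: lookup_update lookup_add scalar_def class_of_def mult_single lookup_single
        in_keys_iff when_def)
  then show ?case using assms update by metis
qed

text \<open>Both \<open>bd\<close> and \<open>Q\<close> are linear extensions of a function on combinatorial types.\<close>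

lemma linear_extension:
  fixes s :: "rat \<Rightarrow> 'r::comm_ring_1" and f :: "comb_type \<Rightarrow> 'r"
  assumes s: "s 0 = 0" "s 1 = 1" "\<And>r t. s (r + t) = s r + s t" "\<And>r t. s (r * t) = s r * s t"
  defines "L \<equiv> \<lambda>a::polytope_ring. \<Sum>c\<in>Poly_Mapping.keys a. s (Poly_Mapping.lookup a c) * f c"
  shows linear_extension_add: "L (a + b) = L a + L b"
    and linear_extension_class: "L (class_of c) = f c"
    and linear_extension_scale: "L (scalar r * a) = s r * L a"
proof -
  show add: "L (a + b) = L a + L b" for a b
    unfolding L_def
    by (rule setsum_keys_plus_distrib[of "\<lambda>c r. s r * f c"]) (simp_all add: s distrib_right)
  have single: "L (Poly_Mapping.single c t) = s t * f c" for c t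
    by (cases "t = 0") (simp_all add: L_def s)
  then show "L (class_of c) = f c" by (simp add: class_of_def s)
  have "L (scalar r * a) = s r * L a" for a
  proof (induction a rule: update_induct)
    case const
    then show ?case by (simp add: L_def)
  next
    case (update g c t)
    have "Poly_Mapping.update c t g = g + Poly_Mapping.single c t"
      using update(1)
      by (intro poly_mapping_eqI)
        (auto simp: lookup_update lookup_add lookup_single in_keys_iff when_def)
    moreover have "scalar r * Poly_Mapping.single c t = Poly_Mapping.single c (r * t)"
      by (simp add: scalar_def mult_single)
    ultimately show ?case using update(3) by (simp add: distrib_left add single s mult.assoc)
  qed
  then show "L (scalar r * a) = s r * L a" .
qed

lemmas scalar_hom = scalar_0 scalar_1 scalar_add scalar_mult

lemma bd_add: "bd (a + b) = bd a + bd b"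
  and bd_class: "bd (class_of c) = facet_sum c"
  and bd_scale: "bd (scalar r * a) = scalar r * bd a"
  unfolding bd_def
  by (rule linear_extension_add[of scalar] linear_extension_class[of scalar]
      linear_extension_scale[of scalar]; rule scalar_hom)+

lemma bd_0 [simp]: "bd 0 = 0" by (simp add: bd_def)

lemma bd_mult: "bd (a * b) = bd a * b + a * bd b"
proof (induction a rule: polytope_ring_induct)
  case (basis c)
  show ?case
  proof (induction b rule: polytope_ring_induct)
    case (basis c')
    show ?case by (simp add: class_of_add[symmetric] bd_class facet_sum_add)
  next
    case (scale r b)
    have "class_of c * (scalar r * b) = scalar r * (class_of c * b)" by (simp add: mult.left_commute)
    then show ?case using scale by (simp only: bd_scale) (simp add: algebra_simps)
  qed (simp_all add: bd_add algebra_simps)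
next
  case (scale r a)
  then show ?case by (simp add: bd_scale mult.assoc distrib_left)
qed (simp_all add: bd_add algebra_simps)

lemma bd_funpow_add: "(bd ^^ k) (a + b) = (bd ^^ k) a + (bd ^^ k) b"
  by (induction k) (simp_all add: bd_add)

lemma bd_funpow_scale: "(bd ^^ k) (scalar r * a) = scalar r * (bd ^^ k) a"
  by (induction k) (simp_all add: bd_scale)

lemma bd_funpow_0 [simp]: "(bd ^^ k) 0 = 0"
  by (induction k) simp_all

lemma bd_funpow_sum: "(bd ^^ k) (sum f I) = (\<Sum>i\<in>I. (bd ^^ k) (f i))"
  by (induction I rule: infinite_finite_induct) (simp_all add: bd_funpow_add)

lemma bd_funpow_class_eq_0: "type_dim c < k \<Longrightarrow> (bd ^^ k) (class_of c) = 0"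
proof (induction k arbitrary: c)
  case (Suc k)
  define S where "S = rep_type c"
  have S: "simple_polytope S" "c = type_of S"
    by (simp_all add: S_def simple_polytope_rep_type type_of_rep_type)
  have "(bd ^^ k) (class_of (type_of F)) = 0" if F: "F \<in> facets S" for F
  proof -
    have "pdim F + 1 = pdim S" using F by (simp add: facets_def)
    then show ?thesis
      using Suc.prems Suc.IH[of "type_of F"] simple_polytope_facet[OF S(1) F] S
      by (simp add: type_dim_type_of)
  qed
  then show ?case
    by (simp add: funpow_Suc_right bd_class S(2) facet_sum_type_of[OF S(1)] bd_funpow_sum
        del: funpow.simps)
qed simp

text \<open>\<open>Q\<close> is \<open>exp(q d)\<close>: the truncation at the dimension only drops zero terms.\<close>

lemma Q_nth: "fps_nth (Q a) k = scalar (1 / fact k) * (bd ^^ k) a"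
proof -
  have hom: "fps_const (scalar 0) = 0" "fps_const (scalar 1) = 1"
    "fps_const (scalar (r + t)) = fps_const (scalar r) + fps_const (scalar t)"
    "fps_const (scalar (r * t)) = fps_const (scalar r) * fps_const (scalar t)" for r t
    by (simp_all add: scalar_add scalar_mult)
  show ?thesis
  proof (induction a rule: polytope_ring_induct)
    case zero
    then show ?case by (simp add: Q_def)
  next
    case (basis c)
    have "Q (class_of c) = Q_type c" unfolding Q_def by (rule linear_extension_class[of "\<lambda>r. fps_const (scalar r)", OF hom])
    moreover have "fps_nth (Q_type c) k =
        (if k \<le> type_dim c then scalar (1 / fact k) * (bd ^^ k) (class_of c) else 0)"
      by (simp add: Q_type_def fps_sum_nth if_distrib[of "(*) _"] cong: if_cong)
    ultimately show ?case using bd_funpow_class_eq_0[of c k] by (simp add: not_le)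
  next
    case (scale r a)
    have "Q (scalar r * a) = fps_const (scalar r) * Q a"
      unfolding Q_def by (rule linear_extension_scale[of "\<lambda>r. fps_const (scalar r)", OF hom])
    then show ?case using scale by (simp add: bd_funpow_scale mult.left_commute)
  next
    case (add a b)
    have "Q (a + b) = Q a + Q b" unfolding Q_def by (rule linear_extension_add[of "\<lambda>r. fps_const (scalar r)", OF hom])
    then show ?case using add by (simp add: bd_funpow_add distrib_left)
  qed
qed

lemma Q_nth_0 [simp]: "fps_nth (Q a) 0 = a" by (simp add: Q_nth)

lemma Q_add: "Q (a + b) = Q a + Q b"
  by (rule fps_ext) (simp add: Q_nth bd_funpow_add distrib_left)

lemma Q_0 [simp]: "Q 0 = 0"
  by (rule fps_ext) (simp add: Q_nth)

lemma Q_sum: "Q (sum f I) = (\<Sum>i\<in>I. Q (f i))"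
  by (induction I rule: infinite_finite_induct) (simp_all add: Q_add)

text \<open>Differentiation determines a coefficient only up to the factor n + 1, which rational
  scalars make invertible.\<close>

lemma of_nat_Suc_cancel:
  fixes a b :: polytope_ring
  assumes "of_nat (Suc n) * a = of_nat (Suc n) * b" shows "a = b"
proof -
  have "scalar (1 / of_nat (Suc n)) * of_nat (Suc n) = 1"
    unfolding scalar_of_nat[symmetric] scalar_mult[symmetric] by (simp del: of_nat_Suc)
  then show ?thesis using arg_cong[OF assms, of "\<lambda>z. scalar (1 / of_nat (Suc n)) * z"]
    by (simp add: mult.assoc[symmetric] del: of_nat_Suc)
qed

text \<open>Termwise differentiation of exp(q d), with k + 1 cancelled against the factorial. It
  replaces the derivative in q by \<open>bd\<close>.\<close>

lemma fps_deriv_Q: "fps_deriv (Q a) = Q (bd a)"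
proof (rule fps_ext)
  fix k
  have "scalar (1 / fact k) = of_nat (Suc k) * scalar (1 / fact (Suc k))"
    using scalar_fact_Suc[of k] by (simp add: mult.commute)
  then show "fps_nth (fps_deriv (Q a)) k = fps_nth (Q (bd a)) k"
    by (simp add: Q_nth funpow_Suc_right mult.assoc del: funpow.simps of_nat_Suc)
qed

text \<open>Both sides agree at q = 0, and the q-derivative of each follows the Leibniz rule in
  \<open>bd a\<close> and \<open>bd b\<close>. So coefficient n + 1 reduces to coefficient n at
  other arguments, and no binomial formula for iterates of \<open>bd\<close> is required.\<close>

lemma Q_mult: "Q (a * b) = Q a * Q b"
proof (rule fps_ext)
  fix n
  show "fps_nth (Q (a * b)) n = fps_nth (Q a * Q b) n"
  proof (induction n arbitrary: a b)
    case (Suc n)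
    have "fps_nth (fps_deriv (Q (a * b))) n = fps_nth (fps_deriv (Q a * Q b)) n"
      unfolding fps_deriv_mult fps_deriv_Q bd_mult Q_add fps_add_nth by (simp add: Suc add.commute)
    then have "of_nat (Suc n) * fps_nth (Q (a * b)) (Suc n) = of_nat (Suc n) * fps_nth (Q a * Q b) (Suc n)"
      by (simp only: fps_deriv_nth Suc_eq_plus1)
    then show ?case by (rule of_nat_Suc_cancel)
  qed simp
qed

section \<open>Two-parameter extensions\<close>

definition bd_series :: "polytope_ring fps \<Rightarrow> polytope_ring fps" where
  "bd_series f = Abs_fps (\<lambda>m. bd (fps_nth f m))"

lemma two_param_add: "two_param (f + g) = two_param f + two_param g"
  by (rule fps_ext) (simp add: two_param_def Q_add)

lemma two_param_mult: "two_param (f * g) = two_param f * two_param g"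
  by (rule fps_ext) (simp add: two_param_def fps_mult_nth Q_sum Q_mult)

lemma Q_1 [simp]: "Q 1 = 1"
proof -
  have bd1: "bd 1 = 0" using bd_mult[of 1 1] by simp
  have "(bd ^^ k) 1 = (if k = 0 then 1 else 0)" for k
    by (cases k) (simp_all add: funpow_Suc_right bd1 del: funpow.simps)
  then show ?thesis by (intro fps_ext) (simp add: Q_nth)
qed

lemma two_param_1 [simp]: "two_param 1 = 1"
  by (rule fps_ext) (simp add: two_param_def)

lemma two_param_X [simp]: "two_param fps_X = fps_X"
  by (rule fps_ext) (simp add: two_param_def fps_X_def)

lemma two_param_deriv: "two_param (fps_deriv f) = fps_deriv (two_param f)"
proof (rule fps_ext)
  fix n
  have "Q (of_nat k * a) = of_nat k * Q a" for k a
    by (induction k) (simp_all add: Q_add distrib_right)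
  from this[of "Suc n"] show "fps_nth (two_param (fps_deriv f)) n = fps_nth (fps_deriv (two_param f)) n"
    by (simp add: two_param_def del: of_nat_Suc)
qed

text \<open>This removes q from the problem: since \<open>two_param\<close> respects sums, products,
  x and the derivative in x, each equation follows from one between one-parameter series with
  \<open>bd_series\<close> on the left.\<close>

lemma deriv_q_two_param: "deriv_q (two_param f) = two_param (bd_series f)"
  by (rule fps_ext) (simp add: deriv_q_def two_param_def bd_series_def fps_deriv_Q)

lemma at_q0_two_param: "at_q0 (two_param f) = f"
  by (rule fps_ext) (simp add: at_q0_def two_param_def)

section \<open>Exponential generating functions and sums over subsets\<close>

definition egf :: "(nat \<Rightarrow> polytope_ring) \<Rightarrow> polytope_ring fps" where
  "egf a = Abs_fps (\<lambda>n. scalar (1 / fact n) * a n)"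

lemma egf_add: "egf a + egf b = egf (\<lambda>n. a n + b n)"
  by (rule fps_ext) (simp add: egf_def distrib_left)

lemma egf_mult: "egf a * egf b = egf (\<lambda>n. \<Sum>k\<le>n. of_nat (n choose k) * (a k * b (n - k)))"
proof (rule fps_ext)
  fix n
  have "scalar (1 / fact k) * scalar (1 / fact (n - k)) = scalar (1 / fact n) * of_nat (n choose k)"
    if "k \<le> n" for k
    unfolding scalar_of_nat[symmetric] scalar_mult[symmetric]
    using that by (simp add: binomial_fact)
  then have "scalar (1 / fact k) * a k * (scalar (1 / fact (n - k)) * b (n - k)) =
      scalar (1 / fact n) * (of_nat (n choose k) * (a k * b (n - k)))" if "k \<le> n" for k
    using that by (metis (no_types, opaque_lifting) mult.assoc mult.commute)
  then show "fps_nth (egf a * egf b) n =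
      fps_nth (egf (\<lambda>n. \<Sum>k\<le>n. of_nat (n choose k) * (a k * b (n - k)))) n"
    unfolding egf_def fps_mult_nth fps_nth_Abs_fps sum_distrib_left atLeast0AtMost
    by (intro sum.cong refl) simp
qed

lemma egf_deriv: "fps_deriv (egf a) = egf (\<lambda>n. a (Suc n))"
proof (rule fps_ext)
  fix n
  have "of_nat (Suc n) * scalar (1 / fact (Suc n)) = scalar (1 / fact n)"
    using scalar_fact_Suc[of n] by (simp add: mult.commute)
  then show "fps_nth (fps_deriv (egf a)) n = fps_nth (egf (\<lambda>n. a (Suc n))) n"
    by (simp add: egf_def mult.assoc[symmetric] del: of_nat_Suc)
qed

text \<open>Multiplication by x singles out one label. At n = 0 the truncated index
  \<open>n - 1\<close> is harmless because of the factor \<open>of_nat n\<close>.\<close>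

lemma egf_X: "fps_X * egf a = egf (\<lambda>n. of_nat n * a (n - 1))"
proof (rule fps_ext)
  fix n
  show "fps_nth (fps_X * egf a) n = fps_nth (egf (\<lambda>n. of_nat n * a (n - 1))) n"
  proof (cases n)
    case (Suc k)
    show ?thesis
      using scalar_fact_Suc[of k] by (simp add: egf_def Suc mult.assoc[symmetric] del: of_nat_Suc)
  qed (simp add: egf_def)
qed

lemma bd_series_egf: "bd_series (egf a) = egf (\<lambda>n. bd (a n))"
  by (rule fps_ext) (simp add: egf_def bd_series_def bd_scale)

lemma bd_series_X_power: "bd_series (fps_X ^ k * f) = fps_X ^ k * bd_series f"
  by (rule fps_ext) (simp add: bd_series_def fps_X_power_mult_nth)

lemma sum_Pow_card:
  fixes f :: "nat \<Rightarrow> 'a::comm_semiring_1"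
  assumes "finite W"
  shows "(\<Sum>S\<in>Pow W. f (card S)) = (\<Sum>k\<le>card W. of_nat (card W choose k) * f k)"
proof -
  have "(\<Sum>S\<in>Pow W. f (card S)) = (\<Sum>k\<le>card W. \<Sum>S\<in>{S \<in> Pow W. card S = k}. f (card S))"
    using assms by (intro sum.group[symmetric]) (auto simp: card_mono)
  also have "\<dots> = (\<Sum>k\<le>card W. of_nat (card {S. S \<subseteq> W \<and> card S = k}) * f k)"
    by (intro sum.cong) auto
  finally show ?thesis using assms by (simp add: n_subsets)
qed

text \<open>The form in which facet counts arrive: each \<open>S\<close> splits the unmarked labels,
  and the summand depends only on the sizes of the two parts, which produces the binomial
  coefficient.\<close>

lemma egf_mult_subsets:
  assumes "\<And>n. finite (W n)" "\<And>n. card (W n) = n"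
  shows "egf a * egf b = egf (\<lambda>n. \<Sum>S\<in>Pow (W n). a (card S) * b (card (W n - S)))"
proof -
  have "(\<Sum>S\<in>Pow (W n). a (card S) * b (card (W n - S))) =
      (\<Sum>k\<le>n. of_nat (n choose k) * (a k * b (n - k)))" for n
  proof -
    have "card (W n - S) = n - card S" if "S \<in> Pow (W n)" for S
      using that assms by (simp add: card_Diff_subset finite_subset[OF _ assms(1)])
    then have "(\<Sum>S\<in>Pow (W n). a (card S) * b (card (W n - S))) =
        (\<Sum>S\<in>Pow (W n). a (card S) * b (n - card S))"
      by (intro sum.cong refl) simp
    then show ?thesis
      using sum_Pow_card[OF assms(1)[of n], of "\<lambda>k. a k * b (n - k)"] assms(2)[of n] by simp
  qed
  then show ?thesis by (simp add: egf_mult)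
qed

section \<open>Minkowski sums up to combinatorial equivalence\<close>

text \<open>For \<open>E\<close> inside \<open>C\<close> this says that \<open>E\<close> is a union
  of fibres of the restriction of \<open>s\<close> to \<open>C\<close>.\<close>

definition saturated :: "('a \<Rightarrow> 'b) \<Rightarrow> 'a set \<Rightarrow> 'a set \<Rightarrow> bool" where
  "saturated s C E \<longleftrightarrow> (\<forall>x\<in>C. \<forall>y\<in>E. s x = s y \<longrightarrow> x \<in> E)"

lemma saturatedD: "saturated s C E \<Longrightarrow> x \<in> C \<Longrightarrow> y \<in> E \<Longrightarrow> s x = s y \<Longrightarrow> x \<in> E"
  unfolding saturated_def by blast

lemma face_of_vimage:
  assumes s: "linear s" and C: "convex C" and F: "F face_of s ` C"
  shows "C \<inter> s -` F face_of C" "saturated s C (C \<inter> s -` F)" "s ` (C \<inter> s -` F) = F"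
proof -
  have comb: "s ((1 - t) *\<^sub>R a + t *\<^sub>R b) = (1 - t) *\<^sub>R s a + t *\<^sub>R s b" for a b t
    by (simp add: linear_add[OF s] linear_scale[OF s])
  show "C \<inter> s -` F face_of C"
    unfolding face_of_def
  proof (intro conjI ballI impI)
    show "convex (C \<inter> s -` F)"
      using C convex_linear_vimage[OF s face_of_imp_convex[OF F]] by (rule convex_Int)
    fix a b x assume h: "a \<in> C" "b \<in> C" "x \<in> C \<inter> s -` F" "x \<in> open_segment a b"
    obtain t where t: "0 < t" "t < 1" "x = (1 - t) *\<^sub>R a + t *\<^sub>R b" using h by (auto simp: in_segment)
    have m: "(1 - t) *\<^sub>R s a + t *\<^sub>R s b \<in> F" using h t comb by auto
    have m': "(1 - (1 - t)) *\<^sub>R s b + (1 - t) *\<^sub>R s a \<in> F" using m by (simp add: add.commute)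
    show "b \<in> C \<inter> s -` F" using face_of_endpoint[OF F _ _ _ _ m] t h by auto
    show "a \<in> C \<inter> s -` F" using face_of_endpoint[OF F _ _ _ _ m'] t h by auto
  qed auto
  show "saturated s C (C \<inter> s -` F)" by (auto simp: saturated_def)
  show "s ` (C \<inter> s -` F) = F" using face_of_imp_subset[OF F] by auto
qed

lemma face_of_image_saturated:
  assumes s: "linear s" and C: "convex C" and E: "E face_of C" "saturated s C E"
  shows "s ` E face_of s ` C" "C \<inter> s -` (s ` E) = E"
proof -
  have EC: "E \<subseteq> C" using face_of_imp_subset[OF E(1)] .
  show "C \<inter> s -` (s ` E) = E" using E(2) EC by (auto simp: saturated_def)
  have end_mem: "b \<in> E"
    if h: "a \<in> C" "b \<in> C" "0 < t" "t < 1" "(1 - t) *\<^sub>R s a + t *\<^sub>R s b \<in> s ` E" for a b t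
  proof -
    have "s ((1 - t) *\<^sub>R a + t *\<^sub>R b) \<in> s ` E"
      using h by (simp add: linear_add[OF s] linear_scale[OF s])
    moreover have "(1 - t) *\<^sub>R a + t *\<^sub>R b \<in> C" using h by (intro convexD[OF C]) auto
    ultimately have "(1 - t) *\<^sub>R a + t *\<^sub>R b \<in> E" using E(2) by (auto simp: saturated_def)
    then show ?thesis using face_of_endpoint[OF E(1)] h by (meson less_imp_le)
  qed
  show "s ` E face_of s ` C"
    unfolding face_of_def
  proof (intro conjI ballI impI)
    show "s ` E \<subseteq> s ` C" using EC by auto
    show "convex (s ` E)" using convex_linear_image[OF s face_of_imp_convex[OF E(1)]] .
    fix a' b' x assume h: "a' \<in> s ` C" "b' \<in> s ` C" "x \<in> s ` E" "x \<in> open_segment a' b'"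
    obtain t where t: "0 < t" "t < 1" "x = (1 - t) *\<^sub>R a' + t *\<^sub>R b'" using h by (auto simp: in_segment)
    obtain a b where ab: "a \<in> C" "b \<in> C" "a' = s a" "b' = s b" using h by auto
    show "b' \<in> s ` E" using end_mem[of a b t] t ab h by auto
    show "a' \<in> s ` E" using end_mem[of b a "1 - t"] t ab h by (auto simp: add.commute)
  qed
qed

text \<open>The faces of a linear image \<open>s ` C\<close> are the images of the \<open>s\<close>-saturated faces of \<open>C\<close>.\<close>

lemma comb_equiv_images:
  assumes s: "linear s" and t: "linear t" and C: "convex C"
    and eq: "\<And>E. E face_of C \<Longrightarrow> saturated s C E \<longleftrightarrow> saturated t C E"
  shows "comb_equiv (s ` C) (t ` C)"
proof -
  define \<phi> where "\<phi> F = t ` (C \<inter> s -` F)" for F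
  define \<psi> where "\<psi> G = s ` (C \<inter> t -` G)" for G
  have 1: "\<phi> F face_of t ` C" "\<psi> (\<phi> F) = F" if F: "F face_of s ` C" for F
    using face_of_vimage[OF s C F] face_of_image_saturated[OF t C, of "C \<inter> s -` F"] eq
    by (auto simp: \<phi>_def \<psi>_def)
  have 2: "\<psi> G face_of s ` C" "\<phi> (\<psi> G) = G" if G: "G face_of t ` C" for G
    using face_of_vimage[OF t C G] face_of_image_saturated[OF s C, of "C \<inter> t -` G"] eq
    by (auto simp: \<phi>_def \<psi>_def)
  have mono: "\<phi> F \<subseteq> \<phi> F'" if "F \<subseteq> F'" for F F' using that by (auto simp: \<phi>_def)
  have mono': "\<psi> F \<subseteq> \<psi> F'" if "F \<subseteq> F'" for F F' using that by (auto simp: \<psi>_def)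
  have "bij_betw \<phi> {F. F face_of s ` C} {G. G face_of t ` C}"
    using 1 2 by (intro bij_betwI[where g = \<psi>]) auto
  moreover have "F \<subseteq> F' \<longleftrightarrow> \<phi> F \<subseteq> \<phi> F'" if "F face_of s ` C" "F' face_of s ` C" for F F'
    using mono mono' 1(2) that by metis
  ultimately show ?thesis unfolding comb_equiv_def by blast
qed

text \<open>If \<open>s\<close> is injective on \<open>C\<close>, every face is saturated for
  \<open>s\<close> as it is for the identity. The maps to which this is applied are not injective on
  the whole space.\<close>

lemma comb_equiv_linear_image_inj_on:
  assumes "linear s" "inj_on s C" "convex C"
  shows "comb_equiv C (s ` C)"
proof -
  have "saturated id C E" "saturated s C E" if "E face_of C" for E
    using assms(2) face_of_imp_subset[OF that] by (auto simp: saturated_def inj_on_def)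
  then show ?thesis using comb_equiv_images[OF linear_id assms(1,3)] by simp
qed

text \<open>Both sums are linear images of \<open>P \<times> K\<close>, by p + k and by p + 2k.
  Midpoints convert a coincidence under one map into a coincidence under the other, so the two maps
  have the same saturated faces.\<close>

lemma comb_equiv_add_same:
  fixes P K :: "'a::real_vector set"
  assumes P: "convex P" and K: "convex K"
  shows "comb_equiv (P + K + K) (P + K)"
proof -
  let ?C = "P \<times> K" and ?s = "\<lambda>(p, k). p + k" and ?t = "\<lambda>(p, k). p + k + k"
  have half: "(1 / 2) *\<^sub>R x + (1 / 2) *\<^sub>R x = (x :: 'a)" for x by (simp flip: scaleR_left_distrib)
  have double_mid: "((1 / 2) *\<^sub>R x + (1 / 2) *\<^sub>R y) + ((1 / 2) *\<^sub>R x + (1 / 2) *\<^sub>R y) = x + y" for x y :: 'a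
  proof -
    have "((1 / 2) *\<^sub>R x + (1 / 2) *\<^sub>R y) + ((1 / 2) *\<^sub>R x + (1 / 2) *\<^sub>R y) =
        ((1 / 2) *\<^sub>R x + (1 / 2) *\<^sub>R x) + ((1 / 2) *\<^sub>R y + (1 / 2) *\<^sub>R y)"
      by (simp only: ac_simps)
    then show ?thesis by (simp only: half)
  qed
  have lin: "linear ?s" "linear ?t" by (auto simp: linear_iff algebra_simps)
  have C: "convex ?C" using P K by (rule convex_Times)
  have "saturated ?t ?C E \<longleftrightarrow> saturated ?s ?C E" if E: "E face_of ?C" for E
  proof
    have EC: "E \<subseteq> ?C" using face_of_imp_subset[OF E] .
    assume t: "saturated ?t ?C E"
    show "saturated ?s ?C E"
      unfolding saturated_def
    proof (intro ballI impI; clarify)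
      fix p k g h assume h: "p \<in> P" "k \<in> K" "(g, h) \<in> E" "p + k = g + h"
      \<comment> \<open>With k' the midpoint of \<open>h\<close> and \<open>k\<close>, p + 2k' = p +
        k + h = g + 2h, so (p, k') is in \<open>E\<close> by \<open>t\<close>; being the midpoint of
        (p, h) and (p, k), it forces (p, k) into \<open>E\<close>.\<close>
      let ?k = "(1 / 2) *\<^sub>R h + (1 / 2) *\<^sub>R k"
      have "?k \<in> K" using h EC by (intro convexD[OF K]) auto
      moreover have "?k + ?k = h + k"
        by (rule double_mid)
      then have "p + ?k + ?k = g + h + h" using h(4) by (simp add: algebra_simps)
      ultimately have "(p, ?k) \<in> E" using saturatedD[OF t _ h(3), of "(p, ?k)"] h by simp
      moreover have "(p, ?k) = (1 - 1 / 2) *\<^sub>R (p, h) + (1 / 2 :: real) *\<^sub>R (p, k)" by (simp add: half)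
      ultimately show "(p, k) \<in> E"
        using face_of_endpoint[OF E, of "(p, h)" "(p, k)" "1 / 2"] h EC by auto
    qed
  next
    have EC: "E \<subseteq> ?C" using face_of_imp_subset[OF E] .
    assume s: "saturated ?s ?C E"
    show "saturated ?t ?C E"
      unfolding saturated_def
    proof (intro ballI impI; clarify)
      fix p k g h assume h: "p \<in> P" "k \<in> K" "(g, h) \<in> E" "p + k + k = g + h + h"
      \<comment> \<open>Halving the coincidence gives p/2 + k = g/2 + h, so the midpoint of
        \<open>g\<close> and \<open>p\<close>, added to \<open>k\<close>, gives g + h.\<close>
      let ?p = "(1 / 2) *\<^sub>R g + (1 / 2) *\<^sub>R p"
      have "?p \<in> P" using h EC by (intro convexD[OF P]) auto
      moreover have "(1 / 2) *\<^sub>R (p + k + k) = (1 / 2) *\<^sub>R (g + h + h)" using h(4) by simp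
      then have "(1 / 2) *\<^sub>R p + k = (1 / 2) *\<^sub>R g + h"
        by (simp add: scaleR_add_right add.assoc half)
      then have "(1 / 2) *\<^sub>R g + ((1 / 2) *\<^sub>R p + k) = (1 / 2) *\<^sub>R g + ((1 / 2) *\<^sub>R g + h)" by simp
      then have "?p + k = g + h" by (simp add: add.assoc[symmetric] half)
      ultimately have "(?p, k) \<in> E" using saturatedD[OF s _ h(3), of "(?p, k)"] h by simp
      moreover have "(?p, k) = (1 - 1 / 2) *\<^sub>R (g, k) + (1 / 2 :: real) *\<^sub>R (p, k)" by (simp add: half)
      ultimately show "(p, k) \<in> E"
        using face_of_endpoint[OF E, of "(g, k)" "(p, k)" "1 / 2"] h EC by auto
    qed
  qed
  then have "comb_equiv (?t ` ?C) (?s ` ?C)" by (rule comb_equiv_images[OF lin(2,1) C])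
  moreover have "?t ` ?C = P + K + K"
  proof (intro equalityI subsetI)
    fix x assume "x \<in> P + K + K"
    then obtain p k l where x: "p \<in> P" "k \<in> K" "l \<in> K" "x = p + k + l" by (auto elim!: set_plus_elim)
    \<comment> \<open>K + K = 2K by convexity, so p + 2k reaches all of P + K + K.\<close>
    let ?k = "(1 / 2) *\<^sub>R k + (1 / 2) *\<^sub>R l"
    have "?k \<in> K" using x by (intro convexD[OF K]) auto
    moreover have "?k + ?k = k + l"
      by (rule double_mid)
    then have "x = ?t (p, ?k)" using x by (simp add: add.assoc)
    ultimately show "x \<in> ?t ` ?C" using x by blast
  qed auto
  moreover have "?s ` ?C = P + K" by (simp add: set_plus_image)
  ultimately show ?thesis by simp
qed

lemma convex_set_sum:
  "finite I \<Longrightarrow> (\<And>i. i \<in> I \<Longrightarrow> convex (K i)) \<Longrightarrow> convex (\<Sum>i\<in>I. K i)"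
  by (induction I rule: finite_induct) (auto intro!: convex_set_plus)

lemma polytope_set_plus:
  assumes "polytope S" "polytope T" shows "polytope (S + T)"
proof -
  have "linear (\<lambda>(x :: 'a, y). x + y)" by (auto simp: linear_iff algebra_simps)
  then show ?thesis
    unfolding set_plus_image by (rule polytope_linear_image) (rule polytope_Times[OF assms])
qed

lemma polytope_set_sum:
  "finite I \<Longrightarrow> (\<And>i. i \<in> I \<Longrightarrow> polytope (K i)) \<Longrightarrow> polytope (\<Sum>i\<in>I. K i)"
proof (induction I rule: finite_induct)
  case empty
  show ?case by (simp add: polytope_sing)
qed (simp add: polytope_set_plus)

lemma set_sum_nonempty:
  "finite I \<Longrightarrow> (\<And>i. i \<in> I \<Longrightarrow> K i \<noteq> {}) \<Longrightarrow> (\<Sum>i\<in>I. K i) \<noteq> {}"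
proof (induction I rule: finite_induct)
  case empty
  show ?case by simp
next
  case (insert i I)
  then obtain a b where "a \<in> K i" "b \<in> (\<Sum>i\<in>I. K i)" by fastforce
  then show ?case using insert(1,2) by auto
qed

text \<open>Distinct members of a building set can become equal after contraction, so repeated summands occur.\<close>

lemma comb_equiv_sum_image:
  fixes K :: "'b \<Rightarrow> 'a::real_vector set"
  assumes "finite J" "\<And>U. convex (K U)"
  shows "comb_equiv (\<Sum>j\<in>J. K (g j)) (\<Sum>U\<in>g ` J. K U)"
proof -
  \<comment> \<open>Combinatorial equivalence is not in general preserved by adding a common
    summand; the arbitrary convex \<open>P\<close> absorbs the summands already treated
    instead.\<close>
  have "comb_equiv (P + (\<Sum>j\<in>J. K (g j))) (P + (\<Sum>U\<in>g ` J. K U))" if "convex P" for P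
    using assms(1) that
  proof (induction J arbitrary: P rule: finite_induct)
    case empty
    show ?case by (simp add: comb_equiv_refl)
  next
    case (insert j J)
    let ?R = "\<Sum>U\<in>g ` J. K U"
    have "comb_equiv ((P + K (g j)) + (\<Sum>j\<in>J. K (g j))) ((P + K (g j)) + ?R)"
      by (rule insert.IH[OF convex_set_plus[OF insert.prems assms(2)]])
    then have 1: "comb_equiv (P + (\<Sum>j\<in>insert j J. K (g j))) (P + (K (g j) + ?R))"
      using insert(1,2) by (simp add: add.assoc)
    show ?case
    proof (cases "g j \<in> g ` J")
      case False
      then show ?thesis using 1 insert(1) by simp
    next
      case True
      define R where "R = (\<Sum>U\<in>g ` J - {g j}. K U)"
      have R: "?R = K (g j) + R" using True insert(1) by (simp add: R_def sum.remove)
      have "convex (P + R)"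
        unfolding R_def using insert(1) assms(2) insert.prems by (intro convex_set_plus convex_set_sum) auto
      then have "comb_equiv (P + R + K (g j) + K (g j)) (P + R + K (g j))"
        by (rule comb_equiv_add_same[OF _ assms(2)])
      then have "comb_equiv (P + (K (g j) + ?R)) (P + ?R)" by (simp add: R ac_simps)
      with 1 have "comb_equiv (P + (\<Sum>j\<in>insert j J. K (g j))) (P + ?R)" by (rule comb_equiv_trans)
      then show ?thesis using True by (simp add: insert_absorb)
    qed
  qed
  from this[OF convex_singleton[of 0]] show ?thesis by (simp only: set_add_0)
qed

section \<open>Sums of coordinate simplices\<close>

definition std_simplex :: "nat set \<Rightarrow> point set" where
  "std_simplex T = convex hull ((\<lambda>i. Poly_Mapping.single i 1) ` T)"

lemma nestohedron_simplex: "nestohedron B = (\<Sum>T\<in>B. std_simplex T)"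
  by (simp add: nestohedron_def std_simplex_def)

lemma convex_simplex: "convex (std_simplex T)"
  by (simp add: std_simplex_def)

lemma polytope_simplex: "finite T \<Longrightarrow> polytope (std_simplex T)"
  by (auto simp: std_simplex_def polytope_def)

lemma vertex_in_simplex: "i \<in> T \<Longrightarrow> Poly_Mapping.single i 1 \<in> std_simplex T"
  by (simp add: std_simplex_def hull_inc)

lemma simplex_nonempty: "T \<noteq> {} \<Longrightarrow> std_simplex T \<noteq> {}"
  using vertex_in_simplex by blast

lemma point_as_sum:
  assumes "finite T" "Poly_Mapping.keys x \<subseteq> T"
  shows "(\<Sum>i\<in>T. Poly_Mapping.lookup x i *\<^sub>R Poly_Mapping.single i 1) = (x :: point)"
proof (rule poly_mapping_eqI)
  fix k
  have "Poly_Mapping.lookup (\<Sum>i\<in>T. Poly_Mapping.lookup x i *\<^sub>R (Poly_Mapping.single i 1 :: point)) k =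
      (\<Sum>i\<in>T. if i = k then Poly_Mapping.lookup x i else 0)"
    by (auto simp: lookup_sum lookup_scaleR_point lookup_single when_def intro!: sum.cong)
  then show "Poly_Mapping.lookup (\<Sum>i\<in>T. Poly_Mapping.lookup x i *\<^sub>R (Poly_Mapping.single i 1 :: point)) k
      = Poly_Mapping.lookup x k"
    using assms by (auto simp: in_keys_iff)
qed

definition coord_sum :: "nat set \<Rightarrow> point \<Rightarrow> real" where
  "coord_sum S x = (\<Sum>i\<in>S. Poly_Mapping.lookup x i)"

lemma linear_coord_sum: "linear (coord_sum S)"
  by (rule linearI) (simp_all add: coord_sum_def lookup_add lookup_scaleR_point sum.distrib sum_distrib_left)

lemma simplex_iff:
  assumes T: "finite T"
  shows "x \<in> std_simplex T \<longleftrightarrow> Poly_Mapping.keys x \<subseteq> T \<and> (\<forall>i. 0 \<le> Poly_Mapping.lookup x i) \<and> coord_sum T x = 1"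
    (is "_ \<longleftrightarrow> ?R")
proof
  assume R: ?R
  have "x = (\<Sum>i\<in>T. Poly_Mapping.lookup x i *\<^sub>R Poly_Mapping.single i 1)"
    using point_as_sum[OF T] R by simp
  also have "\<dots> \<in> std_simplex T"
    using R unfolding coord_sum_def
    by (intro convex_sum[OF T convex_simplex]) (auto intro: vertex_in_simplex)
  finally show "x \<in> std_simplex T" .
next
  have "std_simplex T \<subseteq> {x. Poly_Mapping.keys x \<subseteq> T \<and>
      (\<forall>i. 0 \<le> Poly_Mapping.lookup x i) \<and> coord_sum T x = 1}"
    unfolding std_simplex_def
  proof (rule hull_minimal)
    show "(\<lambda>i. Poly_Mapping.single i 1) ` T \<subseteq> {x. Poly_Mapping.keys x \<subseteq> T \<and>
        (\<forall>i. 0 \<le> Poly_Mapping.lookup x i) \<and> coord_sum T x = 1}"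
      using T by (auto simp: coord_sum_def lookup_single when_def)
    show "convex {x. Poly_Mapping.keys x \<subseteq> T \<and>
        (\<forall>i. 0 \<le> Poly_Mapping.lookup x i) \<and> coord_sum T x = 1}"
    proof (rule convexI, clarify, intro conjI allI)
      fix x y :: point and u v :: real
      assume h: "0 \<le> u" "0 \<le> v" "u + v = 1"
        "Poly_Mapping.keys x \<subseteq> T" "\<forall>i. 0 \<le> Poly_Mapping.lookup x i" "coord_sum T x = 1"
        "Poly_Mapping.keys y \<subseteq> T" "\<forall>i. 0 \<le> Poly_Mapping.lookup y i" "coord_sum T y = 1"
      show "Poly_Mapping.keys (u *\<^sub>R x + v *\<^sub>R y) \<subseteq> T"
      proof
        fix i assume "i \<in> Poly_Mapping.keys (u *\<^sub>R x + v *\<^sub>R y)"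
        then have "u * Poly_Mapping.lookup x i + v * Poly_Mapping.lookup y i \<noteq> 0"
          by (simp add: in_keys_iff lookup_add lookup_scaleR_point)
        then have "Poly_Mapping.lookup x i \<noteq> 0 \<or> Poly_Mapping.lookup y i \<noteq> 0" by auto
        then show "i \<in> T" using h by (auto simp: in_keys_iff[symmetric])
      qed
      show "0 \<le> Poly_Mapping.lookup (u *\<^sub>R x + v *\<^sub>R y) i" for i
        using h by (simp add: lookup_add lookup_scaleR_point)
      show "coord_sum T (u *\<^sub>R x + v *\<^sub>R y) = 1"
        using h by (simp add: linear_add[OF linear_coord_sum] linear_scale[OF linear_coord_sum])
    qed
  qed
  then show "x \<in> std_simplex T \<Longrightarrow> ?R" by blast
qed

lemma coord_sum_superset:
  assumes "finite S" "finite T" "Poly_Mapping.keys x \<subseteq> T" "T \<subseteq> S"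
  shows "coord_sum S x = coord_sum T x"
  unfolding coord_sum_def using assms by (intro sum.mono_neutral_right) (auto simp: in_keys_iff)

text \<open>Nonnegative coordinates with sum zero vanish. For \<open>T\<close> inside
  \<open>S\<close> both sides are false, as all coordinates together sum to 1.\<close>

lemma simplex_Diff_iff:
  assumes "finite T" "finite S"
  shows "x \<in> std_simplex (T - S) \<longleftrightarrow> x \<in> std_simplex T \<and> coord_sum S x = 0"
proof
  assume "x \<in> std_simplex (T - S)"
  then have x: "Poly_Mapping.keys x \<subseteq> T - S" "\<forall>i. 0 \<le> Poly_Mapping.lookup x i" "coord_sum (T - S) x = 1"
    using assms by (auto simp: simplex_iff)
  then have "coord_sum T x = 1"
    using coord_sum_superset[of T "T - S" x] assms by auto
  moreover have "coord_sum S x = 0" unfolding coord_sum_def using x by (auto intro!: sum.neutral simp: in_keys_iff)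
  ultimately show "x \<in> std_simplex T \<and> coord_sum S x = 0" using x assms by (auto simp: simplex_iff)
next
  assume h: "x \<in> std_simplex T \<and> coord_sum S x = 0"
  then have x: "Poly_Mapping.keys x \<subseteq> T" "\<forall>i. 0 \<le> Poly_Mapping.lookup x i" "coord_sum T x = 1"
    using assms by (auto simp: simplex_iff)
  have "\<forall>i\<in>S. Poly_Mapping.lookup x i = 0"
    using h x assms unfolding coord_sum_def by (subst (asm) sum_nonneg_eq_0_iff) auto
  then have k: "Poly_Mapping.keys x \<subseteq> T - S" using x by (auto simp: in_keys_iff)
  then have "coord_sum (T - S) x = 1" using coord_sum_superset[of T "T - S" x] x assms by auto
  then show "x \<in> std_simplex (T - S)" using k x assms by (simp add: simplex_iff)
qed

lemma keys_sum_subset: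
  assumes "\<And>i. i \<in> I \<Longrightarrow> Poly_Mapping.keys (s i) \<subseteq> V"
  shows "Poly_Mapping.keys (sum s I) \<subseteq> V"
proof
  fix k assume "k \<in> Poly_Mapping.keys (sum s I)"
  then have "(\<Sum>i\<in>I. Poly_Mapping.lookup (s i) k) \<noteq> 0" by (simp add: in_keys_iff lookup_sum)
  then obtain i where "i \<in> I" "Poly_Mapping.lookup (s i) k \<noteq> 0" by (meson sum.neutral)
  then show "k \<in> V" using assms by (auto simp: in_keys_iff[symmetric])
qed

text \<open>Every summand has coordinate sum 1. The sum therefore lies in a hyperplane of the
  coordinate space of \<open>V\<close>, which bounds its dimension.\<close>

lemma simplex_sum_keys:
  assumes "finite V" "finite J" "\<And>t. t \<in> J \<Longrightarrow> g t \<subseteq> V" "x \<in> (\<Sum>t\<in>J. std_simplex (g t))"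
  shows "Poly_Mapping.keys x \<subseteq> V" "coord_sum V x = card J"
proof -
  obtain s where s: "x = sum s J" "\<forall>t\<in>J. s t \<in> std_simplex (g t)"
    using assms(4) unfolding set_sum_alt[OF assms(2)] by blast
  have st: "Poly_Mapping.keys (s t) \<subseteq> V" "coord_sum V (s t) = 1" if t: "t \<in> J" for t
  proof -
    have f: "finite (g t)" using assms(1,3) t finite_subset by blast
    have h: "Poly_Mapping.keys (s t) \<subseteq> g t" "coord_sum (g t) (s t) = 1"
      using s t simplex_iff[OF f] by auto
    show "Poly_Mapping.keys (s t) \<subseteq> V" using h assms(3)[OF t] by blast
    show "coord_sum V (s t) = 1" using coord_sum_superset[OF assms(1) f] h assms(3)[OF t] by simp
  qed
  show "Poly_Mapping.keys x \<subseteq> V" unfolding s(1) by (rule keys_sum_subset) (rule st)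
  show "coord_sum V x = card J"
    unfolding s(1) linear_sum[OF linear_coord_sum] using st by simp
qed

text \<open>The summand \<open>std_simplex V\<close> provides the directions from one vertex
  \<open>a\<close> to all others, and the constant coordinate sum excludes any further
  direction.\<close>

lemma pdim_simplex_sum:
  assumes V: "finite V" and J: "finite J" "\<And>t. t \<in> J \<Longrightarrow> g t \<subseteq> V \<and> g t \<noteq> {}"
    and t0: "t0 \<in> J" "g t0 = V"
  shows "pdim (\<Sum>t\<in>J. std_simplex (g t)) + 1 = card V"
proof -
  let ?N = "\<Sum>t\<in>J. std_simplex (g t)"
  let ?D = "{x - y |x y. x \<in> ?N \<and> y \<in> ?N}"
  let ?e = "\<lambda>i. Poly_Mapping.single i 1 :: point"
  obtain a where a: "a \<in> V" using J t0 by blast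
  define b where "b i = ?e i - ?e a" for i
  have lb: "Poly_Mapping.lookup (b i) k = (if i = k then 1 else 0) - (if a = k then 1 else 0)" for i k
    by (simp add: b_def lookup_minus lookup_single when_def)
  have inj: "inj_on b (V - {a})"
    by (auto simp: inj_on_def b_def dest: inj_onD[OF inj_single]) (metis lookup_single_eq lookup_single_not_eq zero_neq_one)
  have ind: "independent (b ` (V - {a}))"
  proof -
    have "u (b i) = 0" if z: "(\<Sum>v\<in>b ` (V - {a}). u v *\<^sub>R v) = 0" and i: "i \<in> V - {a}" for u i
    proof -
      have "0 = Poly_Mapping.lookup (\<Sum>j\<in>V - {a}. u (b j) *\<^sub>R b j) i"
        using z inj by (simp add: sum.reindex)
      also have "\<dots> = (\<Sum>j\<in>V - {a}. if j = i then u (b j) else 0)"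
        unfolding lookup_sum using i by (intro sum.cong refl) (auto simp: lookup_scaleR_point lb)
      also have "\<dots> = u (b i)" using i V by simp
      finally show ?thesis by simp
    qed
    then show ?thesis using V by (subst real_vector.dependent_finite) auto
  qed
  have sub: "b ` (V - {a}) \<subseteq> ?D"
  proof
    fix z assume "z \<in> b ` (V - {a})"
    then obtain i where i: "i \<in> V" "z = b i" by blast
    \<comment> \<open>One vertex is fixed in each remaining summand, so that only the vertex of
      \<open>std_simplex V\<close> varies.\<close>
    define r where "r = (\<Sum>t\<in>J - {t0}. ?e (SOME i. i \<in> g t))"
    have mem: "?e j + r \<in> ?N" if "j \<in> V" for j
    proof -
      have "?e (SOME i. i \<in> g t) \<in> std_simplex (g t)" if "t \<in> J" for t
        using J(2)[OF that] by (intro vertex_in_simplex) (simp add: some_in_eq)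
      then have "r \<in> (\<Sum>t\<in>J - {t0}. std_simplex (g t))"
        unfolding r_def using J(1) by (subst set_sum_alt) auto
      moreover have "?N = std_simplex V + (\<Sum>t\<in>J - {t0}. std_simplex (g t))"
        using J(1) t0 by (simp add: sum.remove)
      ultimately show ?thesis using vertex_in_simplex[OF that] by auto
    qed
    have "z = (?e i + r) - (?e a + r)" by (simp add: i b_def)
    then show "z \<in> ?D" using mem i a by blast
  qed
  have "?D \<subseteq> span (b ` (V - {a}))"
  proof clarify
    fix x y assume xy: "x \<in> ?N" "y \<in> ?N"
    have k: "Poly_Mapping.keys x \<subseteq> V" "Poly_Mapping.keys y \<subseteq> V" "coord_sum V x = coord_sum V y"
      using simplex_sum_keys[OF V J(1), of g] J(2) xy by auto
    define z where "z = x - y"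
    have z: "Poly_Mapping.keys z \<subseteq> V" using k keys_diff[of x y] by (auto simp: z_def)
    have z0: "coord_sum V z = 0" using k by (simp add: z_def linear_diff[OF linear_coord_sum])
    have zs: "z = (\<Sum>i\<in>V. Poly_Mapping.lookup z i *\<^sub>R ?e i)" using point_as_sum[OF V z] by simp
    also have "\<dots> = (\<Sum>i\<in>V. Poly_Mapping.lookup z i *\<^sub>R b i) + (\<Sum>i\<in>V. Poly_Mapping.lookup z i *\<^sub>R ?e a)"
      by (simp add: b_def sum.distrib[symmetric] scaleR_add_right[symmetric])
    also have "(\<Sum>i\<in>V. Poly_Mapping.lookup z i *\<^sub>R ?e a) = 0"
      using z0 by (simp add: coord_sum_def scaleR_left.sum[symmetric])
    also have "(\<Sum>i\<in>V. Poly_Mapping.lookup z i *\<^sub>R b i) = (\<Sum>i\<in>V - {a}. Poly_Mapping.lookup z i *\<^sub>R b i)"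
      using V a by (simp add: sum.remove b_def)
    finally have "z = (\<Sum>i\<in>V - {a}. Poly_Mapping.lookup z i *\<^sub>R b i)" by simp
    moreover have "\<dots> \<in> span (b ` (V - {a}))" by (intro span_sum span_scale span_base) auto
    ultimately show "x - y \<in> span (b ` (V - {a}))" unfolding z_def by simp
  qed
  then have "card (b ` (V - {a})) = pdim ?N"
    unfolding pdim_def using sub ind by (intro real_vector.basis_card_eq_dim)
  then show ?thesis using card_image[OF inj] card.remove[OF V a] by simp
qed

section \<open>Facets of nestohedra\<close>

lemma face_of_supporting_functional:
  assumes u: "linear u" and P: "convex P" and m: "\<And>x. x \<in> P \<Longrightarrow> (m::real) \<le> u x"
  shows "{x \<in> P. u x = m} face_of P"
  unfolding face_of_def
proof (intro conjI ballI impI)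
  show "convex {x \<in> P. u x = m}"
  proof (rule convexI)
    fix x y and a b :: real
    assume h: "x \<in> {x \<in> P. u x = m}" "y \<in> {x \<in> P. u x = m}" "0 \<le> a" "0 \<le> b" "a + b = 1"
    then have "u (a *\<^sub>R x + b *\<^sub>R y) = a * m + b * m"
      by (simp add: linear_add[OF u] linear_scale[OF u])
    also have "\<dots> = m" using h(5) by (simp flip: distrib_right)
    finally show "a *\<^sub>R x + b *\<^sub>R y \<in> {x \<in> P. u x = m}" using h convexD[OF P] by simp
  qed
  fix a b x assume h: "a \<in> P" "b \<in> P" "x \<in> {x \<in> P. u x = m}" "x \<in> open_segment a b"
  then obtain t where t: "0 < t" "t < 1" "x = (1 - t) *\<^sub>R a + t *\<^sub>R b" by (auto simp: in_segment)
  have "(1 - t) * u a + t * u b = m"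
    using h t by (simp add: linear_add[OF u] linear_scale[OF u])
  then have e: "(1 - t) * (u a - m) + t * (u b - m) = 0" by (simp add: algebra_simps)
  have nn: "0 \<le> (1 - t) * (u a - m)" "0 \<le> t * (u b - m)" using m[OF h(1)] m[OF h(2)] t by simp_all
  have "(1 - t) * (u a - m) = 0" "t * (u b - m) = 0" using e nn by linarith+
  then show "a \<in> {x \<in> P. u x = m}" "b \<in> {x \<in> P. u x = m}" using h t by simp_all
qed auto

definition restrict_to :: "nat set set \<Rightarrow> nat set \<Rightarrow> nat set set" where
  "restrict_to B S = {T \<in> B. T \<subseteq> S}"

text \<open>For \<open>S\<close> in a building set this is the usual contraction, consisting of the
  nonempty \<open>U\<close> disjoint from \<open>S\<close> with \<open>U\<close> or
  \<open>U \<union> S\<close> in the building set: a member meeting \<open>S\<close> may be enlarged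
  by \<open>S\<close>.\<close>

definition contract :: "nat set set \<Rightarrow> nat set \<Rightarrow> nat set set" where
  "contract B S = (\<lambda>T. T - S) ` {T \<in> B. \<not> T \<subseteq> S}"

locale connected_building =
  fixes V :: "nat set" and B :: "nat set set"
  assumes finite_V: "finite V" and building: "building_set V B" and V_mem: "V \<in> B"
begin

lemma memD: "T \<in> B \<Longrightarrow> T \<subseteq> V" "T \<in> B \<Longrightarrow> T \<noteq> {}" "T \<in> B \<Longrightarrow> finite T"
  using building finite_V by (auto simp: building_set_def intro: finite_subset)

lemma union_mem: "S \<in> B \<Longrightarrow> T \<in> B \<Longrightarrow> S \<inter> T \<noteq> {} \<Longrightarrow> S \<union> T \<in> B"
  and singleton_mem: "i \<in> V \<Longrightarrow> {i} \<in> B"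
  using building by (auto simp: building_set_def)

lemma finite_B: "finite B"
  using finite_V memD by (meson PowI finite_Pow_iff rev_finite_subset subsetI)

lemma nestohedron_iff:
  "x \<in> nestohedron B \<longleftrightarrow> (\<exists>s. x = sum s B \<and> (\<forall>T\<in>B. s T \<in> std_simplex T))"
  unfolding nestohedron_simplex set_sum_alt[OF finite_B] by blast

lemma polytope_nestohedron: "polytope (nestohedron B)"
  unfolding nestohedron_simplex using finite_B memD by (intro polytope_set_sum polytope_simplex) auto

lemma nestohedron_nonempty: "nestohedron B \<noteq> {}"
  unfolding nestohedron_simplex using finite_B memD by (intro set_sum_nonempty simplex_nonempty) auto

lemma convex_nestohedron: "convex (nestohedron B)"
  by (rule polytope_imp_convex[OF polytope_nestohedron])

lemma pdim_nestohedron: "pdim (nestohedron B) + 1 = card V"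
  unfolding nestohedron_simplex
  using pdim_simplex_sum[OF finite_V finite_B, of "\<lambda>T. T"] memD V_mem by blast

text \<open>The labels of the vertices of \<open>std_simplex T\<close> at which the sum of the
  coordinates in \<open>S\<close> is minimal.\<close>

definition cut :: "nat set \<Rightarrow> nat set \<Rightarrow> nat set" where
  "cut S T = (if T \<subseteq> S then T else T - S)"

text \<open>The face of the nestohedron on which the sum of the coordinates in \<open>S\<close> is minimal.\<close>

definition nest_face :: "nat set \<Rightarrow> point set" where
  "nest_face S = (\<Sum>T\<in>B. std_simplex (cut S T))"

lemma nest_face_iff_ex:
  "x \<in> nest_face S \<longleftrightarrow> (\<exists>s. x = sum s B \<and> (\<forall>T\<in>B. s T \<in> std_simplex (cut S T)))"
  unfolding nest_face_def set_sum_alt[OF finite_B] by blast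

lemma cut_simplex:
  assumes S: "finite S" and T: "T \<in> B"
  shows "x \<in> std_simplex (cut S T) \<longleftrightarrow>
      x \<in> std_simplex T \<and> coord_sum S x = (if T \<subseteq> S then 1 else 0)"
    and "x \<in> std_simplex T \<Longrightarrow> (if T \<subseteq> S then 1 else 0) \<le> coord_sum S x"
proof -
  have f: "finite T" using memD T by blast
  have 1: "coord_sum S x = 1" if "x \<in> std_simplex T" "T \<subseteq> S"
    using that coord_sum_superset[OF S f] simplex_iff[OF f] by metis
  show "x \<in> std_simplex (cut S T) \<longleftrightarrow>
      x \<in> std_simplex T \<and> coord_sum S x = (if T \<subseteq> S then 1 else 0)"
    using 1 simplex_Diff_iff[OF f S] by (auto simp: cut_def)
  show "x \<in> std_simplex T \<Longrightarrow> (if T \<subseteq> S then 1 else 0) \<le> coord_sum S x"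
    using 1 by (auto simp: simplex_iff[OF f] coord_sum_def intro!: sum_nonneg)
qed

text \<open>The minimum of \<open>coord_sum S\<close> on the nestohedron: summands inside
  \<open>S\<close> contribute exactly 1, all others can be brought to 0.\<close>

definition level :: "nat set \<Rightarrow> real" where
  "level S = (\<Sum>T\<in>B. if T \<subseteq> S then 1 else 0)"

lemma level_le:
  assumes "finite S" "x \<in> nestohedron B" shows "level S \<le> coord_sum S x"
proof -
  obtain s where s: "x = sum s B" "\<forall>T\<in>B. s T \<in> std_simplex T"
    using assms(2) nestohedron_iff by blast
  then show ?thesis
    unfolding level_def s(1) linear_sum[OF linear_coord_sum]
    using cut_simplex(2)[OF assms(1)] by (intro sum_mono) blast
qed

text \<open>A total equals the sum of the minima exactly when every term is minimal. As
  \<open>s\<close> is arbitrary, any one decomposition of a point decides its membership in all the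
  faces \<open>nest_face S\<close>.\<close>

lemma coord_sum_eq_level_iff:
  assumes S: "finite S" and s: "\<forall>T\<in>B. s T \<in> std_simplex T"
  shows "coord_sum S (sum s B) = level S \<longleftrightarrow> (\<forall>T\<in>B. s T \<in> std_simplex (cut S T))"
proof -
  have "coord_sum S (sum s B) = level S \<longleftrightarrow>
      (\<Sum>T\<in>B. coord_sum S (s T) - (if T \<subseteq> S then 1 else 0)) = 0"
    by (simp add: level_def linear_sum[OF linear_coord_sum] sum_subtractf)
  also have "\<dots> \<longleftrightarrow> (\<forall>T\<in>B. coord_sum S (s T) - (if T \<subseteq> S then 1 else 0) = 0)"
    using cut_simplex(2)[OF S] s by (intro sum_nonneg_eq_0_iff[OF finite_B]) simp
  also have "\<dots> \<longleftrightarrow> (\<forall>T\<in>B. s T \<in> std_simplex (cut S T))"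
    using cut_simplex(1)[OF S] s by auto
  finally show ?thesis .
qed

lemma nest_face_eq:
  assumes "finite S" shows "nest_face S = {x \<in> nestohedron B. coord_sum S x = level S}"
proof (intro equalityI subsetI)
  fix x assume "x \<in> nest_face S"
  then obtain s where s: "x = sum s B" "\<forall>T\<in>B. s T \<in> std_simplex (cut S T)"
    using nest_face_iff_ex by blast
  then have s': "\<forall>T\<in>B. s T \<in> std_simplex T" using cut_simplex(1)[OF assms] by blast
  then show "x \<in> {x \<in> nestohedron B. coord_sum S x = level S}"
    using s coord_sum_eq_level_iff[OF assms s'] nestohedron_iff by auto
next
  fix x assume x: "x \<in> {x \<in> nestohedron B. coord_sum S x = level S}"
  then obtain s where s: "x = sum s B" "\<forall>T\<in>B. s T \<in> std_simplex T" using nestohedron_iff by blast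
  then show "x \<in> nest_face S" using x coord_sum_eq_level_iff[OF assms s(2)] nest_face_iff_ex by blast
qed

lemma nest_face_sum_iff:
  assumes "finite S" "\<forall>T\<in>B. s T \<in> std_simplex T"
  shows "sum s B \<in> nest_face S \<longleftrightarrow> (\<forall>T\<in>B. s T \<in> std_simplex (cut S T))"
  unfolding nest_face_eq[OF assms(1)] coord_sum_eq_level_iff[OF assms, symmetric]
  using assms(2) nestohedron_iff by blast

lemma nest_face_face: "finite S \<Longrightarrow> nest_face S face_of nestohedron B"
  unfolding nest_face_eq
  by (rule face_of_supporting_functional[OF linear_coord_sum convex_nestohedron level_le])

definition lower :: "nat set \<Rightarrow> point set" where
  "lower S = (\<Sum>T\<in>{T \<in> B. T \<subseteq> S}. std_simplex T)"

definition upper :: "nat set \<Rightarrow> point set" where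
  "upper S = (\<Sum>T\<in>{T \<in> B. \<not> T \<subseteq> S}. std_simplex (T - S))"

lemma lower_eq: "lower S = nestohedron (restrict_to B S)"
  by (simp add: lower_def nestohedron_simplex restrict_to_def)

lemma comb_equiv_upper: "comb_equiv (upper S) (nestohedron (contract B S))"
  unfolding upper_def nestohedron_simplex contract_def
  using finite_B convex_simplex by (intro comb_equiv_sum_image) auto

lemma nest_face_split: "nest_face S = lower S + upper S"
proof -
  have "nest_face S = (\<Sum>T\<in>B. if T \<subseteq> S then std_simplex T else std_simplex (T - S))"
    unfolding nest_face_def cut_def by (intro sum.cong) auto
  also have "\<dots> = lower S + upper S"
    unfolding lower_def upper_def using finite_B
    by (subst sum.If_cases) (auto intro!: arg_cong2[of _ _ _ _ "(+)"] sum.cong)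
  finally show ?thesis .
qed

lemma lower_polytope: "polytope (lower S)" "lower S \<noteq> {}"
proof -
  show "polytope (lower S)"
    unfolding lower_def using finite_B memD(3) by (intro polytope_set_sum polytope_simplex) auto
  show "lower S \<noteq> {}"
    unfolding lower_def using finite_B memD(2) by (intro set_sum_nonempty simplex_nonempty) auto
qed

lemma upper_polytope: "polytope (upper S)" "upper S \<noteq> {}"
proof -
  show "polytope (upper S)"
    unfolding upper_def using finite_B memD(3) by (intro polytope_set_sum polytope_simplex) auto
  show "upper S \<noteq> {}"
    unfolding upper_def using finite_B by (intro set_sum_nonempty simplex_nonempty) auto
qed

text \<open>The two Minkowski summands are supported on the disjoint coordinate sets
  \<open>S\<close> and \<open>V - S\<close>, so addition is injective on the product.\<close>

lemma comb_equiv_nest_face: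
  assumes "finite S" shows "comb_equiv (nest_face S) (lower S \<times> upper S)"
proof -
  let ?add = "\<lambda>(a :: point, c). a + c"
  have keys: "Poly_Mapping.keys a \<subseteq> S" if "a \<in> lower S" for a
    by (rule simplex_sum_keys(1)[OF assms _ _ that[unfolded lower_def]]) (use finite_B in auto)
  have keys': "Poly_Mapping.keys c \<subseteq> V - S" if "c \<in> upper S" for c
    by (rule simplex_sum_keys(1)[of "V - S", OF _ _ _ that[unfolded upper_def]])
      (use finite_B finite_V memD(1) in auto)
  have "inj_on ?add (lower S \<times> upper S)"
  proof (rule inj_onI, clarify)
    fix a c a' c' assume h: "a \<in> lower S" "c \<in> upper S" "a' \<in> lower S" "c' \<in> upper S" "a + c = a' + c'"
    have e: "Poly_Mapping.lookup a i + Poly_Mapping.lookup c i =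
        Poly_Mapping.lookup a' i + Poly_Mapping.lookup c' i" for i
      using h(5) by (metis lookup_add)
    have "Poly_Mapping.lookup a i = Poly_Mapping.lookup a' i \<and> Poly_Mapping.lookup c i = Poly_Mapping.lookup c' i" for i
    proof (cases "i \<in> S")
      case True
      then have "Poly_Mapping.lookup c i = 0" "Poly_Mapping.lookup c' i = 0"
        using keys'[OF h(2)] keys'[OF h(4)] by (auto simp: in_keys_iff)
      then show ?thesis using e[of i] by simp
    next
      case False
      then have "Poly_Mapping.lookup a i = 0" "Poly_Mapping.lookup a' i = 0"
        using keys[OF h(1)] keys[OF h(3)] by (auto simp: in_keys_iff)
      then show ?thesis using e[of i] by simp
    qed
    then show "a = a' \<and> c = c'" by (auto intro: poly_mapping_eqI)
  qed
  moreover have "linear ?add" by (simp add: linear_iff algebra_simps)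
  moreover have "convex (lower S \<times> upper S)"
    by (intro convex_Times polytope_imp_convex lower_polytope upper_polytope)
  ultimately have "comb_equiv (lower S \<times> upper S) (?add ` (lower S \<times> upper S))"
    by (intro comb_equiv_linear_image_inj_on)
  then show ?thesis unfolding nest_face_split set_plus_image by (rule comb_equiv_sym)
qed

text \<open>The dimensions |S| - 1 and |V - S| - 1 of the factors add up to one less than |V| - 1.
  Membership of \<open>S\<close> and \<open>V\<close> in \<open>B\<close> makes the full simplex
  occur in each factor.\<close>

lemma nest_face_facet:
  assumes S: "S \<in> B" "S \<noteq> V" shows "nest_face S \<in> facets (nestohedron B)"
proof -
  have fS: "finite S" "S \<subseteq> V" using memD S by auto
  obtain K where K: "finite K" "lower S \<subseteq> span K" using polytope_subset_span lower_polytope by blast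
  obtain L where L: "finite L" "upper S \<subseteq> span L" using polytope_subset_span upper_polytope by blast
  have ne: "nest_face S \<noteq> {}" using lower_polytope(2) upper_polytope(2) by (auto simp: nest_face_split)
  have face: "nest_face S face_of nestohedron B" by (rule nest_face_face[OF fS(1)])
  obtain \<phi> where "face_iso \<phi> (nest_face S) (lower S \<times> upper S)"
    using comb_equiv_nest_face[OF fS(1)] by (auto simp: comb_equiv_iff_face_iso)
  then have "pdim (nest_face S) = pdim (lower S \<times> upper S)"
    using lower_polytope upper_polytope ne
    by (intro face_iso_pdim polytope_face[OF polytope_nestohedron face] polytope_Times) auto
  also have "\<dots> = pdim (lower S) + pdim (upper S)"
    by (rule pdim_Times[OF K L lower_polytope(2) upper_polytope(2)])
  finally have "pdim (nest_face S) = pdim (lower S) + pdim (upper S)" .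
  moreover have "pdim (lower S) + 1 = card S"
    unfolding lower_def
    by (rule pdim_simplex_sum[OF fS(1), of _ _ S]) (use finite_B memD(2) S in auto)
  moreover have "pdim (upper S) + 1 = card (V - S)"
    unfolding upper_def
  proof (rule pdim_simplex_sum[of _ _ _ V])
    show "V \<in> {T \<in> B. \<not> T \<subseteq> S}" using V_mem S fS by auto
    show "T - S \<subseteq> V - S \<and> T - S \<noteq> {}" if "T \<in> {T \<in> B. \<not> T \<subseteq> S}" for T
      using that memD(1) by auto
  qed (use finite_B finite_V in auto)
  moreover have "card S + card (V - S) = card V"
    using fS finite_V by (metis card_Diff_subset card_mono le_add_diff_inverse)
  ultimately have "pdim (nest_face S) + 1 = pdim (nestohedron B)"
    using pdim_nestohedron by linarith
  then show ?thesis using face ne by (simp add: facets_def)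
qed

text \<open>A functional \<open>u\<close> exposing \<open>F\<close> is minimised summand by summand.
  \<open>U\<close> consists of the labels where \<open>u\<close> exceeds its least vertex value, and
  \<open>S\<close> is a maximal member of \<open>B\<close> inside \<open>U\<close>. A member
  \<open>T\<close> that meets \<open>S\<close> without being contained in it reaches outside
  \<open>U\<close>, since otherwise \<open>S \<union> T\<close> would be larger; so its summand
  avoids \<open>S\<close>. Hence \<open>F\<close> lies in \<open>nest_face S\<close>, and maximality
  of facets gives equality.\<close>

lemma facet_is_nest_face:
  assumes F: "F \<in> facets (nestohedron B)" shows "\<exists>S\<in>B - {V}. F = nest_face S"
proof -
  let ?e = "\<lambda>i. Poly_Mapping.single i 1 :: point"
  obtain u :: "point \<Rightarrow> real" and m where u: "linear u" and Fu: "F = {x \<in> nestohedron B. u x = m}"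
    and m: "\<And>x. x \<in> nestohedron B \<Longrightarrow> m \<le> u x" and nc: "\<exists>x\<in>nestohedron B. u x \<noteq> m"
    using facet_exposed[OF polytope_nestohedron F] by blast
  have ux: "u x = (\<Sum>i\<in>T. Poly_Mapping.lookup x i * u (?e i))" if "x \<in> std_simplex T" "T \<in> B" for x T
  proof -
    have f: "finite T" using memD that by blast
    have "u x = u (\<Sum>i\<in>T. Poly_Mapping.lookup x i *\<^sub>R ?e i)"
      using point_as_sum[OF f] that simplex_iff[OF f] by simp
    then show ?thesis by (simp add: linear_sum[OF u] linear_scale[OF u])
  qed
  have Vne: "V \<noteq> {}" using memD V_mem by blast
  define \<mu> where "\<mu> = Min ((\<lambda>i. u (?e i)) ` V)"
  define U where "U = {i \<in> V. \<mu> < u (?e i)}"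
  have \<mu>: "\<mu> \<le> u (?e i)" if "i \<in> V" for i using that finite_V by (simp add: \<mu>_def)
  have "\<mu> \<in> (\<lambda>i. u (?e i)) ` V" unfolding \<mu>_def using finite_V Vne by (intro Min_in) auto
  then have UV: "U \<subset> V" by (auto simp: U_def)
  have dev: "(\<Sum>i\<in>T. Poly_Mapping.lookup x i * (u (?e i) - \<mu>)) = u x - \<mu>"
    if "x \<in> std_simplex T" "T \<in> B" for x T
  proof -
    have "coord_sum T x = 1" using that simplex_iff[OF memD(3)[OF that(2)]] by simp
    then show ?thesis
      unfolding ux[OF that]
      by (simp add: right_diff_distrib sum_subtractf coord_sum_def flip: sum_distrib_right)
  qed
  \<comment> \<open>If all vertex values agree, \<open>u\<close> is constant on the nestohedron,
    because each member of \<open>B\<close> contributes total weight 1.\<close>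
  have "U \<noteq> {}"
  proof
    assume "U = {}"
    then have c: "u (?e i) = \<mu>" if "i \<in> V" for i using \<mu>[OF that] that by (force simp: U_def)
    have "u x = of_nat (card B) * \<mu>" if x: "x \<in> nestohedron B" for x
    proof -
      obtain s where s: "x = sum s B" "\<forall>T\<in>B. s T \<in> std_simplex T" using x nestohedron_iff by blast
      have "u (s T) = \<mu>" if T: "T \<in> B" for T
        using dev[of "s T" T] s T c memD(1)[OF T] by (simp add: subset_iff)
      then show ?thesis using s(1) by (simp add: linear_sum[OF u])
    qed
    moreover have "F \<noteq> {}" using F by (simp add: facets_def)
    ultimately show False using nc Fu by auto
  qed
  then obtain i0 where "i0 \<in> U" by blast
  then have ne: "{S \<in> B. S \<subseteq> U} \<noteq> {}" using singleton_mem[of i0] UV by blast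
  then obtain S where "S \<in> {S \<in> B. S \<subseteq> U}" "\<forall>T\<in>{S \<in> B. S \<subseteq> U}. S \<subseteq> T \<longrightarrow> S = T"
    using finite_has_maximal[of "{S \<in> B. S \<subseteq> U}"] finite_B by auto
  then have S: "S \<in> B" "S \<subseteq> U" and max: "\<And>T. T \<in> B \<Longrightarrow> T \<subseteq> U \<Longrightarrow> S \<subseteq> T \<Longrightarrow> T = S"
    by auto
  have fS: "finite S" using memD S by blast
  have "F \<subseteq> nest_face S"
  proof
    fix x assume "x \<in> F"
    then have x: "x \<in> nestohedron B" "u x = m" using Fu by auto
    then obtain s where s: "x = sum s B" "\<forall>T\<in>B. s T \<in> std_simplex T" using nestohedron_iff by blast
    \<comment> \<open>Replacing the summand at \<open>T\<close> by the vertex \<open>i\<close> stays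
      in the nestohedron and cannot push \<open>u\<close> below \<open>m\<close>.\<close>
    have le: "u (s T) \<le> u (?e i)" if T: "T \<in> B" "i \<in> T" for T i
    proof -
      define s' where "s' = s(T := ?e i)"
      have "\<forall>T\<in>B. s' T \<in> std_simplex T" using s T vertex_in_simplex by (simp add: s'_def)
      then have "m \<le> u (sum s' B)" using m nestohedron_iff by blast
      moreover have "u (sum s' B) = u (?e i) + (\<Sum>T\<in>B - {T}. u (s T))"
        using finite_B T by (simp add: linear_add[OF u] linear_sum[OF u] sum.remove[of B T] s'_def)
      moreover have "m = u (s T) + (\<Sum>T\<in>B - {T}. u (s T))"
        using finite_B T s(1) x(2) by (simp add: linear_add[OF u] linear_sum[OF u] sum.remove[of B T])
      ultimately show ?thesis by simp
    qed
    have z: "coord_sum S (s T) = 0" if T: "T \<in> B" "\<not> T \<subseteq> S" for T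
    proof -
      have sT: "s T \<in> std_simplex T" "finite T" using s(2) T(1) memD(3) by blast+
      then have k: "Poly_Mapping.keys (s T) \<subseteq> T" "\<forall>i. 0 \<le> Poly_Mapping.lookup (s T) i"
        using simplex_iff[of T "s T"] by auto
      have "Poly_Mapping.lookup (s T) i = 0" if i: "i \<in> S" for i
      proof (cases "i \<in> T")
        case True
        then have "S \<union> T \<in> B" using union_mem S(1) T(1) i by blast
        then have "\<not> T \<subseteq> U" using max[of "S \<union> T"] S T by blast
        \<comment> \<open>The label \<open>j\<close> shows that the least value of \<open>u\<close>
          on the simplex of \<open>T\<close> is \<mu>; the weight of \<open>s T\<close> therefore
          sits on labels of value \<mu>, none of which is in \<open>U\<close>.\<close>
        then obtain j where j: "j \<in> T" "u (?e j) \<le> \<mu>" using memD(1)[OF T(1)] by (force simp: U_def)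
        have "(\<Sum>i\<in>T. Poly_Mapping.lookup (s T) i * (u (?e i) - \<mu>)) \<le> 0"
          unfolding dev[OF sT(1) T(1)] using le[OF T(1) j(1)] j(2) by linarith
        moreover have nn: "0 \<le> Poly_Mapping.lookup (s T) i * (u (?e i) - \<mu>)" if "i \<in> T" for i
          using k \<mu>[of i] that memD(1)[OF T(1)] by auto
        ultimately have "(\<Sum>i\<in>T. Poly_Mapping.lookup (s T) i * (u (?e i) - \<mu>)) = 0"
          by (intro antisym sum_nonneg)
        then have "Poly_Mapping.lookup (s T) i * (u (?e i) - \<mu>) = 0"
          using sum_nonneg_0[OF sT(2), of "\<lambda>i. Poly_Mapping.lookup (s T) i * (u (?e i) - \<mu>)" i] nn True
          by simp
        moreover have "u (?e i) - \<mu> \<noteq> 0" using i S by (auto simp: U_def)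
        ultimately show ?thesis by simp
      next
        case False
        then show ?thesis using k by (auto simp: in_keys_iff)
      qed
      then show ?thesis by (simp add: coord_sum_def)
    qed
    have "\<forall>T\<in>B. s T \<in> std_simplex (cut S T)"
      using s(2) z simplex_Diff_iff[OF memD(3) fS] by (auto simp: cut_def)
    then show "x \<in> nest_face S" unfolding s(1) using nest_face_sum_iff[OF fS s(2)] by blast
  qed
  moreover have SV: "S \<noteq> V" using S UV by blast
  ultimately have "nest_face S = F"
    using facet_maximal[OF polytope_nestohedron F nest_face_face[OF fS]]
      facet_neq[OF nest_face_facet[OF S(1) SV]] by blast
  then show ?thesis using S SV by blast
qed

lemma facets_nestohedron: "facets (nestohedron B) = nest_face ` (B - {V})"
  using facet_is_nest_face nest_face_facet by blast

section \<open>Distinctness of the facets, simplicity, and the boundary formula\<close>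

lemma nest_face_subset:
  assumes S: "S \<in> B" "S \<noteq> V" and S': "S' \<in> B" "S' \<noteq> V" and sub: "nest_face S \<subseteq> nest_face S'"
  shows "S' \<subseteq> S"
proof
  fix k assume k: "k \<in> S'"
  show "k \<in> S"
  proof (rule ccontr)
    assume nk: "k \<notin> S"
    \<comment> \<open>The summand at \<open>V\<close> is put on the vertex \<open>k\<close>, every
      other on some admissible vertex. This gives a point of \<open>nest_face S\<close> whose
      summand at \<open>V\<close> has weight 1 in \<open>S'\<close>, where
      \<open>nest_face S'\<close> demands 0.\<close>
    define s where "s T = (Poly_Mapping.single (if T = V then k else (SOME i. i \<in> cut S T)) 1 :: point)" for T
    have fin: "finite S" "finite S'" using memD S S' by auto
    have kV: "k \<in> V" using k S' memD by blast
    have VS: "\<not> V \<subseteq> S" using S memD by blast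
    have "s T \<in> std_simplex (cut S T)" if T: "T \<in> B" for T
    proof -
      have "cut S T \<noteq> {}" using memD(2)[OF T] by (auto simp: cut_def)
      moreover have "k \<in> cut S V" using kV nk VS by (simp add: cut_def)
      ultimately show ?thesis unfolding s_def by (intro vertex_in_simplex) (auto simp: some_in_eq)
    qed
    then have s: "\<forall>T\<in>B. s T \<in> std_simplex (cut S T)" by blast
    then have s': "\<forall>T\<in>B. s T \<in> std_simplex T" using cut_simplex(1)[OF fin(1)] by blast
    have "sum s B \<in> nest_face S'" using s sub nest_face_sum_iff[OF fin(1) s'] by blast
    then have "s V \<in> std_simplex (cut S' V)" using nest_face_sum_iff[OF fin(2) s'] V_mem by blast
    then have "coord_sum S' (s V) = (if V \<subseteq> S' then 1 else 0)" "s V \<in> std_simplex V"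
      using cut_simplex(1)[OF fin(2) V_mem] by auto
    moreover have "coord_sum S' (s V) = 1"
      using k fin by (simp add: s_def coord_sum_def lookup_single when_def)
    ultimately have "V \<subseteq> S'" by (simp split: if_splits)
    then show False using memD(1) S' by blast
  qed
qed

lemma inj_on_nest_face: "inj_on nest_face (B - {V})"
proof (rule inj_onI)
  fix S S' assume "S \<in> B - {V}" "S' \<in> B - {V}" "nest_face S = nest_face S'"
  then show "S = S'" using nest_face_subset[of S S'] nest_face_subset[of S' S] by auto
qed

text \<open>For a fixed decomposition of \<open>v\<close>, each member \<open>S\<close> whose facet
  contains \<open>v\<close>, and \<open>V\<close> itself, selects a label \<open>f S\<close>
  carrying weight in its own summand. These labels are distinct, so at most
  \<open>card V - 1\<close> facets meet at \<open>v\<close>.\<close>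

theorem simple_nestohedron: "simple_polytope (nestohedron B)"
  unfolding simple_polytope_def
proof (intro conjI allI impI)
  fix v assume v: "v extreme_point_of nestohedron B"
  then have "v \<in> nestohedron B" by (simp add: extreme_point_of_def)
  then obtain s where s: "v = sum s B" "\<forall>T\<in>B. s T \<in> std_simplex T" using nestohedron_iff by blast
  define M where "M = {S \<in> B - {V}. v \<in> nest_face S}"
  have fM: "finite M" using finite_B by (simp add: M_def)
  have "{F \<in> facets (nestohedron B). v \<in> F} = nest_face ` M"
    unfolding facets_nestohedron M_def by blast
  then have c: "card {F \<in> facets (nestohedron B). v \<in> F} = card M"
    using card_image[OF inj_on_subset[OF inj_on_nest_face, of M]] by (auto simp: M_def)
  define f where "f S = (SOME i. i \<in> S \<and> Poly_Mapping.lookup (s S) i \<noteq> 0)" for S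
  have f: "f S \<in> S" "Poly_Mapping.lookup (s S) (f S) \<noteq> 0" if S: "S \<in> B" for S
  proof -
    have "coord_sum S (s S) = 1" using s(2) S simplex_iff[OF memD(3)[OF S], of "s S"] by simp
    then have "\<exists>i. i \<in> S \<and> Poly_Mapping.lookup (s S) i \<noteq> 0"
      unfolding coord_sum_def by (metis sum.neutral zero_neq_one)
    from someI_ex[OF this] show "f S \<in> S" "Poly_Mapping.lookup (s S) (f S) \<noteq> 0"
      by (auto simp: f_def)
  qed
  \<comment> \<open>If \<open>S\<close> is not inside \<open>S'\<close>, then
    \<open>v \<in> nest_face S'\<close> clears the summand of \<open>S\<close> from the labels in
    \<open>S'\<close>, so \<open>f S\<close> is outside \<open>S'\<close> while \<open>f S'\<close>
    is inside.\<close>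
  have sub: "S \<subseteq> S'" if h: "S \<in> insert V M" "S' \<in> insert V M" "f S = f S'" for S S'
  proof (rule ccontr)
    assume ns: "\<not> S \<subseteq> S'"
    have SB: "S \<in> B" "S' \<in> B" using h V_mem by (auto simp: M_def)
    have "S' \<noteq> V" using ns memD(1)[OF SB(1)] by blast
    then have "sum s B \<in> nest_face S'" using h s(1) by (auto simp: M_def)
    then have "s S \<in> std_simplex (cut S' S)"
      using nest_face_sum_iff[OF memD(3)[OF SB(2)] s(2)] SB(1) by blast
    then have "Poly_Mapping.keys (s S) \<subseteq> S - S'"
      using ns simplex_iff[of "S - S'"] memD(3)[OF SB(1)] by (simp add: cut_def)
    then show False using f[OF SB(1)] f[OF SB(2)] h(3) by (auto simp: in_keys_iff)
  qed
  have "inj_on f (insert V M)" using sub by (intro inj_onI) (simp add: subset_antisym)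
  moreover have "f ` insert V M \<subseteq> V"
    using f(1) memD(1) V_mem by (auto simp: M_def)
  ultimately have "card (insert V M) \<le> card V" using finite_V by (rule card_inj_on_le)
  moreover have "V \<notin> M" by (simp add: M_def)
  ultimately have "card M \<le> pdim (nestohedron B)" using fM pdim_nestohedron by simp
  then show "card {F \<in> facets (nestohedron B). v \<in> F} = pdim (nestohedron B)"
    using card_facets_extreme_point_ge[OF polytope_nestohedron v] c by simp
qed (rule polytope_nestohedron nestohedron_nonempty)+

lemma connected_building_restrict:
  assumes S: "S \<in> B" shows "connected_building S (restrict_to B S)"
proof
  show "finite S" using memD S by blast
  show "S \<in> restrict_to B S" using S by (simp add: restrict_to_def)
  show "building_set S (restrict_to B S)"
    using building S memD(1)[OF S] by (auto simp: building_set_def restrict_to_def)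
qed

lemma connected_building_contract:
  assumes S: "S \<in> B" "S \<noteq> V" shows "connected_building (V - S) (contract B S)"
proof
  have SV: "\<not> V \<subseteq> S" using S memD by blast
  show "finite (V - S)" using finite_V by blast
  show "V - S \<in> contract B S" using V_mem SV by (auto simp: contract_def)
  show "building_set (V - S) (contract B S)"
    unfolding building_set_def
  proof (intro conjI ballI impI)
    show "contract B S \<subseteq> Pow (V - S)" using memD(1) by (auto simp: contract_def)
    show "{} \<notin> contract B S" by (auto simp: contract_def)
    show "{i} \<in> contract B S" if "i \<in> V - S" for i
      unfolding contract_def using that singleton_mem[of i] by (intro image_eqI[of _ _ "{i}"]) auto
    fix X Y assume XY: "X \<in> contract B S" "Y \<in> contract B S" "X \<inter> Y \<noteq> {}"
    obtain T where T: "T \<in> B" "X = T - S" using XY by (auto simp: contract_def)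
    obtain R where R: "R \<in> B" "Y = R - S" using XY by (auto simp: contract_def)
    have "T \<union> R \<in> B" using union_mem[OF T(1) R(1)] XY(3) T R by blast
    moreover have "X \<union> Y = (T \<union> R) - S" "\<not> T \<union> R \<subseteq> S" using T R XY(3) by blast+
    ultimately show "X \<union> Y \<in> contract B S" unfolding contract_def by blast
  qed
qed

lemma type_of_nest_face:
  assumes S: "S \<in> B" "S \<noteq> V"
  shows "type_of (nest_face S) =
    type_of (nestohedron (restrict_to B S)) + type_of (nestohedron (contract B S))"
proof -
  interpret r: connected_building S "restrict_to B S" by (rule connected_building_restrict[OF S(1)])
  interpret c: connected_building "V - S" "contract B S" by (rule connected_building_contract[OF S])
  have "comb_equiv (nest_face S) (nestohedron (restrict_to B S) \<times> nestohedron (contract B S))"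
    using comb_equiv_trans[OF comb_equiv_nest_face
        comb_equiv_Times[OF comb_equiv_refl comb_equiv_upper]] memD(3)[OF S(1)]
    by (simp add: lower_eq)
  then show ?thesis
    using simple_polytope_facet[OF simple_nestohedron nest_face_facet[OF S]]
      r.simple_nestohedron c.simple_nestohedron by (intro type_of_Times)
qed

theorem bd_nestohedron:
  "bd (class_of (type_of (nestohedron B))) =
    (\<Sum>S\<in>B - {V}. class_of (type_of (nestohedron (restrict_to B S))) *
      class_of (type_of (nestohedron (contract B S))))"
proof -
  have "bd (class_of (type_of (nestohedron B))) = (\<Sum>F\<in>nest_face ` (B - {V}). class_of (type_of F))"
    by (simp add: bd_class facet_sum_type_of[OF simple_nestohedron] facets_nestohedron)
  also have "\<dots> = (\<Sum>S\<in>B - {V}. class_of (type_of (nest_face S)))"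
    by (simp add: sum.reindex[OF inj_on_nest_face])
  finally show ?thesis
    by (simp only: class_of_add[symmetric])
      (rule sum.cong[OF refl], simp add: type_of_nest_face)
qed

end

section \<open>Relabelling\<close>

text \<open>A vertex \<open>v\<close> of \<open>T\<close> corresponds to a nonempty face
  \<open>E\<close> of \<open>S\<close>. A vertex \<open>w\<close> of \<open>E\<close> gives a face
  \<open>{w}\<close> mapped to a nonempty subset of \<open>{v}\<close>, so the facets through
  \<open>w\<close> and through \<open>v\<close> correspond.\<close>

lemma simple_polytope_comb_equiv:
  assumes S: "simple_polytope S" and T: "polytope T" "T \<noteq> {}" and eq: "comb_equiv S T"
  shows "simple_polytope T"
proof -
  obtain \<phi> where iso: "face_iso \<phi> S T" using eq by (auto simp: comb_equiv_iff_face_iso)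
  note PS = simple_polytopeD[OF S]
  have "card {G \<in> facets T. v \<in> G} = pdim T" if v: "v extreme_point_of T" for v
  proof -
    obtain E where E: "E face_of S" "\<phi> E = {v}"
      using face_iso_surj[OF iso extreme_point_imp_face[OF v]] by blast
    have "E \<noteq> {}" using E face_iso_empty[OF iso] by auto
    then obtain w where w: "w extreme_point_of E"
      using polytope_extreme_point_exists[OF polytope_face[OF PS(1) E(1)]] by blast
    have wS: "{w} face_of S" using face_of_trans[OF extreme_point_imp_face[OF w] E(1)] .
    have "w \<in> E" using w by (simp add: extreme_point_of_def)
    then have "\<phi> {w} \<subseteq> {v}" using face_iso_mono[OF iso wS E(1)] E by simp
    moreover have "\<phi> {w} \<noteq> {}"
      using face_iso_eq[OF iso wS empty_face_of] face_iso_empty[OF iso] by simp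
    ultimately have pw: "\<phi> {w} = {v}" by blast
    note bij = face_iso_facets[OF iso PS(1) T(1)]
    have mem: "v \<in> \<phi> F \<longleftrightarrow> w \<in> F" if "F \<in> facets S" for F
      using face_iso_mono[OF iso wS, of F] that pw by (simp add: facets_def)
    have im: "\<phi> ` facets S = facets T" using bij by (simp add: bij_betw_def)
    have "\<phi> ` {F \<in> facets S. w \<in> F} = {G \<in> facets T. v \<in> G}"
    proof (intro equalityI subsetI)
      fix G assume G: "G \<in> {G \<in> facets T. v \<in> G}"
      then obtain F where "F \<in> facets S" "G = \<phi> F" using im by blast
      then show "G \<in> \<phi> ` {F \<in> facets S. w \<in> F}" using G mem by auto
    qed (use im mem in auto)
    moreover have "inj_on \<phi> {F \<in> facets S. w \<in> F}"
      using bij by (auto simp: bij_betw_def intro: inj_on_subset)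
    ultimately have "card {G \<in> facets T. v \<in> G} = card {F \<in> facets S. w \<in> F}"
      using card_image by metis
    also have "\<dots> = pdim S" using S wS by (simp add: simple_polytope_def face_of_singleton)
    also have "\<dots> = pdim T" by (rule face_iso_pdim[OF iso PS(1) T(1) PS(2) T(2)])
    finally show ?thesis .
  qed
  then show ?thesis using T by (simp add: simple_polytope_def)
qed

lemma type_of_linear_image:
  assumes "simple_polytope S" "linear f" "inj_on f S"
  shows "type_of (f ` S) = type_of S"
proof -
  note S = simple_polytopeD[OF assms(1)]
  have eq: "comb_equiv S (f ` S)"
    using comb_equiv_linear_image_inj_on[OF assms(2,3) polytope_imp_convex[OF S(1)]] .
  have "simple_polytope (f ` S)"
    using simple_polytope_comb_equiv[OF assms(1) polytope_linear_image[OF assms(2) S(1)] _ eq] S(2) by simp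
  then show ?thesis using type_of_eqI[OF assms(1) _ eq] by simp
qed

lemma linear_image_set_plus:
  assumes "linear f" shows "f ` (A + B) = f ` A + f ` B"
proof (intro equalityI subsetI)
  fix x assume "x \<in> f ` A + f ` B"
  then obtain a b where "a \<in> A" "b \<in> B" "x = f (a + b)"
    by (auto elim!: set_plus_elim simp: linear_add[OF assms])
  then show "x \<in> f ` (A + B)" by blast
next
  fix x assume "x \<in> f ` (A + B)"
  then obtain a b where "a \<in> A" "b \<in> B" "x = f a + f b"
    by (auto elim!: set_plus_elim simp: linear_add[OF assms])
  then show "x \<in> f ` A + f ` B" by (simp add: set_plus_intro)
qed

lemma linear_image_set_sum:
  assumes "linear f" "finite I" shows "f ` (\<Sum>i\<in>I. K i) = (\<Sum>i\<in>I. f ` K i)"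
  using assms(2)
proof (induction I rule: finite_induct)
  case empty
  show ?case by (simp add: linear_0[OF assms(1)])
next
  case (insert i I)
  then show ?case by (simp add: linear_image_set_plus[OF assms(1)])
qed

text \<open>The relabelling is realised by a linear map that forgets the coordinates outside
  \<open>V\<close>; it is injective on points supported on \<open>V\<close>, which suffices.\<close>

lemma (in connected_building) type_of_relabel:
  assumes inj: "inj_on \<sigma> V"
  shows "type_of (nestohedron (image \<sigma> ` B)) = type_of (nestohedron B)"
proof -
  define f where "f x = (\<Sum>i\<in>V. Poly_Mapping.lookup x i *\<^sub>R Poly_Mapping.single (\<sigma> i) 1 :: point)" for x :: point
  have lin: "linear f"
    by (rule linearI)
      (simp_all add: f_def lookup_add lookup_scaleR_point scaleR_left_distrib sum.distrib scaleR_sum_right)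
  have look: "Poly_Mapping.lookup (f x) (\<sigma> i) = Poly_Mapping.lookup x i" if i: "i \<in> V" for x i
  proof -
    have "Poly_Mapping.lookup (f x) (\<sigma> i) = (\<Sum>j\<in>V. if j = i then Poly_Mapping.lookup x j else 0)"
      unfolding f_def lookup_sum using inj i
      by (intro sum.cong refl) (auto simp: lookup_scaleR_point lookup_single when_def inj_on_def)
    then show ?thesis using i finite_V by simp
  qed
  have "inj_on f (nestohedron B)"
  proof (rule inj_onI)
    fix x y assume h: "x \<in> nestohedron B" "y \<in> nestohedron B" "f x = f y"
    have k: "Poly_Mapping.keys x \<subseteq> V" "Poly_Mapping.keys y \<subseteq> V"
      using simplex_sum_keys(1)[OF finite_V finite_B, of "\<lambda>T. T"] memD(1) h(1,2)
      by (auto simp: nestohedron_simplex)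
    show "x = y"
    proof (rule poly_mapping_eqI)
      fix i show "Poly_Mapping.lookup x i = Poly_Mapping.lookup y i"
      proof (cases "i \<in> V")
        case True
        then show ?thesis using look[of i x] look[of i y] h(3) by simp
      next
        case False
        then have "i \<notin> Poly_Mapping.keys x" "i \<notin> Poly_Mapping.keys y" using k by auto
        then show ?thesis by (simp add: in_keys_iff)
      qed
    qed
  qed
  moreover have "f ` nestohedron B = nestohedron (image \<sigma> ` B)"
  proof -
    have e: "f (Poly_Mapping.single i 1) = Poly_Mapping.single (\<sigma> i) 1" if "i \<in> V" for i
    proof -
      have "f (Poly_Mapping.single i 1) =
          (\<Sum>j\<in>V. if j = i then (Poly_Mapping.single (\<sigma> j) 1 :: point) else 0)"
        unfolding f_def by (intro sum.cong refl) (auto simp: lookup_single when_def)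
      then show ?thesis using that finite_V by simp
    qed
    have "f ` std_simplex T = std_simplex (\<sigma> ` T)" if "T \<in> B" for T
    proof -
      have "f ` (\<lambda>i. Poly_Mapping.single i 1) ` T = (\<lambda>i. Poly_Mapping.single i 1) ` \<sigma> ` T"
        using e memD(1)[OF that] by (auto simp: image_image intro!: image_cong)
      then show ?thesis unfolding std_simplex_def convex_hull_linear_image[OF lin] by simp
    qed
    then have "f ` nestohedron B = (\<Sum>T\<in>B. std_simplex (\<sigma> ` T))"
      unfolding nestohedron_simplex linear_image_set_sum[OF lin finite_B] by (intro sum.cong) auto
    also have "\<dots> = nestohedron (image \<sigma> ` B)"
    proof -
      have "inj_on (image \<sigma>) B"
        using inj_on_image_Pow[OF inj] memD(1) by (auto intro: inj_on_subset)
      then show ?thesis unfolding nestohedron_simplex by (simp add: sum.reindex)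
    qed
    finally show ?thesis .
  qed
  ultimately show ?thesis using type_of_linear_image[OF simple_nestohedron lin] by metis
qed

text \<open>Relabelling has to send marked vertices to marked vertices; the others may be matched
  arbitrarily.\<close>

lemma ex_bij_betw_prescribed:
  assumes "finite A" "card A = card A'" "finite A'" "length xs = length ys"
    "distinct xs" "distinct ys" "set xs \<subseteq> A" "set ys \<subseteq> A'"
  shows "\<exists>\<sigma>. bij_betw \<sigma> A A' \<and> map \<sigma> xs = ys"
  using assms
proof (induction xs arbitrary: A A' ys)
  case Nil
  then show ?case using finite_same_card_bij by auto
next
  case (Cons x xs)
  then obtain y ys' where ys: "ys = y # ys'" by (cases ys) auto
  have "\<exists>\<sigma>. bij_betw \<sigma> (A - {x}) (A' - {y}) \<and> map \<sigma> xs = ys'"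
    using Cons.prems unfolding ys by (intro Cons.IH) auto
  then obtain \<sigma> where \<sigma>: "bij_betw \<sigma> (A - {x}) (A' - {y})" "map \<sigma> xs = ys'" by blast
  have "bij_betw (\<sigma>(x := y)) (A - {x}) (A' - {y})"
    using \<sigma>(1) by (subst bij_betw_cong[where g = \<sigma>]) auto
  then have "bij_betw (\<sigma>(x := y)) (A - {x} \<union> {x}) (A' - {y} \<union> {y})"
    by (rule bij_betw_combine) auto
  moreover have "A - {x} \<union> {x} = A" "A' - {y} \<union> {y} = A'" using Cons.prems ys by auto
  ultimately have "bij_betw (\<sigma>(x := y)) A A'" by simp
  moreover have "map (\<sigma>(x := y)) (x # xs) = ys"
    using \<sigma>(2) Cons.prems ys by (auto cong: map_cong)
  ultimately show ?case by blast
qed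

section \<open>The four families of building sets\<close>

text \<open>The ground set, and below the marked vertices, are parameters because restriction and
  contraction leave \<open>{1..n + 1}\<close>; relabelling recovers the type from the
  cardinality.\<close>

definition Pe_bs :: "nat set \<Rightarrow> nat set set" where
  "Pe_bs V = {S. S \<noteq> {} \<and> S \<subseteq> V}"

definition St_bs :: "nat \<Rightarrow> nat set \<Rightarrow> nat set set" where
  "St_bs a V = {S. S \<noteq> {} \<and> S \<subseteq> V \<and> (a \<in> S \<or> (\<exists>i. S = {i}))}"

text \<open>\<open>a\<close> and \<open>b\<close> stand for 1 and n + 1 in
  \<open>B_Gamma\<close>.\<close>

definition Gamma_bs :: "nat \<Rightarrow> nat \<Rightarrow> nat set \<Rightarrow> nat set set" where
  "Gamma_bs a b V = {S. S \<noteq> {} \<and> S \<subseteq> V \<and> ((b \<in> S \<longrightarrow> a \<in> S) \<or> (\<exists>i. S = {i}))}"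

text \<open>\<open>a\<close>, \<open>b\<close>, \<open>c\<close> stand for 1, 2, n + 1 in
  \<open>B_Mas\<close>: the star at \<open>a\<close>, subject to the condition on \<open>c\<close>
  and \<open>b\<close> that defines \<open>Gamma_bs b c\<close>.\<close>

definition Mas_bs :: "nat \<Rightarrow> nat \<Rightarrow> nat \<Rightarrow> nat set \<Rightarrow> nat set set" where
  "Mas_bs a b c V = {S. S \<noteq> {} \<and> S \<subseteq> V \<and> (a \<in> S \<and> (c \<in> S \<longrightarrow> b \<in> S) \<or> (\<exists>i. S = {i}))}"

lemma connected_buildingI:
  assumes "finite V" "V \<noteq> {}" "P V" "\<And>i. P {i}"
    "\<And>S T. P S \<Longrightarrow> P T \<Longrightarrow> S \<inter> T \<noteq> {} \<Longrightarrow> P (S \<union> T)"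
  shows "connected_building V {S. S \<noteq> {} \<and> S \<subseteq> V \<and> P S}"
  using assms by unfold_locales (auto simp: building_set_def)

lemma connected_building_Pe: "finite V \<Longrightarrow> V \<noteq> {} \<Longrightarrow> connected_building V (Pe_bs V)"
  using connected_buildingI[of V "\<lambda>_. True"] by (simp add: Pe_bs_def)

lemma connected_building_St: "finite V \<Longrightarrow> a \<in> V \<Longrightarrow> connected_building V (St_bs a V)"
  unfolding St_bs_def by (rule connected_buildingI) (auto simp: insert_absorb)

lemma connected_building_Gamma: "finite V \<Longrightarrow> a \<in> V \<Longrightarrow> connected_building V (Gamma_bs a b V)"
  unfolding Gamma_bs_def by (rule connected_buildingI) (auto simp: insert_absorb)

lemma connected_building_Mas:
  "finite V \<Longrightarrow> a \<in> V \<Longrightarrow> b \<in> V \<Longrightarrow> connected_building V (Mas_bs a b c V)"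
  unfolding Mas_bs_def by (rule connected_buildingI) (auto simp: insert_absorb)

lemma image_building:
  assumes "inj_on \<sigma> V" "\<And>S. S \<subseteq> V \<Longrightarrow> P S \<longleftrightarrow> P' (\<sigma> ` S)"
  shows "image \<sigma> ` {S. S \<noteq> {} \<and> S \<subseteq> V \<and> P S} = {S. S \<noteq> {} \<and> S \<subseteq> \<sigma> ` V \<and> P' S}"
proof (intro equalityI subsetI)
  fix S assume "S \<in> {S. S \<noteq> {} \<and> S \<subseteq> \<sigma> ` V \<and> P' S}"
  then obtain R where "R \<subseteq> V" "S = \<sigma> ` R" "S \<noteq> {}" "P' S" by (auto simp: subset_image_iff)
  then show "S \<in> image \<sigma> ` {S. S \<noteq> {} \<and> S \<subseteq> V \<and> P S}" using assms(2) by auto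
qed (use assms(2) in auto)

lemma image_singleton_iff:
  assumes "inj_on \<sigma> V" "S \<subseteq> V" shows "(\<exists>i. \<sigma> ` S = {i}) \<longleftrightarrow> (\<exists>i. S = {i})"
proof
  assume "\<exists>i. \<sigma> ` S = {i}"
  then obtain i where i: "\<sigma> ` S = {i}" by blast
  then obtain j where j: "j \<in> S" by blast
  have "x = j" if "x \<in> S" for x
  proof (rule inj_onD[OF assms(1)])
    show "\<sigma> x = \<sigma> j" using i that j by (metis imageI singletonD)
  qed (use that j assms(2) in auto)
  then have "S = {j}" using j by blast
  then show "\<exists>i. S = {i}" by blast
qed auto

lemma image_mem_iff:
  assumes "inj_on \<sigma> A" "i \<in> A" "\<sigma> i = a" "S \<subseteq> A" shows "i \<in> S \<longleftrightarrow> a \<in> \<sigma> ` S"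
  using inj_on_image_mem_iff[OF assms(1,2,4)] assms(3) by simp

section \<open>Identification with the four given families\<close>

lemma type_of_Pe_bs:
  assumes V: "finite V" "card V = n + 1" shows "type_of (nestohedron (Pe_bs V)) = Pe n"
proof -
  let ?A = "{1..n + 1}"
  interpret connected_building ?A "Pe_bs ?A"
    by (rule connected_building_Pe) auto
  obtain \<sigma> where \<sigma>: "bij_betw \<sigma> ?A V"
    using finite_same_card_bij[of ?A V] V by auto
  then have inj: "inj_on \<sigma> ?A" and im: "\<sigma> ` ?A = V" by (auto simp: bij_betw_def)
  have "graphical ?A (complete_graph ?A) = Pe_bs ?A"
  proof -
    have "(u, v) \<in> (complete_graph ?A \<inter> S \<times> S)\<^sup>*" if "S \<subseteq> ?A" "u \<in> S" "v \<in> S" for S u v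
    proof (cases "u = v")
      case False
      then show ?thesis using that by (intro r_into_rtrancl) (auto simp: complete_graph_def)
    qed simp
    then show ?thesis by (auto simp: graphical_def Pe_bs_def)
  qed
  moreover have "image \<sigma> ` Pe_bs ?A = Pe_bs V"
    using image_building[OF inj, of "\<lambda>_. True" "\<lambda>_. True"] im by (simp add: Pe_bs_def)
  ultimately show ?thesis using type_of_relabel[OF inj] by (simp add: Pe_def)
qed

lemma type_of_St_bs:
  assumes V: "finite V" "card V = n + 1" "a \<in> V"
  shows "type_of (nestohedron (St_bs a V)) = St n"
proof -
  let ?A = "{1..n + 1}"
  interpret connected_building ?A "St_bs 1 ?A"
    by (rule connected_building_St) auto
  obtain \<sigma> where \<sigma>: "bij_betw \<sigma> ?A V" "map \<sigma> [1] = [a]"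
    using ex_bij_betw_prescribed[of ?A V "[1]" "[a]"] V by auto
  then have inj: "inj_on \<sigma> ?A" and im: "\<sigma> ` ?A = V" and a: "\<sigma> 1 = a" by (auto simp: bij_betw_def)
  have "graphical ?A (star_graph 1 ?A) = St_bs 1 ?A"
  proof (intro equalityI subsetI)
    fix S assume S: "S \<in> graphical ?A (star_graph 1 ?A)"
    then obtain u where u: "u \<in> S" by (auto simp: graphical_def)
    have "S = {u}" if n: "1 \<notin> S"
    proof -
      have e: "star_graph 1 ?A \<inter> S \<times> S = {}" using n by (auto simp: star_graph_def)
      have "v = u" if v: "v \<in> S" for v
      proof -
        have "(u, v) \<in> (star_graph 1 ?A \<inter> S \<times> S)\<^sup>*" using S u v unfolding graphical_def by blast
        then show ?thesis unfolding e by simp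
      qed
      then show ?thesis using u by blast
    qed
    then show "S \<in> St_bs 1 ?A" using S by (auto simp: graphical_def St_bs_def)
  next
    fix S assume S: "S \<in> St_bs 1 ?A"
    have "(u, v) \<in> (star_graph 1 ?A \<inter> S \<times> S)\<^sup>*" if uv: "u \<in> S" "v \<in> S" for u v
    proof (cases "1 \<in> S")
      case True
      have SA: "S \<subseteq> ?A" using S by (auto simp: St_bs_def)
      have "(u, 1) \<in> (star_graph 1 ?A \<inter> S \<times> S)\<^sup>*"
      proof (cases "u = 1")
        case False
        then show ?thesis using uv SA True by (intro r_into_rtrancl) (auto simp: star_graph_def)
      qed simp
      moreover have "(1, v) \<in> (star_graph 1 ?A \<inter> S \<times> S)\<^sup>*"
      proof (cases "v = 1")
        case False
        then show ?thesis using uv SA True by (intro r_into_rtrancl) (auto simp: star_graph_def)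
      qed simp
      ultimately show ?thesis by (rule rtrancl_trans)
    next
      case False
      then show ?thesis using S uv by (auto simp: St_bs_def)
    qed
    then show "S \<in> graphical ?A (star_graph 1 ?A)" using S by (auto simp: graphical_def St_bs_def)
  qed
  moreover have "image \<sigma> ` St_bs 1 ?A = St_bs a V"
    unfolding St_bs_def im[symmetric]
    using image_singleton_iff[OF inj] image_mem_iff[OF inj _ a]
    by (intro image_building[OF inj]) simp
  ultimately show ?thesis using type_of_relabel[OF inj] by (simp add: St_def)
qed

text \<open>\<open>P_Gamma\<close> is declared to be a segment in dimension one; this value must be
  matched with a nestohedron for the uniform description of facets to cover it.\<close>

lemma segment_type_eq: "segment_type = type_of (nestohedron (Pe_bs {1, 2}))"
proof -
  let ?e = "\<lambda>i. Poly_Mapping.single i 1 :: point"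
  let ?N = "nestohedron (Pe_bs {1, 2})"
  interpret connected_building "{1, 2}" "Pe_bs {1, 2}" by (rule connected_building_Pe) auto
  \<comment> \<open>The nestohedron is the segment from 2 e1 + e2 to e1 + 2 e2, and (2 x2 - x1) / 3
    takes the values 0 and 1 at these endpoints.\<close>
  define f where "f x = ((2 * Poly_Mapping.lookup x 2 - Poly_Mapping.lookup x 1) / 3) *\<^sub>R ?e 1" for x :: point
  have lin: "linear f"
    by (rule linearI) (simp_all add: f_def lookup_add lookup_scaleR_point add_divide_distrib
        diff_divide_distrib algebra_simps)
  have fe: "f (?e 1) = (- 1 / 3) *\<^sub>R ?e 1" "f (?e 2) = (2 / 3) *\<^sub>R ?e 1"
    by (simp_all add: f_def lookup_single)
  have "Pe_bs {1, 2} = {{1}, {2}, {1, 2}}" by (auto simp: Pe_bs_def)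
  then have N: "?N = {?e 1} + ({?e 2} + closed_segment (?e 1) (?e 2))"
    by (simp add: nestohedron_simplex std_simplex_def segment_convex_hull)
  have "f ` ?N = {f (?e 1)} + ({f (?e 2)} + closed_segment (f (?e 1)) (f (?e 2)))"
    unfolding N linear_image_set_plus[OF lin] closed_segment_linear_image[OF lin] by simp
  also have "\<dots> = {f (?e 1) + f (?e 2)} + closed_segment (f (?e 1)) (f (?e 2))"
    unfolding add.assoc[symmetric] by (simp add: set_plus_def)
  also have "\<dots> = closed_segment (f (?e 1) + f (?e 2) + f (?e 1)) (f (?e 1) + f (?e 2) + f (?e 2))"
    by (simp only: translation_eq_singleton_plus[symmetric] closed_segment_translation)
  also have "\<dots> = closed_segment 0 (?e 1)"
  proof -
    have "f (?e 1) + f (?e 2) + f (?e 1) = (- 1 / 3 + 2 / 3 + - 1 / 3) *\<^sub>R ?e 1"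
      "f (?e 1) + f (?e 2) + f (?e 2) = (- 1 / 3 + 2 / 3 + 2 / 3) *\<^sub>R ?e 1"
      unfolding fe by (simp_all only: scaleR_left_distrib)
    then show ?thesis by simp
  qed
  finally have "f ` ?N = closed_segment 0 (?e 1)" .
  moreover have "inj_on f ?N"
  proof (rule inj_onI)
    fix x y assume h: "x \<in> ?N" "y \<in> ?N" "f x = f y"
    have k: "Poly_Mapping.keys z \<subseteq> {1, 2} \<and> coord_sum {1, 2} z = card (Pe_bs {1, 2})" if "z \<in> ?N" for z
      using simplex_sum_keys[OF finite_V finite_B, of "\<lambda>T. T"] memD(1) that
      by (auto simp: nestohedron_simplex)
    have s: "Poly_Mapping.lookup x 1 + Poly_Mapping.lookup x 2 = Poly_Mapping.lookup y 1 + Poly_Mapping.lookup y 2"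
      using k[OF h(1)] k[OF h(2)] by (simp add: coord_sum_def)
    have d: "2 * Poly_Mapping.lookup x 2 - Poly_Mapping.lookup x 1 =
        2 * Poly_Mapping.lookup y 2 - Poly_Mapping.lookup y 1"
      using arg_cong[OF h(3), of "\<lambda>z. Poly_Mapping.lookup z 1"]
      by (simp add: f_def lookup_scaleR_point lookup_single)
    show "x = y"
    proof (rule poly_mapping_eqI)
      fix i :: nat
      consider "i = 1" | "i = 2" | "i \<notin> {1, 2}" by auto
      then show "Poly_Mapping.lookup x i = Poly_Mapping.lookup y i"
      proof cases
        case 3
        then have "i \<notin> Poly_Mapping.keys x" "i \<notin> Poly_Mapping.keys y" using k[OF h(1)] k[OF h(2)] by auto
        then show ?thesis by (simp add: in_keys_iff)
      qed (use s d in auto)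
    qed
  qed
  ultimately show ?thesis
    unfolding segment_type_def using type_of_linear_image[OF simple_nestohedron lin] by metis
qed

lemma singleton_iff_card_less_2:
  assumes "finite S" "S \<noteq> {}" shows "(\<exists>i. S = {i}) \<longleftrightarrow> card S < 2"
proof -
  have "card S < 2 \<longleftrightarrow> card S = 1" using assms by (auto simp: card_gt_0_iff less_2_cases_iff)
  then show ?thesis by (simp add: card_1_singleton_iff)
qed

lemma B_Gamma_eq:
  assumes "1 \<le> n" shows "B_Gamma n = Gamma_bs 1 (n + 1) {1..n + 1}"
proof (intro equalityI subsetI)
  fix S assume "S \<in> B_Gamma n"
  then show "S \<in> Gamma_bs 1 (n + 1) {1..n + 1}"
    using assms by (auto simp: B_Gamma_def Gamma_bs_def singletons_def subset_iff; fastforce)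
next
  fix S assume "S \<in> Gamma_bs 1 (n + 1) {1..n + 1}"
  then have S: "S \<noteq> {}" "S \<subseteq> {1..n + 1}" "(n + 1 \<in> S \<longrightarrow> 1 \<in> S) \<or> (\<exists>i. S = {i})"
    by (auto simp: Gamma_bs_def)
  have fin: "finite S" using S(2) finite_subset by blast
  have ns: "2 \<le> card S" if "\<not> (\<exists>i. S = {i})"
    using that singleton_iff_card_less_2[OF fin S(1)] by (simp add: not_less)
  consider "\<exists>i. S = {i}" | "n + 1 \<notin> S" "2 \<le> card S" | "n + 1 \<in> S" "1 \<in> S"
    using S(3) ns by blast
  then show "S \<in> B_Gamma n"
  proof cases
    case 1
    then show ?thesis using S by (auto simp: B_Gamma_def singletons_def)
  next
    case 2
    then have "S \<subseteq> {1..n}" using S(2) by (auto simp: subset_iff le_Suc_eq)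
    then show ?thesis using 2 by (simp add: B_Gamma_def)
  next
    case 3
    then have "S = {1, n + 1} \<union> (S - {1, n + 1})" "S - {1, n + 1} \<subseteq> {2..n}"
      using S(2) by (auto simp: subset_iff le_Suc_eq Suc_le_eq)
    then show ?thesis unfolding B_Gamma_def by blast
  qed
qed

lemma type_of_Gamma_bs:
  assumes V: "finite V" "card V = n + 1" "a \<in> V" "b \<in> V" "a \<noteq> b"
  shows "type_of (nestohedron (Gamma_bs a b V)) = P_Gamma n"
proof -
  let ?A = "{1..n + 1}"
  have n: "1 \<le> n"
    using V card_mono[of V "{a, b}"] by auto
  interpret connected_building ?A "Gamma_bs 1 (n + 1) ?A"
    by (rule connected_building_Gamma) auto
  obtain \<sigma> where \<sigma>: "bij_betw \<sigma> ?A V" "map \<sigma> [1, n + 1] = [a, b]"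
    using ex_bij_betw_prescribed[of ?A V "[1, n + 1]" "[a, b]"] V n by auto
  then have inj: "inj_on \<sigma> ?A" and im: "\<sigma> ` ?A = V" and ab: "\<sigma> 1 = a" "\<sigma> (n + 1) = b"
    by (auto simp: bij_betw_def)
  have "image \<sigma> ` Gamma_bs 1 (n + 1) ?A = Gamma_bs a b V"
    unfolding Gamma_bs_def im[symmetric]
    using image_singleton_iff[OF inj] image_mem_iff[OF inj _ ab(1)] image_mem_iff[OF inj _ ab(2)]
    by (intro image_building[OF inj]) simp
  then have "type_of (nestohedron (Gamma_bs a b V)) = type_of (nestohedron (Gamma_bs 1 (n + 1) ?A))"
    using type_of_relabel[OF inj] by simp
  also have "\<dots> = P_Gamma n"
  proof (cases "n = 1")
    case True
    have "Gamma_bs 1 2 {1, 2} = Pe_bs {1, 2}"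
    proof (intro equalityI subsetI)
      fix S :: "nat set" assume S: "S \<in> Pe_bs {1, 2}"
      have "S = {2}" if "1 \<notin> S" using S that unfolding Pe_bs_def by blast
      then show "S \<in> Gamma_bs 1 2 {1, 2}" using S unfolding Gamma_bs_def Pe_bs_def by blast
    qed (simp add: Gamma_bs_def Pe_bs_def)
    moreover have "?A = {1, 2}" "n + 1 = 2" using True by auto
    moreover have "P_Gamma n = segment_type" using True by (simp add: P_Gamma_def)
    ultimately show ?thesis by (simp only: segment_type_eq)
  next
    case False
    then show ?thesis using n B_Gamma_eq[OF n] by (simp add: P_Gamma_def)
  qed
  finally show ?thesis .
qed

lemma B_Mas_eq:
  assumes "2 \<le> n" shows "B_Mas n = Mas_bs 1 2 (n + 1) {1..n + 1}"
proof (intro equalityI subsetI)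
  fix S assume "S \<in> B_Mas n"
  then show "S \<in> Mas_bs 1 2 (n + 1) {1..n + 1}"
    using assms by (auto simp: B_Mas_def Mas_bs_def singletons_def subset_iff; fastforce)
next
  fix S assume "S \<in> Mas_bs 1 2 (n + 1) {1..n + 1}"
  then have S: "S \<noteq> {}" "S \<subseteq> {1..n + 1}" "1 \<in> S \<and> (n + 1 \<in> S \<longrightarrow> 2 \<in> S) \<or> (\<exists>i. S = {i})"
    by (auto simp: Mas_bs_def)
  consider "\<exists>i. S = {i}" | "1 \<in> S" "2 \<in> S" | "1 \<in> S" "2 \<notin> S" "n + 1 \<notin> S" "S \<noteq> {1}"
    using S(3) by blast
  then show "S \<in> B_Mas n"
  proof cases
    case 1
    then show ?thesis using S by (auto simp: B_Mas_def singletons_def)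
  next
    case 2
    then have "S = {1, 2} \<union> (S - {1, 2})" "S - {1, 2} \<subseteq> {3..n + 1}"
      using S(2) by (auto simp: subset_iff Suc_le_eq)
    then show ?thesis unfolding B_Mas_def by blast
  next
    case 3
    have "S - {1} \<subseteq> {3..n}"
    proof
      fix x assume x: "x \<in> S - {1}"
      then have "x \<noteq> 2" "x \<noteq> n + 1" "x \<noteq> 1" "1 \<le> x" "x \<le> n + 1" using 3 S(2) by auto
      then show "x \<in> {3..n}" by auto
    qed
    moreover have "S = {1} \<union> (S - {1})" "S - {1} \<noteq> {}" using 3 by auto
    ultimately show ?thesis unfolding B_Mas_def by blast
  qed
qed

lemma type_of_Mas_bs:
  assumes V: "finite V" "card V = n + 1" "a \<in> V" "b \<in> V" "c \<in> V" "a \<noteq> b" "a \<noteq> c" "b \<noteq> c"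
  shows "type_of (nestohedron (Mas_bs a b c V)) = P_Mas n"
proof -
  let ?A = "{1..n + 1}"
  have n: "2 \<le> n"
    using V card_mono[of V "{a, b, c}"] by auto
  interpret connected_building ?A "Mas_bs 1 2 (n + 1) ?A"
    by (rule connected_building_Mas) (use n in auto)
  obtain \<sigma> where \<sigma>: "bij_betw \<sigma> ?A V" "map \<sigma> [1, 2, n + 1] = [a, b, c]"
    using ex_bij_betw_prescribed[of ?A V "[1, 2, n + 1]" "[a, b, c]"] V n by auto
  then have inj: "inj_on \<sigma> ?A" and im: "\<sigma> ` ?A = V"
    and abc: "\<sigma> 1 = a" "\<sigma> 2 = b" "\<sigma> (n + 1) = c"
    by (auto simp: bij_betw_def)
  have "image \<sigma> ` Mas_bs 1 2 (n + 1) ?A = Mas_bs a b c V"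
    unfolding Mas_bs_def im[symmetric]
    using image_singleton_iff[OF inj] image_mem_iff[OF inj _ abc(1)] image_mem_iff[OF inj _ abc(2)]
      image_mem_iff[OF inj _ abc(3)] n
    by (intro image_building[OF inj]) simp
  then show ?thesis
    using type_of_relabel[OF inj] n B_Mas_eq[OF n] by (simp add: P_Mas_def)
qed

section \<open>The boundaries of the two families\<close>

text \<open>Indexed by the number of vertices. The value 0 at the empty set fits the missing
  constant term of \<open>Pe_series\<close> and lets sums over nonempty or proper subsets be
  extended to all subsets.\<close>

definition pe_class :: "nat \<Rightarrow> polytope_ring" where
  "pe_class k = (if k = 0 then 0 else class_of (Pe (k - 1)))"

text \<open>The argument counts unmarked vertices: one mark for \<open>st_class\<close>, two for
  \<open>ga_class\<close>, three for \<open>ma_class\<close>.\<close>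

definition st_class :: "nat \<Rightarrow> polytope_ring" where
  "st_class k = class_of (St k)"

definition ga_class :: "nat \<Rightarrow> polytope_ring" where
  "ga_class k = class_of (P_Gamma (k + 1))"

definition ma_class :: "nat \<Rightarrow> polytope_ring" where
  "ma_class k = class_of (P_Mas (k + 2))"

lemma pe_class_0 [simp]: "pe_class 0 = 0" by (simp add: pe_class_def)

text \<open>Singletons restrict to a point, which must count as the factor 1. The zero map,
  injective on a singleton, moves that point to the origin representing the unit type.\<close>

lemma pe_class_1 [simp]: "pe_class (Suc 0) = 1"
proof -
  have "Pe_bs {0} = {{0}}" by (auto simp: Pe_bs_def)
  then have N: "nestohedron (Pe_bs {0}) = {Poly_Mapping.single 0 1}"
    by (simp add: nestohedron_simplex std_simplex_def)
  have "linear (\<lambda>_ :: point. 0 :: point)" by (simp add: linear_iff)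
  from type_of_linear_image[OF simple_polytope_sing this, of "Poly_Mapping.single 0 1"]
  have "type_of {Poly_Mapping.single 0 1} = (0 :: comb_type)" by (simp add: zero_comb_type_def)
  then have "Pe 0 = 0" using type_of_Pe_bs[of "{0}" 0] N by simp
  then show ?thesis by (simp add: pe_class_def class_of_def)
qed

abbreviation nest_class :: "nat set set \<Rightarrow> polytope_ring" where
  "nest_class B \<equiv> class_of (type_of (nestohedron B))"

lemma nest_class_Pe: "finite S \<Longrightarrow> S \<noteq> {} \<Longrightarrow> nest_class (Pe_bs S) = pe_class (card S)"
  using type_of_Pe_bs[of S "card S - 1"] by (simp add: pe_class_def card_gt_0_iff)

lemma nest_class_St:
  assumes "finite S" "a \<in> S" shows "nest_class (St_bs a S) = st_class (card (S - {a}))"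
proof -
  have "card S = card (S - {a}) + 1" by (metis Suc_eq_plus1 card.remove assms)
  from type_of_St_bs[OF assms(1) this assms(2)] show ?thesis by (simp only: st_class_def)
qed

lemma nest_class_Gamma:
  assumes "finite S" "a \<in> S" "b \<in> S" "a \<noteq> b"
  shows "nest_class (Gamma_bs a b S) = ga_class (card (S - {a, b}))"
proof -
  have "card S = card (S - {a, b}) + 1 + 1"
    using assms card_Diff_subset[of "{a, b}" S] card_mono[of S "{a, b}"] by simp
  then show ?thesis using type_of_Gamma_bs[of S "card (S - {a, b}) + 1" a b] assms
    by (simp add: ga_class_def)
qed

lemma nest_class_Mas:
  assumes "finite S" "a \<in> S" "b \<in> S" "c \<in> S" "a \<noteq> b" "a \<noteq> c" "b \<noteq> c"
  shows "nest_class (Mas_bs a b c S) = ma_class (card (S - {a, b, c}))"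
proof -
  have "card S = card (S - {a, b, c}) + 2 + 1"
    using assms card_Diff_subset[of "{a, b, c}" S] card_mono[of S "{a, b, c}"] by simp
  then show ?thesis using type_of_Mas_bs[of S "card (S - {a, b, c}) + 2" a b c] assms
    by (simp add: ma_class_def)
qed

section \<open>Restrictions, contractions and the boundary of \<open>P_Gamma\<close>\<close>

lemma contract_eqI:
  assumes "\<And>T. T \<in> B \<Longrightarrow> \<not> T \<subseteq> S \<Longrightarrow> T - S \<in> C"
    "\<And>U. U \<in> C \<Longrightarrow> \<exists>T\<in>B. \<not> T \<subseteq> S \<and> T - S = U"
  shows "contract B S = C"
  unfolding contract_def
proof (intro equalityI subsetI)
  fix U assume "U \<in> C"
  then show "U \<in> (\<lambda>T. T - S) ` {T \<in> B. \<not> T \<subseteq> S}" using assms(2)[of U] by auto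
qed (use assms(1) in auto)

lemma Gamma_bs_eq_Pe_bs: "b \<notin> S \<Longrightarrow> Gamma_bs a b S = Pe_bs S"
  by (auto simp: Gamma_bs_def Pe_bs_def)

lemma restrict_Gamma_bs: "S \<subseteq> V \<Longrightarrow> restrict_to (Gamma_bs a b V) S = Gamma_bs a b S"
  by (auto simp: Gamma_bs_def restrict_to_def)

lemma Gamma_bs_singleton: "Gamma_bs a b {i} = Pe_bs {i}"
  by (auto simp: Gamma_bs_def Pe_bs_def subset_singleton_iff)

lemma Mas_bs_eq_St_bs: "c \<notin> S \<Longrightarrow> Mas_bs a b c S = St_bs a S"
  by (auto simp: Mas_bs_def St_bs_def)

lemma restrict_Mas_bs: "S \<subseteq> V \<Longrightarrow> restrict_to (Mas_bs a b c V) S = Mas_bs a b c S"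
  by (auto simp: Mas_bs_def restrict_to_def)

lemma Mas_bs_singleton: "Mas_bs a b c {i} = Pe_bs {i}"
  by (auto simp: Mas_bs_def Pe_bs_def subset_singleton_iff)

lemma contract_Gamma_free:
  fixes V :: "nat set" and a b :: nat
  assumes "S \<subseteq> V" "a \<notin> S" "b \<notin> S"
  shows "contract (Gamma_bs a b V) S = Gamma_bs a b (V - S)"
proof (rule contract_eqI)
  fix T assume "T \<in> Gamma_bs a b V" "\<not> T \<subseteq> S"
  then show "T - S \<in> Gamma_bs a b (V - S)" using assms unfolding Gamma_bs_def by auto
next
  fix U assume "U \<in> Gamma_bs a b (V - S)"
  then show "\<exists>T\<in>Gamma_bs a b V. \<not> T \<subseteq> S \<and> T - S = U"
    unfolding Gamma_bs_def by (intro bexI[of _ U]) auto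
qed

text \<open>Contracting either mark dissolves the condition: an \<open>a\<close> in \<open>S\<close>
  can be adjoined to any set, and if \<open>b\<close> is in \<open>S\<close> no remaining set
  contains it.\<close>

lemma contract_Gamma_end:
  fixes V :: "nat set" and a b :: nat
  assumes "S \<subseteq> V" "a \<in> S \<or> b \<in> S" "a \<in> V"
  shows "contract (Gamma_bs a b V) S = Pe_bs (V - S)"
proof (rule contract_eqI)
  fix T assume "T \<in> Gamma_bs a b V" "\<not> T \<subseteq> S"
  then show "T - S \<in> Pe_bs (V - S)" unfolding Gamma_bs_def Pe_bs_def by auto
next
  fix U assume U: "U \<in> Pe_bs (V - S)"
  define T where "T = (if a \<in> S then insert a U else U)"
  have "T \<in> Gamma_bs a b V" using U assms unfolding T_def Gamma_bs_def Pe_bs_def by auto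
  moreover have "T - S = U" using U unfolding T_def Pe_bs_def by auto
  moreover have "\<not> T \<subseteq> S" using U \<open>T - S = U\<close> unfolding Pe_bs_def by auto
  ultimately show "\<exists>T\<in>Gamma_bs a b V. \<not> T \<subseteq> S \<and> T - S = U" by blast
qed

text \<open>Members are sorted by their marks: \<open>{b}\<close> gives the first term; nonempty
  \<open>J\<close> without marks, \<open>J\<close> with \<open>a\<close>, and \<open>J\<close> with
  both marks give the three sums. A member without \<open>b\<close> restricts to a permutohedron,
  and contracting a mark leaves one.\<close>

lemma bd_Gamma:
  fixes V :: "nat set" and a b :: nat
  assumes V: "finite V" "a \<in> V" "b \<in> V" "a \<noteq> b" and W: "W = V - {a, b}"
  shows "bd (ga_class (card W)) = pe_class (Suc (card W))
    + (\<Sum>J\<in>Pow W. pe_class (card J) * ga_class (card (W - J)))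
    + (\<Sum>J\<in>Pow W. pe_class (Suc (card J)) * pe_class (Suc (card (W - J))))
    + (\<Sum>J\<in>Pow W. ga_class (card J) * pe_class (card (W - J)))"
proof -
  let ?B = "Gamma_bs a b V"
  interpret connected_building V ?B using V by (intro connected_building_Gamma)
  define t where "t S = nest_class (restrict_to ?B S) * nest_class (contract ?B S)" for S
  have fW: "finite W" and WV: "W \<subseteq> V" and nW: "a \<notin> W" "b \<notin> W" using V W by auto
  have fin: "finite J" if "J \<subseteq> W" for J using fW that finite_subset by blast
  have Veq: "V = insert a (insert b W)" using V W by auto
  let ?I1 = "Pow W - {{}}" and ?I2 = "insert a ` Pow W"
    and ?I3 = "(\<lambda>J. insert a (insert b J)) ` (Pow W - {W})"
  have index: "?B - {V} = {{b}} \<union> (?I1 \<union> (?I2 \<union> ?I3))"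
  proof (intro equalityI subsetI)
    fix S assume "S \<in> ?B - {V}"
    then have S: "S \<noteq> {}" "S \<subseteq> V" "S \<noteq> V" "(b \<in> S \<longrightarrow> a \<in> S) \<or> (\<exists>i. S = {i})"
      by (auto simp: Gamma_bs_def)
    consider "a \<notin> S" "b \<notin> S" | "a \<notin> S" "b \<in> S" | "a \<in> S" "b \<notin> S" | "a \<in> S" "b \<in> S" by blast
    then show "S \<in> {{b}} \<union> (?I1 \<union> (?I2 \<union> ?I3))"
    proof cases
      case 1
      then show ?thesis using S W by auto
    next
      case 2
      then show ?thesis using S by auto
    next
      case 3
      then have "S = insert a (S - {a})" "S - {a} \<in> Pow W" using S W by auto
      then show ?thesis by blast
    next
      case 4
      then have e: "S = insert a (insert b (S - {a, b}))" by auto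
      then have "S - {a, b} \<noteq> W" using S(3) Veq by metis
      then have "S - {a, b} \<in> Pow W - {W}" using S(2) W by auto
      with e show ?thesis by blast
    qed
  next
    fix S assume "S \<in> {{b}} \<union> (?I1 \<union> (?I2 \<union> ?I3))"
    then consider "S = {b}" | "S \<in> ?I1" | J where "S = insert a J" "J \<subseteq> W"
      | J where "S = insert a (insert b J)" "J \<subseteq> W" "J \<noteq> W" by blast
    then show "S \<in> ?B - {V}"
    proof cases
      case 1
      then show ?thesis using V(2-4) by (auto simp: Gamma_bs_def)
    next
      case 2
      then have "S \<noteq> {}" "S \<subseteq> V" "b \<notin> S" "S \<noteq> V" using WV nW V(2) by auto
      then show ?thesis by (simp add: Gamma_bs_def)
    next
      case 3
      then have "S \<subseteq> V" "a \<in> S" "b \<notin> S" using WV nW V(2,4) by auto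
      then have "S \<noteq> {}" "S \<noteq> V" using V(3) by auto
      then show ?thesis using \<open>S \<subseteq> V\<close> \<open>a \<in> S\<close> by (simp add: Gamma_bs_def)
    next
      case 4
      then have "S \<subseteq> V" "a \<in> S" "S - {a, b} = J" using WV nW V(2,3) by auto
      then have "S \<noteq> {}" "S \<noteq> V" using 4(3) W by auto
      then show ?thesis using \<open>S \<subseteq> V\<close> \<open>a \<in> S\<close> by (simp add: Gamma_bs_def)
    qed
  qed
  have "bd (ga_class (card W)) = (\<Sum>S\<in>?B - {V}. t S)"
    using bd_nestohedron nest_class_Gamma[OF V] by (simp add: t_def W)
  also have "\<dots> = t {b} + (sum t ?I1 + (sum t ?I2 + sum t ?I3))"
  proof -
    have "?I2 \<inter> ?I3 = {}" "?I1 \<inter> (?I2 \<union> ?I3) = {}" "{{b}} \<inter> (?I1 \<union> (?I2 \<union> ?I3)) = {}"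
      using V(4) nW by auto
    then show ?thesis
      unfolding index using fW by (simp add: sum.union_disjoint del: Un_insert_left)
  qed
  also have "t {b} = pe_class (Suc (card W))"
  proof -
    have "V - {b} = insert a W" unfolding W using V(2,4) by auto
    then have "contract ?B {b} = Pe_bs (insert a W)"
      using contract_Gamma_end[of "{b}" V a b] V(2,3) by simp
    moreover have "restrict_to ?B {b} = Pe_bs {b}" 
      using restrict_Gamma_bs[of "{b}" V a b] V(3) by (simp add: Gamma_bs_singleton)
    ultimately show ?thesis using fW nW by (simp add: t_def nest_class_Pe)
  qed
  also have "sum t ?I1 = (\<Sum>J\<in>?I1. pe_class (card J) * ga_class (card (W - J)))"
  proof (intro sum.cong refl)
    fix J assume J: "J \<in> ?I1"
    then have h: "J \<subseteq> W" "J \<noteq> {}" "J \<subseteq> V" "a \<notin> J" "b \<notin> J" using WV nW by auto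
    have "V - J - {a, b} = W - J" using W by auto
    then show "t J = pe_class (card J) * ga_class (card (W - J))"
      unfolding t_def restrict_Gamma_bs[OF h(3)] Gamma_bs_eq_Pe_bs[OF h(5)] contract_Gamma_free[OF h(3-5)]
      using h V fin by (simp add: nest_class_Pe nest_class_Gamma)
  qed
  \<comment> \<open>The added index \<open>J = {}\<close> contributes the factor
    \<open>pe_class 0 = 0\<close>.\<close>
  also have "\<dots> = (\<Sum>J\<in>Pow W. pe_class (card J) * ga_class (card (W - J)))"
    using fW by (intro sum.mono_neutral_left) auto
  also have "sum t ?I2 = (\<Sum>J\<in>Pow W. pe_class (Suc (card J)) * pe_class (Suc (card (W - J))))"
  proof -
    have "inj_on (insert a) (Pow W)" using nW by (auto simp: inj_on_def)
    then have "sum t ?I2 = (\<Sum>J\<in>Pow W. t (insert a J))" by (simp add: sum.reindex)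
    also have "\<dots> = (\<Sum>J\<in>Pow W. pe_class (Suc (card J)) * pe_class (Suc (card (W - J))))"
    proof (intro sum.cong refl)
      fix J assume "J \<in> Pow W"
      then have h: "J \<subseteq> W" "a \<notin> J" "b \<notin> J" using nW by auto
      have s: "insert a J \<subseteq> V" "b \<notin> insert a J" using h WV V by auto
      have d: "V - insert a J = insert b (W - J)" using Veq h V(4) nW by auto
      have "contract ?B (insert a J) = Pe_bs (insert b (W - J))"
        using contract_Gamma_end[OF s(1), of a b] V d by simp
      then show "t (insert a J) = pe_class (Suc (card J)) * pe_class (Suc (card (W - J)))"
        unfolding t_def restrict_Gamma_bs[OF s(1)] Gamma_bs_eq_Pe_bs[OF s(2)]
        using h fin fW nW by (simp add: nest_class_Pe)
    qed
    finally show ?thesis .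
  qed
  also have "sum t ?I3 = (\<Sum>J\<in>Pow W - {W}. ga_class (card J) * pe_class (card (W - J)))"
  proof -
    have "inj_on (\<lambda>J. insert a (insert b J)) (Pow W - {W})"
    proof (rule inj_onI)
      fix X Y assume h: "X \<in> Pow W - {W}" "Y \<in> Pow W - {W}" "insert a (insert b X) = insert a (insert b Y)"
      then have "X = insert a (insert b X) - {a, b}" "Y = insert a (insert b Y) - {a, b}" using nW by auto
      then show "X = Y" using h(3) by simp
    qed
    then have "sum t ?I3 = (\<Sum>J\<in>Pow W - {W}. t (insert a (insert b J)))" by (simp add: sum.reindex)
    also have "\<dots> = (\<Sum>J\<in>Pow W - {W}. ga_class (card J) * pe_class (card (W - J)))"
    proof (intro sum.cong refl)
      fix J assume "J \<in> Pow W - {W}"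
      then have h: "J \<subseteq> W" "J \<noteq> W" "a \<notin> J" "b \<notin> J" using nW by auto
      have s: "insert a (insert b J) \<subseteq> V" using h WV V by auto
      have d: "V - insert a (insert b J) = W - J" using W by auto
      have e: "insert a (insert b J) - {a, b} = J" using h by auto
      have "contract ?B (insert a (insert b J)) = Pe_bs (W - J)"
        using contract_Gamma_end[OF s, of a b] V d by simp
      moreover have "W - J \<noteq> {}" using h by blast
      ultimately show "t (insert a (insert b J)) = ga_class (card J) * pe_class (card (W - J))"
        unfolding t_def restrict_Gamma_bs[OF s]
        using fin[OF h(1)] fW V(4) e by (simp add: nest_class_Pe nest_class_Gamma)
    qed
    finally show ?thesis .
  qed
  \<comment> \<open>The added index \<open>J = W\<close> stands for the excluded member
    \<open>V\<close> and contributes the factor \<open>pe_class 0 = 0\<close>.\<close>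
  also have "\<dots> = (\<Sum>J\<in>Pow W. ga_class (card J) * pe_class (card (W - J)))"
    using fW by (intro sum.mono_neutral_left) auto
  finally show ?thesis by (simp add: add.assoc)
qed

section \<open>Contractions and the boundary of \<open>P_Mas\<close>\<close>

lemma contract_Mas_free:
  fixes V :: "nat set" and a b c :: nat
  assumes "S \<subseteq> V" "a \<notin> S" "b \<notin> S" "c \<notin> S"
  shows "contract (Mas_bs a b c V) S = Mas_bs a b c (V - S)"
proof (rule contract_eqI)
  fix T assume "T \<in> Mas_bs a b c V" "\<not> T \<subseteq> S"
  then show "T - S \<in> Mas_bs a b c (V - S)" using assms unfolding Mas_bs_def by auto
next
  fix U assume "U \<in> Mas_bs a b c (V - S)"
  then show "\<exists>T\<in>Mas_bs a b c V. \<not> T \<subseteq> S \<and> T - S = U"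
    unfolding Mas_bs_def by (intro bexI[of _ U]) auto
qed

text \<open>Once \<open>b\<close> is contracted it can be adjoined to any set containing
  \<open>a\<close>, so \<open>c\<close> is no longer constrained and only the star condition
  survives.\<close>

lemma contract_Mas_b:
  fixes V :: "nat set" and a b c :: nat
  assumes "a \<in> V" "b \<in> V" "a \<noteq> b"
  shows "contract (Mas_bs a b c V) {b} = St_bs a (V - {b})"
proof (rule contract_eqI)
  fix T assume "T \<in> Mas_bs a b c V" "\<not> T \<subseteq> {b}"
  then show "T - {b} \<in> St_bs a (V - {b})" using assms unfolding Mas_bs_def St_bs_def by auto
next
  fix U assume U: "U \<in> St_bs a (V - {b})"
  define T where "T = (if a \<in> U then insert b U else U)"
  have "T \<in> Mas_bs a b c V" using U assms unfolding T_def Mas_bs_def St_bs_def by auto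
  moreover have e: "T - {b} = U" using U unfolding T_def St_bs_def by auto
  moreover have "\<not> T \<subseteq> {b}" using U e unfolding St_bs_def by auto
  ultimately show "\<exists>T\<in>Mas_bs a b c V. \<not> T \<subseteq> {b} \<and> T - {b} = U" by blast
qed

lemma contract_Mas_c:
  fixes V :: "nat set" and a b c :: nat
  assumes "a \<in> V" "c \<in> V" "a \<noteq> c"
  shows "contract (Mas_bs a b c V) {c} = St_bs a (V - {c})"
proof (rule contract_eqI)
  fix T assume "T \<in> Mas_bs a b c V" "\<not> T \<subseteq> {c}"
  then show "T - {c} \<in> St_bs a (V - {c})" using assms unfolding Mas_bs_def St_bs_def by auto
next
  fix U assume U: "U \<in> St_bs a (V - {c})"
  then have "U \<in> Mas_bs a b c V" using assms unfolding Mas_bs_def St_bs_def by auto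
  moreover have e: "U - {c} = U" "\<not> U \<subseteq> {c}" using U unfolding St_bs_def by auto
  ultimately show "\<exists>T\<in>Mas_bs a b c V. \<not> T \<subseteq> {c} \<and> T - {c} = U" by blast
qed

text \<open>A contracted \<open>a\<close> can be adjoined to every set satisfying the condition on
  \<open>b\<close> and \<open>c\<close>; the only remaining member, \<open>{c}\<close>, is a
  singleton from the start.\<close>

lemma contract_Mas_a:
  fixes V :: "nat set" and a b c :: nat
  assumes "S \<subseteq> V" "a \<in> S" "b \<notin> S" "c \<notin> S"
  shows "contract (Mas_bs a b c V) S = Gamma_bs b c (V - S)"
proof (rule contract_eqI)
  fix T assume "T \<in> Mas_bs a b c V" "\<not> T \<subseteq> S"
  then show "T - S \<in> Gamma_bs b c (V - S)" using assms unfolding Mas_bs_def Gamma_bs_def by auto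
next
  fix U assume U: "U \<in> Gamma_bs b c (V - S)"
  define T where "T = (if c \<in> U \<longrightarrow> b \<in> U then insert a U else U)"
  have "T \<in> Mas_bs a b c V" using U assms unfolding T_def Mas_bs_def Gamma_bs_def by auto
  moreover have e: "T - S = U" using U assms unfolding T_def Gamma_bs_def by auto
  moreover have "\<not> T \<subseteq> S" using U e unfolding Gamma_bs_def by auto
  ultimately show "\<exists>T\<in>Mas_bs a b c V. \<not> T \<subseteq> S \<and> T - S = U" by blast
qed

text \<open>Adjoining \<open>a\<close> and \<open>b\<close> to an arbitrary set meets every
  condition.\<close>

lemma contract_Mas_ab:
  fixes V :: "nat set" and a b c :: nat
  assumes "S \<subseteq> V" "a \<in> S" "b \<in> S"
  shows "contract (Mas_bs a b c V) S = Pe_bs (V - S)"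
proof (rule contract_eqI)
  fix T assume "T \<in> Mas_bs a b c V" "\<not> T \<subseteq> S"
  then show "T - S \<in> Pe_bs (V - S)" unfolding Mas_bs_def Pe_bs_def by auto
next
  fix U assume U: "U \<in> Pe_bs (V - S)"
  then have "insert a (insert b U) \<in> Mas_bs a b c V" using assms unfolding Mas_bs_def Pe_bs_def by auto
  moreover have e: "insert a (insert b U) - S = U" using U assms unfolding Pe_bs_def by auto
  moreover have "\<not> insert a (insert b U) \<subseteq> S" using U e unfolding Pe_bs_def by auto
  ultimately show "\<exists>T\<in>Mas_bs a b c V. \<not> T \<subseteq> S \<and> T - S = U" by blast
qed

lemma inj_on_Un_Pow:
  assumes "W \<inter> D = {}" shows "inj_on (\<lambda>J. D \<union> J) (Pow W)"
proof (rule inj_onI)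
  fix X Y assume h: "X \<in> Pow W" "Y \<in> Pow W" "D \<union> X = D \<union> Y"
  then have "X = (D \<union> X) - D" "Y = (D \<union> Y) - D" using assms by auto
  then show "X = Y" using h(3) by simp
qed

text \<open>Members without \<open>a\<close> are singletons: \<open>{b}\<close> and
  \<open>{c}\<close> account for the coefficient 2, the unmarked ones for the second term. Members
  with \<open>a\<close> are sorted by \<open>b\<close> and \<open>c\<close>. Those without
  \<open>c\<close> restrict to stellahedra; their contraction is of type \<open>P_Gamma\<close> if
  \<open>b\<close> survives, and contracting both \<open>a\<close> and \<open>b\<close> leaves a
  permutohedron.\<close>

lemma bd_Mas:
  fixes V :: "nat set" and a b c :: nat
  assumes V: "finite V" "a \<in> V" "b \<in> V" "c \<in> V" "a \<noteq> b" "a \<noteq> c" "b \<noteq> c"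
    and W: "W = V - {a, b, c}"
  shows "bd (ma_class (card W)) = 2 * st_class (Suc (card W))
    + of_nat (card W) * ma_class (card W - 1)
    + (\<Sum>J\<in>Pow W. st_class (card J) * ga_class (card (W - J)))
    + (\<Sum>J\<in>Pow W. st_class (Suc (card J)) * pe_class (Suc (card (W - J))))
    + (\<Sum>J\<in>Pow W. ma_class (card J) * pe_class (card (W - J)))"
proof -
  let ?B = "Mas_bs a b c V"
  interpret connected_building V ?B using V(1-3) by (intro connected_building_Mas)
  define t where "t S = nest_class (restrict_to ?B S) * nest_class (contract ?B S)" for S
  have fW: "finite W" and WV: "W \<subseteq> V" and nW: "a \<notin> W" "b \<notin> W" "c \<notin> W" using V W by auto
  have fin: "finite J" if "J \<subseteq> W" for J using fW that finite_subset by blast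
  have Veq: "V = {a, b, c} \<union> W" using V(2-4) W by auto
  have sing: "nest_class (restrict_to ?B {i}) = 1" if "i \<in> V" for i
    using restrict_Mas_bs[of "{i}" V a b c] that by (simp add: Mas_bs_singleton nest_class_Pe)
  let ?I0 = "(\<lambda>i. {i}) ` W" and ?I1 = "(\<lambda>J. {a} \<union> J) ` Pow W" and ?I2 = "(\<lambda>J. {a, b} \<union> J) ` Pow W"
    and ?I3 = "(\<lambda>J. {a, b, c} \<union> J) ` (Pow W - {W})"
  have index: "?B - {V} = {{b}, {c}} \<union> (?I0 \<union> (?I1 \<union> (?I2 \<union> ?I3)))"
  proof (intro equalityI subsetI)
    fix S assume "S \<in> ?B - {V}"
    then have S: "S \<noteq> {}" "S \<subseteq> V" "S \<noteq> V" "a \<in> S \<and> (c \<in> S \<longrightarrow> b \<in> S) \<or> (\<exists>i. S = {i})"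
      by (auto simp: Mas_bs_def)
    consider i where "a \<notin> S" "S = {i}" | "a \<in> S" "b \<notin> S" "c \<notin> S" | "a \<in> S" "b \<in> S" "c \<notin> S"
      | "a \<in> S" "b \<in> S" "c \<in> S" using S(4) V(6) by blast
    then show "S \<in> {{b}, {c}} \<union> (?I0 \<union> (?I1 \<union> (?I2 \<union> ?I3)))"
    proof cases
      case 1
      then show ?thesis using S(2) W by auto
    next
      case 2
      then have "S = {a} \<union> (S - {a})" "S - {a} \<in> Pow W" using S(2) W by auto
      then show ?thesis by blast
    next
      case 3
      then have "S = {a, b} \<union> (S - {a, b})" "S - {a, b} \<in> Pow W" using S(2) W by auto
      then show ?thesis by blast
    next
      case 4
      then have e: "S = {a, b, c} \<union> (S - {a, b, c})" by auto
      then have "S - {a, b, c} \<noteq> W" using S(3) Veq by metis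
      then have "S - {a, b, c} \<in> Pow W - {W}" using S(2) W by auto
      with e show ?thesis by blast
    qed
  next
    fix S assume "S \<in> {{b}, {c}} \<union> (?I0 \<union> (?I1 \<union> (?I2 \<union> ?I3)))"
    then consider i where "S = {i}" "i \<in> V" "i \<noteq> a" | J where "S = {a} \<union> J" "J \<subseteq> W"
      | J where "S = {a, b} \<union> J" "J \<subseteq> W" | J where "S = {a, b, c} \<union> J" "J \<subseteq> W" "J \<noteq> W"
      using V(3-6) nW WV by blast
    then show "S \<in> ?B - {V}"
    proof cases
      case 1
      then show ?thesis using V(2) by (auto simp: Mas_bs_def)
    next
      case 2
      then have "S \<subseteq> V" "a \<in> S" "c \<notin> S" using WV nW V(2,6) by auto
      moreover from this have "S \<noteq> {}" "S \<noteq> V" using V(4) by auto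
      ultimately show ?thesis by (simp add: Mas_bs_def)
    next
      case 3
      then have "S \<subseteq> V" "a \<in> S" "c \<notin> S" using WV nW V(2,3,6,7) by auto
      moreover from this have "S \<noteq> {}" "S \<noteq> V" using V(4) by auto
      ultimately show ?thesis by (simp add: Mas_bs_def)
    next
      case 4
      then have "S \<subseteq> V" "a \<in> S" "b \<in> S" "S - {a, b, c} = J" using WV nW V(2-4) by auto
      moreover from this have "S \<noteq> {}" "S \<noteq> V" using 4(3) W by auto
      ultimately show ?thesis by (simp add: Mas_bs_def)
    qed
  qed
  have "bd (ma_class (card W)) = (\<Sum>S\<in>?B - {V}. t S)"
    using bd_nestohedron nest_class_Mas[OF V] by (simp add: t_def W)
  also have "\<dots> = sum t {{b}, {c}} + (sum t ?I0 + (sum t ?I1 + (sum t ?I2 + sum t ?I3)))"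
  proof -
    have d3: "?I2 \<inter> ?I3 = {}" using V(6,7) nW by auto
    have d2: "?I1 \<inter> (?I2 \<union> ?I3) = {}" using V(5) nW by auto
    have d1: "?I0 \<inter> (?I1 \<union> (?I2 \<union> ?I3)) = {}" using nW by auto
    have d0: "{{b}, {c}} \<inter> (?I0 \<union> (?I1 \<union> (?I2 \<union> ?I3))) = {}" using V(5-7) nW by auto
    have f: "finite ?I0" "finite ?I1" "finite ?I2" "finite ?I3" "finite {{b}, {c}}" using fW by auto
    show ?thesis
      unfolding index
      by (subst sum.union_disjoint, (use f d0 in auto)[3], subst sum.union_disjoint, (use f d1 in auto)[3],
          subst sum.union_disjoint, (use f d2 in auto)[3], subst sum.union_disjoint, (use f d3 in auto)[3])
        (rule refl)
  qed
  also have "sum t {{b}, {c}} = 2 * st_class (Suc (card W))"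
  proof -
    \<comment> \<open>Contracting \<open>b\<close> or \<open>c\<close> turns the other of the two
      into an ordinary vertex of the star at \<open>a\<close>, whence the successor.\<close>
    have "V - {b} - {a} = insert c W" "V - {c} - {a} = insert b W" unfolding W using V(2-7) by auto
    then have "t {b} = st_class (Suc (card W))" "t {c} = st_class (Suc (card W))"
      unfolding t_def contract_Mas_b[OF V(2,3,5)] contract_Mas_c[OF V(2,4,6)]
      using V fW nW by (simp_all add: sing nest_class_St)
    then show ?thesis using V(7) by simp
  qed
  \<comment> \<open>Contracting an unmarked vertex keeps the three marks and loses one label. For
    empty \<open>W\<close> the factor 0 covers the truncated \<open>card W - 1\<close>.\<close>
  also have "sum t ?I0 = of_nat (card W) * ma_class (card W - 1)"
  proof -
    have "t {i} = ma_class (card W - 1)" if i: "i \<in> W" for i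
    proof -
      have n: "{i} \<subseteq> V" "a \<notin> {i}" "b \<notin> {i}" "c \<notin> {i}" using i WV nW by auto
      have "V - {i} - {a, b, c} = W - {i}" unfolding W by auto
      then show ?thesis
        unfolding t_def contract_Mas_free[OF n]
        using V n i fW by (simp add: sing nest_class_Mas)
    qed
    then have "(\<Sum>i\<in>W. t {i}) = of_nat (card W) * ma_class (card W - 1)" by simp
    then show ?thesis by (simp add: sum.reindex)
  qed
  also have "sum t ?I1 = (\<Sum>J\<in>Pow W. st_class (card J) * ga_class (card (W - J)))"
  proof -
    have "W \<inter> {a} = {}" using nW by auto
    then have "sum t ?I1 = (\<Sum>J\<in>Pow W. t ({a} \<union> J))"
      using inj_on_Un_Pow[of W "{a}"] by (simp add: sum.reindex)
    also have "\<dots> = (\<Sum>J\<in>Pow W. st_class (card J) * ga_class (card (W - J)))"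
    proof (intro sum.cong refl)
      fix J assume "J \<in> Pow W"
      then have h: "J \<subseteq> W" "a \<notin> J" "b \<notin> J" "c \<notin> J" using nW by auto
      have s: "{a} \<union> J \<subseteq> V" "a \<in> {a} \<union> J" "b \<notin> {a} \<union> J" "c \<notin> {a} \<union> J" using h WV V by auto
      have d: "V - ({a} \<union> J) - {b, c} = W - J" "{a} \<union> J - {a} = J" using h unfolding W by auto
      have "nest_class (restrict_to ?B ({a} \<union> J)) = st_class (card J)"
        unfolding restrict_Mas_bs[OF s(1)] Mas_bs_eq_St_bs[OF s(4)]
        using nest_class_St[OF _ s(2)] fin[OF h(1)] d(2) by simp
      moreover have "nest_class (Gamma_bs b c (V - ({a} \<union> J))) = ga_class (card (V - ({a} \<union> J) - {b, c}))"
        by (rule nest_class_Gamma) (use V s in auto)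
      then have "nest_class (contract ?B ({a} \<union> J)) = ga_class (card (W - J))"
        by (simp only: contract_Mas_a[OF s] d(1))
      ultimately show "t ({a} \<union> J) = st_class (card J) * ga_class (card (W - J))" by (simp only: t_def)
    qed
    finally show ?thesis .
  qed
  also have "sum t ?I2 = (\<Sum>J\<in>Pow W. st_class (Suc (card J)) * pe_class (Suc (card (W - J))))"
  proof -
    have "W \<inter> {a, b} = {}" using nW by auto
    then have "sum t ?I2 = (\<Sum>J\<in>Pow W. t ({a, b} \<union> J))"
      using inj_on_Un_Pow[of W "{a, b}"] by (simp add: sum.reindex)
    also have "\<dots> = (\<Sum>J\<in>Pow W. st_class (Suc (card J)) * pe_class (Suc (card (W - J))))"
    proof (intro sum.cong refl)
      fix J assume "J \<in> Pow W"
      then have h: "J \<subseteq> W" "a \<notin> J" "b \<notin> J" "c \<notin> J" using nW by auto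
      have s: "{a, b} \<union> J \<subseteq> V" "a \<in> {a, b} \<union> J" "b \<in> {a, b} \<union> J" "c \<notin> {a, b} \<union> J" using h WV V by auto
      have d: "V - ({a, b} \<union> J) = insert c (W - J)" "{a, b} \<union> J - {a} = insert b J"
        using h V(2-7) unfolding W by auto
      have "nest_class (restrict_to ?B ({a, b} \<union> J)) = st_class (Suc (card J))"
        unfolding restrict_Mas_bs[OF s(1)] Mas_bs_eq_St_bs[OF s(4)]
        using nest_class_St[OF _ s(2)] fin[OF h(1)] d(2) h(3) by simp
      moreover have "nest_class (contract ?B ({a, b} \<union> J)) = pe_class (Suc (card (W - J)))"
        unfolding contract_Mas_ab[OF s(1-3)] d(1) using fW nW by (simp add: nest_class_Pe)
      ultimately show "t ({a, b} \<union> J) = st_class (Suc (card J)) * pe_class (Suc (card (W - J)))"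
        by (simp only: t_def)
    qed
    finally show ?thesis .
  qed
  also have "sum t ?I3 = (\<Sum>J\<in>Pow W - {W}. ma_class (card J) * pe_class (card (W - J)))"
  proof -
    have "W \<inter> {a, b, c} = {}" using nW by auto
    then have "inj_on (\<lambda>J. {a, b, c} \<union> J) (Pow W - {W})"
      by (rule inj_on_subset[OF inj_on_Un_Pow]) blast
    then have "sum t ?I3 = (\<Sum>J\<in>Pow W - {W}. t ({a, b, c} \<union> J))" by (simp add: sum.reindex)
    also have "\<dots> = (\<Sum>J\<in>Pow W - {W}. ma_class (card J) * pe_class (card (W - J)))"
    proof (intro sum.cong refl)
      fix J assume "J \<in> Pow W - {W}"
      then have h: "J \<subseteq> W" "J \<noteq> W" "a \<notin> J" "b \<notin> J" "c \<notin> J" using nW by auto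
      have s: "{a, b, c} \<union> J \<subseteq> V" "a \<in> {a, b, c} \<union> J" "b \<in> {a, b, c} \<union> J" "c \<in> {a, b, c} \<union> J"
        using h WV V by auto
      have d: "V - ({a, b, c} \<union> J) = W - J" "{a, b, c} \<union> J - {a, b, c} = J" using h unfolding W by auto
      have "nest_class (restrict_to ?B ({a, b, c} \<union> J)) = ma_class (card J)"
        unfolding restrict_Mas_bs[OF s(1)]
        using nest_class_Mas[OF _ s(2-4) V(5-7)] fin[OF h(1)] d(2) by simp
      moreover have "nest_class (contract ?B ({a, b, c} \<union> J)) = pe_class (card (W - J))"
      proof -
        have "W - J \<noteq> {}" using h by blast
        then show ?thesis unfolding contract_Mas_ab[OF s(1-3)] d(1) using fW by (simp add: nest_class_Pe)
      qed
      ultimately show "t ({a, b, c} \<union> J) = ma_class (card J) * pe_class (card (W - J))"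
        by (simp only: t_def)
    qed
    finally show ?thesis .
  qed
  \<comment> \<open>Again \<open>J = W\<close> stands for \<open>V\<close> and contributes the
    factor \<open>pe_class 0 = 0\<close>.\<close>
  also have "\<dots> = (\<Sum>J\<in>Pow W. ma_class (card J) * pe_class (card (W - J)))"
    using fW by (intro sum.mono_neutral_left) auto
  finally show ?thesis by (simp only: add.assoc)
qed

section \<open>The differential equations\<close>

lemma Pe_series_egf: "Pe_series = egf pe_class"
  by (rule fps_ext) (simp add: Pe_series_def egf_def pe_class_def)

lemma St_series_egf: "St_series = egf st_class"
  by (rule fps_ext) (simp add: St_series_def egf_def st_class_def)

lemma P_Gamma_series_egf: "P_Gamma_series = egf ga_class"
  by (rule fps_ext) (simp add: P_Gamma_series_def egf_def ga_class_def)

text \<open>The exponent is s + 2 but the factorial is that of s, so the series is exponential only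
  up to the factor x^2, with which \<open>bd_series\<close> commutes.\<close>

lemma P_Mas_series_egf: "P_Mas_series = fps_X\<^sup>2 * egf ma_class"
proof (rule fps_ext)
  fix n
  show "fps_nth P_Mas_series n = fps_nth (fps_X\<^sup>2 * egf ma_class) n"
  proof (cases "n < 2")
    case False
    then have "n - 2 + 2 = n" by simp
    then show ?thesis
      using False by (simp add: P_Mas_series_def egf_def ma_class_def fps_X_power_mult_nth del: add_2_eq_Suc')
  qed (simp add: P_Mas_series_def fps_X_power_mult_nth)
qed

lemma bd_P_Gamma_series:
  "bd_series P_Gamma_series = 2 * Pe_series * P_Gamma_series
    + fps_deriv Pe_series * (1 + fps_deriv Pe_series)"
proof -
  \<comment> \<open>Any n labels would do as unmarked ones; the marks are 0 and 1.\<close>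
  define W where "W n = {..<n + 2} - {0, 1 :: nat}" for n
  have W: "finite (W n)" "card (W n) = n" for n
    by (simp_all add: W_def card_Diff_subset)
  note mult = egf_mult_subsets[of W, OF W]
  have "bd (ga_class n) = pe_class (Suc n)
      + (\<Sum>J\<in>Pow (W n). pe_class (card J) * ga_class (card (W n - J)))
      + (\<Sum>J\<in>Pow (W n). pe_class (Suc (card J)) * pe_class (Suc (card (W n - J))))
      + (\<Sum>J\<in>Pow (W n). ga_class (card J) * pe_class (card (W n - J)))" for n
  proof -
    have V: "finite {..<n + 2}" "0 \<in> {..<n + 2}" "1 \<in> {..<n + 2}" "0 \<noteq> (1::nat)" by auto
    show ?thesis using bd_Gamma[OF V W_def] by (simp only: W(2))
  qed
  then have "bd_series P_Gamma_series = fps_deriv Pe_series + Pe_series * P_Gamma_series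
      + fps_deriv Pe_series * fps_deriv Pe_series + P_Gamma_series * Pe_series"
    unfolding P_Gamma_series_egf Pe_series_egf egf_deriv mult egf_add bd_series_egf by presburger
  then show ?thesis by (simp add: algebra_simps)
qed

lemma bd_P_Mas_series:
  "bd_series P_Mas_series = (fps_X + Pe_series) * P_Mas_series
    + fps_X\<^sup>2 * (2 * fps_deriv St_series + St_series * P_Gamma_series
      + fps_deriv St_series * fps_deriv Pe_series)"
proof -
  define W where "W n = {..<n + 3} - {0, 1, 2 :: nat}" for n
  have W: "finite (W n)" "card (W n) = n" for n
    by (simp_all add: W_def card_Diff_subset)
  note mult = egf_mult_subsets[of W, OF W]
  have "bd (ma_class n) = st_class (Suc n) + st_class (Suc n) + of_nat n * ma_class (n - 1)
      + (\<Sum>J\<in>Pow (W n). st_class (card J) * ga_class (card (W n - J)))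
      + (\<Sum>J\<in>Pow (W n). st_class (Suc (card J)) * pe_class (Suc (card (W n - J))))
      + (\<Sum>J\<in>Pow (W n). ma_class (card J) * pe_class (card (W n - J)))" for n
  proof -
    have V: "finite {..<n + 3}" "0 \<in> {..<n + 3}" "1 \<in> {..<n + 3}" "2 \<in> {..<n + 3}"
      "0 \<noteq> (1::nat)" "0 \<noteq> (2::nat)" "1 \<noteq> (2::nat)" by auto
    show ?thesis using bd_Mas[OF V W_def] by (simp only: W(2) mult_2)
  qed
  then have "bd_series (egf ma_class) = fps_deriv St_series + fps_deriv St_series + fps_X * egf ma_class
      + St_series * P_Gamma_series + fps_deriv St_series * fps_deriv Pe_series + egf ma_class * Pe_series"
    unfolding P_Gamma_series_egf Pe_series_egf St_series_egf egf_X egf_deriv mult egf_add bd_series_egf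
    by presburger
  then show ?thesis
    unfolding P_Mas_series_egf bd_series_X_power by (simp add: algebra_simps)
qed

theorem theorem4p14:
  shows
    "(deriv_q (two_param P_Gamma_series)
        = 2 * two_param Pe_series * two_param P_Gamma_series
          + fps_deriv (two_param Pe_series) * (1 + fps_deriv (two_param Pe_series))
      \<and> at_q0 (two_param P_Gamma_series) = P_Gamma_series)
   \<and> (deriv_q (two_param P_Mas_series)
        = (fps_X + two_param Pe_series) * two_param P_Mas_series
          + fps_X\<^sup>2 * (2 * fps_deriv (two_param St_series)
                     + two_param St_series * two_param P_Gamma_series
                     + fps_deriv (two_param St_series) * fps_deriv (two_param Pe_series))
      \<and> at_q0 (two_param P_Mas_series) = P_Mas_series)"
proof -
  \<comment> \<open>The numeral 2 has to be carried through \<open>two_param\<close> as well, as 1 +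
    1.\<close>
  have two: "two_param 2 = 2"
    using two_param_add[of 1 1] by (simp only: one_add_one two_param_1)
  note hom = two_param_add two_param_mult two_param_deriv two two_param_1 two_param_X power2_eq_square
  show ?thesis
    unfolding deriv_q_two_param at_q0_two_param bd_P_Gamma_series bd_P_Mas_series hom
    by (intro conjI refl)
qed

end
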